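(* Let $n\ge 3$ be an integer, let $f:K_n\to\mathbb{R}$, and let $m=m_f:=\frac{1}{n}\sum_{i=1}^n f(a_i)$. (i) If $p=1$, then $$\sum_{i=1}^n|f(a_i)-m|\le \frac{2}{n}\,\mathrm{Var}_1(f).$$ Moreover, if the vertices are labeled so that $f(a_1)\ge\dots\ge f(a_k)\ge m\ge f(a_{k+1})\ge\dots\ge f(a_n)$, then equality holds if and only if $f(a_i)=f(a_1)$ for all $1\le i\le k$ and $f(a_i)=f(a_n)$ for all $k+1\le i\le n$. (ii) If $1<p<2$, then $$\sum_{i=1}^n|f(a_i)-m|^p\le \frac{\lfloor \frac n2\rfloor^{p-1}+\lceil \frac n2\rceil^{p-1}}{n^{p}}\,\mathrm{Var}_p(f)^p .$$ The maximizers are the functions $f:K_n\to\mathbb{R}$ with $f(K_n)=\{A,B\}$, $A>B$, and $|f^{-1}(A)|\in\{\lfloor \frac n2\rfloor,\lceil \frac n2\rceil\}$. (iii) If $p=2$, then $$\sum_{i=1}^n|f(a_i)-m|^2=\frac1n\,\mathrm{Var}_2(f)^2 .$$ (iv) If $2<p\le 3$, then $$\sum_{i=1}^n|f(a_i)-m|^p\le \frac{1}{2^{p-1}+n-2}\,\mathrm{Var}_p(f)^p,$$ and this inequality is sharp. Equality is attained for any function $f:K_n\to\mathbb{R}$ assuming the values $a+c,\underbrace{a,\dots,a}_{n-2},a-c$ with $a,c\in\mathbb{R}$. Moreover, the same sharp inequality, with the same maximizers, holds for all $p\in(3,3+\delta_n^1)$, where $$\delta_n^1=\frac{\log(\sqrt{n^2+4}+3n)-\log(4n)}{\log(n-1)}=\frac{1}{2n^2\log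 n}+O(1/n^3).$$ (v) If $3<p<4$ is such that $\frac{n-2}{n}\ge\frac{1+(n-1)^{p-1}}{n^{p-1}}$ (in particular, if $3<p<4$ and $$p\ge 3+\delta_n^2:=1+\frac{2\log n-\log(n^2-2n-1)}{\log n-\log(n-1)}=3+\frac2n+O\Big(\frac1{n^2}\Big),$$ in which case this condition is satisfied), then $$\sum_{i=1}^n|f(a_i)-m|^p\le\frac{1+(n-1)^{p-1}}{n^p}\,\mathrm{Var}_p(f)^p,$$ and this inequality is sharp. Equality is attained for Dirac delta functions. (vi) If $p\ge 4$, then $$\sum_{i=1}^n|f(a_i)-m|^p\le\frac{1+(n-1)^{p-1}}{n^p}\,\mathrm{Var}_p(f)^p,$$ and this inequality is sharp. Equality is attained for Dirac delta functions.
   Context: $K_n$ is the complete graph with vertices $a_1,\dots,a_n$; a function $f:K_n\to\mathbb{R}$ is a real function on the vertex set, and $f(K_n)$ is its set of values. The $p$-variation is $$\mathrm{Var}_p(f)=\Big(\sum_{1\le i<j\le n}|f(a_i)-f(a_j)|^p\Big)^{1/p}.$$ An inequality is sharp if its constant cannot be replaced by a smaller one. A maximizer is a non-constant function attaining equality (constant functions trivially give $0=0$). Dirac delta functions are functions with $f(K_n)=\{A,B\}$, $A\ne B$, and $|f^{-1}(A)|=1$. The $O(\cdot)$ terms are as $n\to\infty$. *)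

theory Defs
  imports Complex_Main "HOL-Library.Landau_Symbols"
begin

text \<open>
  The vertices of the complete graph on n vertices are the numbers 1, ..., n; a function on it is a
  function of type \<^typ>\<open>nat \<Rightarrow> real\<close>, of which only the values on \<^term>\<open>{1..n}\<close> matter.
\<close>

definition mean :: "nat \<Rightarrow> (nat \<Rightarrow> real) \<Rightarrow> real" where
  "mean n f = (1 / real n) * (\<Sum>i=1..n. f i)"

definition p_variation :: "real \<Rightarrow> nat \<Rightarrow> (nat \<Rightarrow> real) \<Rightarrow> real" where
  "p_variation p n f =
     (\<Sum>(i, j)\<in>{(i, j). 1 \<le> i \<and> i < j \<and> j \<le> n}. \<bar>f i - f j\<bar> powr p) powr (1 / p)"

definition deviation :: "real \<Rightarrow> nat \<Rightarrow> (nat \<Rightarrow> real) \<Rightarrow> real" where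
  "deviation p n f = (\<Sum>i=1..n. \<bar>f i - mean n f\<bar> powr p)"

definition variation_bound :: "real \<Rightarrow> nat \<Rightarrow> real \<Rightarrow> bool" where
  "variation_bound p n C \<longleftrightarrow> (\<forall>f. deviation p n f \<le> C * p_variation p n f powr p)"

definition sharp_variation_bound :: "real \<Rightarrow> nat \<Rightarrow> real \<Rightarrow> bool" where
  "sharp_variation_bound p n C \<longleftrightarrow>
     variation_bound p n C \<and> (\<forall>C'<C. \<not> variation_bound p n C')"

definition attains_equality :: "real \<Rightarrow> nat \<Rightarrow> real \<Rightarrow> (nat \<Rightarrow> real) \<Rightarrow> bool" where
  "attains_equality p n C f \<longleftrightarrow> deviation p n f = C * p_variation p n f powr p"

definition maximizer :: "real \<Rightarrow> nat \<Rightarrow> real \<Rightarrow> (nat \<Rightarrow> real) \<Rightarrow> bool" where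
  "maximizer p n C f \<longleftrightarrow> (\<exists>i\<in>{1..n}. \<exists>j\<in>{1..n}. f i \<noteq> f j) \<and> attains_equality p n C f"

definition dirac_delta :: "nat \<Rightarrow> (nat \<Rightarrow> real) \<Rightarrow> bool" where
  "dirac_delta n f \<longleftrightarrow>
     (\<exists>A B. A \<noteq> B \<and> f ` {1..n} = {A, B} \<and> card {i \<in> {1..n}. f i = A} = 1)"

definition delta1 :: "nat \<Rightarrow> real" where
  "delta1 n = (ln (sqrt (real n ^ 2 + 4) + 3 * real n) - ln (4 * real n)) / ln (real n - 1)"

definition delta2 :: "nat \<Rightarrow> real" where
  "delta2 n =
     (1 + (2 * ln (real n) - ln (real n ^ 2 - 2 * real n - 1)) / (ln (real n) - ln (real n - 1))) - 3"

end

theory Submission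
  imports Defs "HOL-Analysis.Analysis" "HOL-Real_Asymp.Real_Asymp"
begin

text \<open>
  Write x = f - m. The cases p = 1 and p = 2 are the triangle inequality and an identity.

  For 1 < p < 2, pairs of vertices on the same side of the mean contribute at most |x_i - x_j|^p to n
  times the left hand side, and pairs on opposite sides are estimated by a tangent line whose linear
  term is controlled by Chebyshev's sum inequality.

  For 2 < p \<le> 3, Clarkson's inequality reduces the claim to the negativity of the sum of
  sgn(x_i) sgn(x_j) ((a + b)^p - a^p - b^p) over all i, j, where a = |x_i| and b = |x_j|; this follows
  from an integral representation of y^p.

  For p > 3, an extremal function exists by compactness, and the first and second order conditions
  show that all but two vertices share one value lying between the other two values. This leaves
  an inequality in one parameter h in [0, 1], where h = 0 is the function with values
  a + c, a, ..., a, a - c and h = 1 is a Dirac delta; the difference of both sides is monotone in h and vanishes at h = 0 or h = 1.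
\<close>

section \<open>Ordered pairs\<close>

text \<open>For mean zero, n x_i is the sum of all x_i - x_j; this ties the two sides together. Each
  constant is the ratio of both sides on a candidate extremal function. The pairwise argument behind
  p \<le> 3 cannot go further: at p = 3 the form in the signs vanishes, and for 3 < p < 4 the same
  representation with one more Taylor term turns it into a square of the opposite sign. This is why
  an extremal function has to be located instead. For the functions that remain put q = p - 1 and
  \<eta> = (n - 2) / n. Up to a positive factor, the derivative in h of the difference of both sides
  is C n ((1 + h)^q - (1 - h)^q) minus (1 + \<eta> h)^q - (1 - \<eta> h)^q + 2 ((1 - \<eta>) h)^q.
  Near h = 0 its sign is that of C n - \<eta>, and for the Dirac delta constant C n \<le> \<eta> is
  exactly the hypothesis of (v). \<open>delta2\<close> solves this hypothesis for p after its term
  n^(1-p) has been replaced by the larger n^(-2). \<open>delta1\<close> enters through the bound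
  2^(p-3) \<le> 1 + 1 / (2 n^2).\<close>

lemma sum_ordered_pairs:
  fixes g :: "nat \<Rightarrow> nat \<Rightarrow> real"
  assumes sym: "\<And>i j. g i j = g j i" and diag: "\<And>i. g i i = 0"
  shows "(\<Sum>(i, j)\<in>{(i, j). 1 \<le> i \<and> i < j \<and> j \<le> n}. g i j) = (\<Sum>i=1..n. \<Sum>j=1..n. g i j) / 2"
proof -
  let ?U = "{(i, j). 1 \<le> i \<and> i < j \<and> j \<le> n}" and ?L = "{(i, j). 1 \<le> j \<and> j < i \<and> i \<le> n}"
  have fin: "finite ?U" "finite ?L"
    by (rule finite_subset[of _ "{1..n} \<times> {1..n}"]; force)+
  have "(\<Sum>i=1..n. \<Sum>j=1..n. g i j) = (\<Sum>(i, j)\<in>{1..n} \<times> {1..n}. g i j)"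
    by (simp add: sum.cartesian_product)
  also have "\<dots> = (\<Sum>(i, j)\<in>?U \<union> ?L. g i j)"
    by (rule sum.mono_neutral_right) (force simp: diag intro: ccontr)+
  also have "\<dots> = (\<Sum>(i, j)\<in>?U. g i j) + (\<Sum>(i, j)\<in>?L. g i j)"
    using fin by (intro sum.union_disjoint) auto
  also have "(\<Sum>(i, j)\<in>?L. g i j) = (\<Sum>(i, j)\<in>?U. g i j)"
    by (rule sum.reindex_bij_witness[of _ "\<lambda>(i,j). (j,i)" "\<lambda>(i,j). (j,i)"]) (auto simp: sym)
  finally show ?thesis by simp
qed

text \<open>Counting every pair twice, with a zero diagonal, lets double sums factor into products
  of single sums. The factors 1/2 in later statements come from here.\<close>

definition pair_sum :: "real \<Rightarrow> nat \<Rightarrow> (nat \<Rightarrow> real) \<Rightarrow> real" where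
  "pair_sum p n f = (\<Sum>i=1..n. \<Sum>j=1..n. \<bar>f i - f j\<bar> powr p)"

lemma pair_sum_nonneg: "0 \<le> pair_sum p n f"
  unfolding pair_sum_def by (intro sum_nonneg) auto

lemma p_variation_powr:
  assumes "p > 0"
  shows "p_variation p n f powr p = pair_sum p n f / 2"
proof -
  have "(\<Sum>(i, j)\<in>{(i, j). 1 \<le> i \<and> i < j \<and> j \<le> n}. \<bar>f i - f j\<bar> powr p) = pair_sum p n f / 2"
    unfolding pair_sum_def by (rule sum_ordered_pairs) (auto simp: abs_minus_commute)
  then show ?thesis
    unfolding p_variation_def using assms pair_sum_nonneg[of p n f] by (simp only: powr_powr) simp
qed

lemma p_variation_1: "p_variation 1 n f = (\<Sum>i=1..n. \<Sum>j=1..n. \<bar>f i - f j\<bar>) / 2"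
proof -
  have "p_variation 1 n f \<ge> 0" by (simp add: p_variation_def)
  then show ?thesis
    using p_variation_powr[of 1 n f] by (simp add: pair_sum_def)
qed

lemma pair_sum_pos:
  assumes "i \<in> {1..n}" "j \<in> {1..n}" "f i \<noteq> f j"
  shows "0 < pair_sum p n f"
proof -
  have "0 < \<bar>f i - f j\<bar> powr p" using assms by simp
  also have "\<dots> \<le> (\<Sum>j=1..n. \<bar>f i - f j\<bar> powr p)"
    using assms by (intro member_le_sum) auto
  also have "\<dots> \<le> pair_sum p n f"
    unfolding pair_sum_def
    using assms by (intro member_le_sum[of i "{1..n}" "\<lambda>i. \<Sum>j=1..n. \<bar>f i - f j\<bar> powr p"]) (auto intro: sum_nonneg)
  finally show ?thesis .
qed

lemma sum_deviation:
  assumes "n > 0"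
  shows "(\<Sum>j=1..n. f i - f j) = real n * (f i - mean n f)" "(\<Sum>i=1..n. f i - mean n f) = 0"
  using assms by (simp_all add: mean_def sum_subtractf algebra_simps)

section \<open>The exponents 1 and 2\<close>

text \<open>Equality case of the triangle inequality: after a change of sign the terms
  \<open>\<bar>h i\<bar> - h i\<close> are nonnegative and sum to zero, so each of them
  vanishes.\<close>

lemma abs_sum_eq_iff:
  fixes g :: "'a \<Rightarrow> real"
  assumes "finite I"
  shows "\<bar>\<Sum>i\<in>I. g i\<bar> = (\<Sum>i\<in>I. \<bar>g i\<bar>) \<longleftrightarrow> (\<forall>i\<in>I. 0 \<le> g i) \<or> (\<forall>i\<in>I. g i \<le> 0)"
proof -
  have pos: "\<forall>i\<in>I. 0 \<le> h i" if "(\<Sum>i\<in>I. h i) = (\<Sum>i\<in>I. \<bar>h i\<bar>)" for h :: "'a \<Rightarrow> real"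
  proof -
    have "(\<Sum>i\<in>I. \<bar>h i\<bar> - h i) = 0" using that by (simp add: sum_subtractf)
    then have "\<forall>i\<in>I. \<bar>h i\<bar> - h i = 0" using assms by (subst (asm) sum_nonneg_eq_0_iff) auto
    then show ?thesis by force
  qed
  show ?thesis
  proof
    assume eq: "\<bar>\<Sum>i\<in>I. g i\<bar> = (\<Sum>i\<in>I. \<bar>g i\<bar>)"
    show "(\<forall>i\<in>I. 0 \<le> g i) \<or> (\<forall>i\<in>I. g i \<le> 0)"
    proof (cases "0 \<le> (\<Sum>i\<in>I. g i)")
      case True
      with eq have "(\<Sum>i\<in>I. g i) = (\<Sum>i\<in>I. \<bar>g i\<bar>)" by linarith
      from pos[OF this] show ?thesis by blast
    next
      case False
      with eq have "(\<Sum>i\<in>I. - g i) = (\<Sum>i\<in>I. \<bar>- g i\<bar>)" by (simp add: sum_negf)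
      from pos[OF this] show ?thesis by simp
    qed
  next
    assume "(\<forall>i\<in>I. 0 \<le> g i) \<or> (\<forall>i\<in>I. g i \<le> 0)"
    then show "\<bar>\<Sum>i\<in>I. g i\<bar> = (\<Sum>i\<in>I. \<bar>g i\<bar>)"
    proof
      assume *: "\<forall>i\<in>I. 0 \<le> g i"
      then have "(\<Sum>i\<in>I. \<bar>g i\<bar>) = (\<Sum>i\<in>I. g i)" by (intro sum.cong) auto
      moreover have "0 \<le> (\<Sum>i\<in>I. g i)" using * by (intro sum_nonneg) auto
      ultimately show ?thesis by simp
    next
      assume *: "\<forall>i\<in>I. g i \<le> 0"
      then have "(\<Sum>i\<in>I. \<bar>g i\<bar>) = (\<Sum>i\<in>I. - g i)" by (intro sum.cong) auto
      moreover have "(\<Sum>i\<in>I. g i) \<le> 0" using * by (intro sum_nonpos) auto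
      ultimately show ?thesis by (simp add: sum_negf)
    qed
  qed
qed

lemma abs_deviation_le:
  assumes "n > 0"
  shows "\<bar>f i - mean n f\<bar> \<le> (\<Sum>j=1..n. \<bar>f i - f j\<bar>) / real n"
    and "\<bar>f i - mean n f\<bar> = (\<Sum>j=1..n. \<bar>f i - f j\<bar>) / real n \<longleftrightarrow>
      (\<forall>j\<in>{1..n}. f j \<le> f i) \<or> (\<forall>j\<in>{1..n}. f i \<le> f j)"
proof -
  have eq: "\<bar>f i - mean n f\<bar> = \<bar>\<Sum>j=1..n. f i - f j\<bar> / real n"
    using assms unfolding sum_deviation(1)[OF assms] by (simp add: abs_mult)
  show "\<bar>f i - mean n f\<bar> \<le> (\<Sum>j=1..n. \<bar>f i - f j\<bar>) / real n"
    unfolding eq using assms by (intro divide_right_mono sum_abs) auto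
  have "\<bar>f i - mean n f\<bar> = (\<Sum>j=1..n. \<bar>f i - f j\<bar>) / real n \<longleftrightarrow>
    \<bar>\<Sum>j=1..n. f i - f j\<bar> = (\<Sum>j=1..n. \<bar>f i - f j\<bar>)"
    unfolding eq using assms by simp
  also have "\<dots> \<longleftrightarrow> (\<forall>j\<in>{1..n}. 0 \<le> f i - f j) \<or> (\<forall>j\<in>{1..n}. f i - f j \<le> 0)"
    by (rule abs_sum_eq_iff) simp
  finally show "\<bar>f i - mean n f\<bar> = (\<Sum>j=1..n. \<bar>f i - f j\<bar>) / real n \<longleftrightarrow>
      (\<forall>j\<in>{1..n}. f j \<le> f i) \<or> (\<forall>j\<in>{1..n}. f i \<le> f j)" by simp
qed

text \<open>A sum of termwise inequalities is an equality only if every term is. In the term of i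
  all differences f i - f j then have one sign, so f i is the largest or the smallest value.\<close>

lemma deviation_1:
  assumes "n > 0"
  shows "(\<Sum>i=1..n. \<bar>f i - mean n f\<bar>) \<le> 2 / real n * p_variation 1 n f"
    and "(\<Sum>i=1..n. \<bar>f i - mean n f\<bar>) = 2 / real n * p_variation 1 n f \<longleftrightarrow>
      (\<forall>i\<in>{1..n}. (\<forall>j\<in>{1..n}. f j \<le> f i) \<or> (\<forall>j\<in>{1..n}. f i \<le> f j))"
proof -
  have eq: "2 / real n * p_variation 1 n f = (\<Sum>i=1..n. (\<Sum>j=1..n. \<bar>f i - f j\<bar>) / real n)"
    by (simp add: p_variation_1 flip: sum_divide_distrib)
  show "(\<Sum>i=1..n. \<bar>f i - mean n f\<bar>) \<le> 2 / real n * p_variation 1 n f"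
    unfolding eq by (intro sum_mono abs_deviation_le assms)
  let ?h = "\<lambda>i. (\<Sum>j=1..n. \<bar>f i - f j\<bar>) / real n - \<bar>f i - mean n f\<bar>"
  have "(\<Sum>i=1..n. \<bar>f i - mean n f\<bar>) = 2 / real n * p_variation 1 n f \<longleftrightarrow> (\<Sum>i=1..n. ?h i) = 0"
    unfolding eq by (auto simp: sum_subtractf)
  also have "\<dots> \<longleftrightarrow> (\<forall>i\<in>{1..n}. ?h i = 0)"
    using abs_deviation_le(1)[OF assms, of f] by (intro sum_nonneg_eq_0_iff) auto
  also have "\<dots> \<longleftrightarrow> (\<forall>i\<in>{1..n}. \<bar>f i - mean n f\<bar> = (\<Sum>j=1..n. \<bar>f i - f j\<bar>) / real n)"
    by auto
  finally show "(\<Sum>i=1..n. \<bar>f i - mean n f\<bar>) = 2 / real n * p_variation 1 n f \<longleftrightarrow>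
      (\<forall>i\<in>{1..n}. (\<forall>j\<in>{1..n}. f j \<le> f i) \<or> (\<forall>j\<in>{1..n}. f i \<le> f j))"
    using abs_deviation_le(2)[OF assms, of f] by simp
qed

lemma mean_eq_bound_imp_const:
  assumes "n > 0" "i \<in> {1..n}" and b: "(\<forall>j\<in>{1..n}. mean n f \<le> f j) \<or> (\<forall>j\<in>{1..n}. f j \<le> mean n f)"
  shows "f i = mean n f"
proof -
  have "\<bar>\<Sum>i=1..n. f i - mean n f\<bar> = (\<Sum>i=1..n. \<bar>f i - mean n f\<bar>)"
    using b by (subst abs_sum_eq_iff) auto
  then have "(\<Sum>i=1..n. \<bar>f i - mean n f\<bar>) = 0" using sum_deviation(2)[OF assms(1)] by simp
  then have "\<forall>i\<in>{1..n}. \<bar>f i - mean n f\<bar> = 0" by (subst (asm) sum_nonneg_eq_0_iff) auto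
  then show ?thesis using assms(2) by simp
qed

text \<open>By \<open>deviation_1\<close> equality means that every value is the maximum f (a 1) or
  the minimum f (a n). It remains to see which labels take which of the two; the mean decides this
  unless f is constant.\<close>

lemma deviation_1_equality:
  assumes bij: "bij_betw a {1..n} {1..n}" and k: "1 \<le> k" "k < n"
    and mono: "\<And>i j. 1 \<le> i \<Longrightarrow> i \<le> j \<Longrightarrow> j \<le> n \<Longrightarrow> f (a j) \<le> f (a i)"
    and m: "mean n f \<le> f (a k)" "f (a (k + 1)) \<le> mean n f"
  shows "(\<Sum>i=1..n. \<bar>f i - mean n f\<bar>) = 2 / real n * p_variation 1 n f \<longleftrightarrow>
    (\<forall>i\<in>{1..k}. f (a i) = f (a 1)) \<and> (\<forall>i\<in>{k+1..n}. f (a i) = f (a n))"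
proof -
  have n: "n > 0" using k by simp
  have all: "(\<forall>i\<in>{1..n}. P i) \<longleftrightarrow> (\<forall>i\<in>{1..n}. P (a i))" for P
    using bij by (metis bij_betw_imp_surj_on imageE imageI)
  have ext: "(\<forall>i\<in>{1..n}. (\<forall>j\<in>{1..n}. f j \<le> f i) \<or> (\<forall>j\<in>{1..n}. f i \<le> f j)) \<longleftrightarrow>
    (\<forall>i\<in>{1..n}. f (a i) = f (a 1) \<or> f (a i) = f (a n))"
  proof -
    have "(\<forall>j\<in>{1..n}. f (a j) \<le> f (a i)) \<longleftrightarrow> f (a i) = f (a 1)"
      "(\<forall>j\<in>{1..n}. f (a i) \<le> f (a j)) \<longleftrightarrow> f (a i) = f (a n)" if "i \<in> {1..n}" for i
    proof -
      have "f (a i) \<le> f (a 1)" "f (a n) \<le> f (a i)"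
        "\<And>j. j \<in> {1..n} \<Longrightarrow> f (a j) \<le> f (a 1)" "\<And>j. j \<in> {1..n} \<Longrightarrow> f (a n) \<le> f (a j)"
        "1 \<in> {1..n}" "n \<in> {1..n}"
        using that n by (auto intro!: mono)
      then show "(\<forall>j\<in>{1..n}. f (a j) \<le> f (a i)) \<longleftrightarrow> f (a i) = f (a 1)"
        "(\<forall>j\<in>{1..n}. f (a i) \<le> f (a j)) \<longleftrightarrow> f (a i) = f (a n)"
        by (metis order_antisym)+
    qed
    then show ?thesis
      unfolding all[of "\<lambda>i. (\<forall>j\<in>{1..n}. f j \<le> f i) \<or> (\<forall>j\<in>{1..n}. f i \<le> f j)"]
        all[of "\<lambda>j. f j \<le> f (a _)"] all[of "\<lambda>j. f (a _) \<le> f j"] by simp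
  qed
  have "(\<forall>i\<in>{1..n}. f (a i) = f (a 1) \<or> f (a i) = f (a n)) \<longleftrightarrow>
    (\<forall>i\<in>{1..k}. f (a i) = f (a 1)) \<and> (\<forall>i\<in>{k+1..n}. f (a i) = f (a n))" (is "?l \<longleftrightarrow> ?r")
  proof
    assume r: ?r
    show ?l
    proof
      fix i assume "i \<in> {1..n}"
      then have "i \<in> {1..k} \<or> i \<in> {k+1..n}" by auto
      with r show "f (a i) = f (a 1) \<or> f (a i) = f (a n)" by blast
    qed
  next
    assume l: ?l
    \<comment> \<open>The only obstruction is a label up to k with the minimal value, or a label
      above k with the maximal one. Then all values lie on one side of the mean, which forces f to
      be constant, and the two values coincide.\<close>
    have const: "f (a 1) = f (a n)" if "f (a k) \<le> f (a n) \<or> f (a 1) \<le> f (a (k+1))"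
    proof -
      have "(\<forall>j\<in>{1..n}. mean n f \<le> f j) \<or> (\<forall>j\<in>{1..n}. f j \<le> mean n f)"
      proof (rule disjE[OF that])
        assume *: "f (a k) \<le> f (a n)"
        have "f (a n) \<le> f (a j)" if "j \<in> {1..n}" for j using that by (intro mono) auto
        with * m(1) show ?thesis
          unfolding all[of "\<lambda>j. mean n f \<le> f j"] all[of "\<lambda>j. f j \<le> mean n f"] by force
      next
        assume *: "f (a 1) \<le> f (a (k+1))"
        have "f (a j) \<le> f (a 1)" if "j \<in> {1..n}" for j using that by (intro mono) auto
        with * m(2) show ?thesis
          unfolding all[of "\<lambda>j. mean n f \<le> f j"] all[of "\<lambda>j. f j \<le> mean n f"] by force
      qed
      moreover have "a 1 \<in> {1..n}" "a n \<in> {1..n}" using bij n by (auto simp: bij_betw_def)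
      ultimately show ?thesis using mean_eq_bound_imp_const[OF n] by metis
    qed
    show ?r
    proof (intro conjI ballI)
      fix i assume i: "i \<in> {1..k}"
      then have "f (a k) \<le> f (a i)" using k by (intro mono) auto
      moreover have "i \<in> {1..n}" using i k by auto
      ultimately show "f (a i) = f (a 1)" using l const by metis
    next
      fix i assume i: "i \<in> {k+1..n}"
      then have "f (a i) \<le> f (a (k+1))" using k by (intro mono) auto
      moreover have "i \<in> {1..n}" using i k by auto
      ultimately show "f (a i) = f (a n)" using l const by metis
    qed
  qed
  then show ?thesis using deviation_1(2)[OF n] ext by simp
qed

lemma deviation_2:
  assumes "n > 0"
  shows "(\<Sum>i=1..n. \<bar>f i - mean n f\<bar> ^ 2) = 1 / real n * p_variation 2 n f ^ 2"
proof -
  define x where "x i = f i - mean n f" for i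
  have sum0: "(\<Sum>i=1..n. x i) = 0" unfolding x_def using sum_deviation(2)[OF assms] .
  have v: "p_variation 2 n f \<ge> 0" by (simp add: p_variation_def)
  have "p_variation 2 n f ^ 2 = pair_sum 2 n f / 2"
    using p_variation_powr[of 2 n f] v by simp
  also have "pair_sum 2 n f = (\<Sum>i=1..n. \<Sum>j=1..n. (x i)^2 + (x j)^2 - 2 * (x i * x j))"
    unfolding pair_sum_def
    by (intro sum.cong refl) (simp add: powr_numeral x_def power2_eq_square algebra_simps)
  also have "\<dots> = 2 * real n * (\<Sum>i=1..n. (x i)^2) - 2 * ((\<Sum>i=1..n. x i) * (\<Sum>j=1..n. x j))"
    by (simp add: sum.distrib sum_subtractf sum_product sum_distrib_left algebra_simps)
  finally show ?thesis using assms sum0 by (simp add: x_def)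
qed

section \<open>Inequalities for powers\<close>

text \<open>Strict convexity through the mean value theorem. The point b = 0 is separate because the
  derivative rule for \<open>powr\<close> needs a positive base; there the left side is (1 - r)
  a^r.\<close>

lemma powr_tangent_less:
  fixes a b r :: real
  assumes "a > 0" "b \<ge> 0" "a \<noteq> b" "r > 1"
  shows "a powr r + r * a powr (r - 1) * (b - a) < b powr r"
proof (cases "b = 0")
  case True
  have "a powr r = a powr (r - 1) * a" using assms powr_add[of a "r - 1" 1] by simp
  then show ?thesis using assms True by (simp add: mult.assoc mult_strict_right_mono)
next
  case False
  then have b: "b > 0" using assms by simp
  have der: "((\<lambda>x. x powr r) has_real_derivative r * x powr (r - 1)) (at x)" if "x > 0" for x
    using that by (rule has_real_derivative_powr)
  show ?thesis
  proof (cases "a < b")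
    case True
    then obtain z where z: "a < z" "z < b" "b powr r - a powr r = (b - a) * (r * z powr (r - 1))"
      using MVT2[of a b "\<lambda>x. x powr r" "\<lambda>x. r * x powr (r - 1)"] der assms by force
    moreover have "a powr (r - 1) < z powr (r - 1)" using z assms by (intro powr_less_mono2) auto
    then have "(b - a) * (r * a powr (r - 1)) < (b - a) * (r * z powr (r - 1))"
      using True assms by simp
    ultimately show ?thesis by (simp add: algebra_simps)
  next
    case F: False
    then obtain z where z: "b < z" "z < a" "a powr r - b powr r = (a - b) * (r * z powr (r - 1))"
      using MVT2[of b a "\<lambda>x. x powr r" "\<lambda>x. r * x powr (r - 1)"] der assms b by force
    moreover have "z powr (r - 1) < a powr (r - 1)" using z assms b by (intro powr_less_mono2) auto
    then have "(a - b) * (r * z powr (r - 1)) < (a - b) * (r * a powr (r - 1))"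
      using F assms by simp
    ultimately show ?thesis by (simp add: algebra_simps)
  qed
qed

text \<open>The concave case is the convex one for the inverse function:
  \<open>powr_tangent_less\<close> with exponent 1/r is applied to the powers s = b^r and t =
  a^r.\<close>

lemma powr_less_tangent:
  fixes a b r :: real
  assumes "a > 0" "b \<ge> 0" "a \<noteq> b" "0 < r" "r < 1"
  shows "b powr r < a powr r + r * a powr (r - 1) * (b - a)"
proof (cases "b = 0")
  case True
  have "a powr r = a powr (r - 1) * a" using assms powr_add[of a "r - 1" 1] by simp
  then show ?thesis using assms True by (simp add: mult.assoc)
next
  case False
  define s where "s = b powr r"
  define t where "t = a powr r"
  have eq: "s powr (1/r) = b" "t powr (1/r) = a"
    using assms False by (simp_all add: s_def t_def powr_powr)
  then have "s \<noteq> t" using assms by auto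
  then have "t powr (1/r) + 1/r * t powr (1/r - 1) * (s - t) < s powr (1/r)"
    using assms False by (intro powr_tangent_less) (auto simp: s_def t_def)
  then have *: "1/r * t powr (1/r - 1) * (s - t) < b - a" using eq by simp
  have "t powr (1/r - 1) = a powr (1 - r)"
    using assms by (simp add: t_def powr_powr algebra_simps)
  then have "a powr (1 - r) * (s - t) < r * (b - a)" using * assms by (simp add: field_simps)
  then have "a powr (r - 1) * (a powr (1 - r) * (s - t)) < a powr (r - 1) * (r * (b - a))"
    using assms by (intro mult_strict_left_mono) auto
  moreover have "a powr (r - 1) * a powr (1 - r) = 1" using assms by (simp flip: powr_add)
  ultimately show ?thesis by (simp add: s_def t_def algebra_simps)
qed

lemma powr_le_tangent:
  fixes a b r :: real
  assumes "a > 0" "b \<ge> 0" "0 < r" "r < 1"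
  shows "b powr r \<le> a powr r + r * a powr (r - 1) * (b - a)"
  using powr_less_tangent[of a b r] assms by (cases "a = b") auto

lemma powr_diff_le:
  fixes a b q :: real
  assumes "0 \<le> b" "b \<le> a" "0 < q" "q \<le> 1"
  shows "a powr q - b powr q \<le> (a - b) powr q"
proof (cases "a = 0")
  case False
  then have a: "a > 0" using assms by simp
  have le: "t \<le> t powr q" if "0 \<le> t" "t \<le> 1" for t :: real
    using powr_mono'[of q 1 t] that assms by (cases "t = 0") auto
  have "1 = b / a + (a - b) / a" using a by (simp add: field_simps)
  also have "\<dots> \<le> (b / a) powr q + ((a - b) / a) powr q"
    using assms a by (intro add_mono le) (auto simp: field_simps)
  also have "\<dots> = (b powr q + (a - b) powr q) / a powr q"
    using assms a by (simp add: powr_divide add_divide_distrib)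
  finally show ?thesis using a by (simp add: field_simps)
qed (use assms in simp)

section \<open>Functions with two values\<close>

lemma sum_two_valued:
  fixes g :: "real \<Rightarrow> real"
  assumes "f ` {1..n} \<subseteq> {A, B}"
  shows "(\<Sum>i=1..n. g (f i)) = real (card {i\<in>{1..n}. f i = A}) * g A
    + (real n - real (card {i\<in>{1..n}. f i = A})) * g B"
proof -
  let ?S = "{i\<in>{1..n}. f i = A}"
  have "(\<Sum>i=1..n. g (f i)) = (\<Sum>i\<in>?S. g (f i)) + (\<Sum>i\<in>{1..n} - ?S. g (f i))"
    by (subst add.commute, rule sum.subset_diff) auto
  also have "(\<Sum>i\<in>?S. g (f i)) = (\<Sum>i\<in>?S. g A)" by (rule sum.cong) auto
  also have "(\<Sum>i\<in>{1..n} - ?S. g (f i)) = (\<Sum>i\<in>{1..n} - ?S. g B)"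
    using assms by (intro sum.cong) (auto simp: image_subset_iff)
  also have "real (card ({1..n} - ?S)) = real n - real (card ?S)"
    by (subst card_Diff_subset) (auto intro!: of_nat_diff card_mono[of "{1..n}", simplified])
  then have "(\<Sum>i\<in>{1..n} - ?S. g B) = (real n - real (card ?S)) * g B" by simp
  finally show ?thesis by simp
qed

text \<open>The ratio of both sides depends only on the number k of vertices with value A, since A
  and B have distances (n - k) d / n and k d / n from the mean. Balanced k serves the exponents
  below 2, and k = 1 the Dirac deltas.\<close>

lemma two_valued_equality:
  assumes f: "f ` {1..n} \<subseteq> {A, B}" and n: "n > 0" and p: "p > 1"
    and k: "k = real (card {i\<in>{1..n}. f i = A})"
  shows "attains_equality p n ((k powr (p - 1) + (real n - k) powr (p - 1)) / real n powr p) f"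
proof -
  have k0: "0 \<le> k" "k \<le> real n"
  proof -
    have "card {i\<in>{1..n}. f i = A} \<le> card {1..n}" by (intro card_mono) auto
    then show "0 \<le> k" "k \<le> real n" unfolding k by auto
  qed
  have s: "(\<Sum>i=1..n. g (f i)) = k * g A + (real n - k) * g B" for g
    unfolding k by (rule sum_two_valued[OF f])
  have m: "mean n f = (k * A + (real n - k) * B) / n" using s[of "\<lambda>x. x"] by (simp add: mean_def)
  define d where "d = \<bar>A - B\<bar>"
  have "A - mean n f = (real n - k) / n * (A - B)" "B - mean n f = - (k / n * (A - B))"
    using n unfolding m by (simp_all add: field_simps)
  then have abs: "\<bar>A - mean n f\<bar> = (real n - k) / n * d" "\<bar>B - mean n f\<bar> = k / n * d"
    using k0 by (simp_all add: abs_mult d_def)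
  have pw: "t powr p = t * t powr (p - 1)" if "0 \<le> t" for t :: real
    using that powr_add[of t 1 "p - 1"] by simp
  have "deviation p n f = k * \<bar>A - mean n f\<bar> powr p + (real n - k) * \<bar>B - mean n f\<bar> powr p"
    unfolding deviation_def using s[of "\<lambda>x. \<bar>x - mean n f\<bar> powr p"] .
  also have "\<dots> = (k * (real n - k) powr p + (real n - k) * k powr p) / real n powr p * d powr p"
  proof -
    have "((real n - k) / n * d) powr p = (real n - k) powr p / real n powr p * d powr p"
      "(k / n * d) powr p = k powr p / real n powr p * d powr p"
      using k0 by (simp_all add: powr_mult powr_divide d_def)
    then show ?thesis unfolding abs by (simp only:) (simp add: add_divide_distrib distrib_right)
  qed
  also have "\<dots> = (k powr (p - 1) + (real n - k) powr (p - 1)) / real n powr p * (k * (real n - k) * d powr p)"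
    using k0 by (simp add: pw[of k] pw[of "real n - k"] field_simps)
  also have "k * (real n - k) * d powr p = pair_sum p n f / 2"
  proof -
    have "pair_sum p n f = (\<Sum>i=1..n. k * \<bar>f i - A\<bar> powr p + (real n - k) * \<bar>f i - B\<bar> powr p)"
      unfolding pair_sum_def using s[of "\<lambda>x. \<bar>f _ - x\<bar> powr p"] by simp
    also have "\<dots> = 2 * (k * (real n - k) * d powr p)"
      using s[of "\<lambda>x. k * \<bar>x - A\<bar> powr p + (real n - k) * \<bar>x - B\<bar> powr p"] p
      by (simp add: d_def abs_minus_commute algebra_simps)
    finally show ?thesis by simp
  qed
  finally show ?thesis
    using p by (simp add: attains_equality_def p_variation_powr)
qed

section \<open>Exponents between 1 and 2\<close>

text \<open>The identity behind Chebyshev's sum inequality: a covariance is a sum over pairs, so a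
  sign or an upper bound for each pair carries over to the sum.\<close>

lemma covariance_sum:
  fixes a g :: "'a \<Rightarrow> real"
  assumes "finite I" "I \<noteq> {}"
  shows "(\<Sum>i\<in>I. g i * (a i - (\<Sum>i\<in>I. a i) / real (card I)))
    = (\<Sum>i\<in>I. \<Sum>j\<in>I. (g i - g j) * (a i - a j)) / (2 * real (card I))"
proof -
  let ?G = "\<Sum>i\<in>I. g i" and ?A = "\<Sum>i\<in>I. a i" and ?GA = "\<Sum>i\<in>I. g i * a i"
  have c: "real (card I) > 0" using assms by (simp add: card_gt_0_iff)
  have "(\<Sum>i\<in>I. \<Sum>j\<in>I. (g i - g j) * (a i - a j))
    = (\<Sum>i\<in>I. \<Sum>j\<in>I. g i * a i + g j * a j - g i * a j - a i * g j)"
    by (simp add: algebra_simps)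
  also have "\<dots> = 2 * real (card I) * ?GA - 2 * (?G * ?A)"
    by (simp add: sum.distrib sum_subtractf flip: sum_distrib_left sum_distrib_right)
  finally have dbl: "(\<Sum>i\<in>I. \<Sum>j\<in>I. (g i - g j) * (a i - a j)) = 2 * real (card I) * ?GA - 2 * (?G * ?A)" .
  have lin: "(\<Sum>i\<in>I. g i * (a i - m)) = ?GA - ?G * m" for m
    by (simp add: right_diff_distrib sum_subtractf sum_distrib_right)
  show ?thesis using c unfolding lin dbl by (simp add: field_simps)
qed

text \<open>This is the contribution of two vertices on the same side of the mean. The bounds are
  monotonicity and subadditivity of the power q, for b \<le> a by symmetry.\<close>

lemma powr_diff_mult_le:
  fixes a b q :: real
  assumes "0 \<le> a" "0 \<le> b" "0 < q" "q \<le> 1"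
  shows "0 \<le> (a powr q - b powr q) * (a - b)"
    and "(a powr q - b powr q) * (a - b) \<le> \<bar>a - b\<bar> powr (q + 1)"
proof -
  have *: "0 \<le> (a powr q - b powr q) * (a - b) \<and>
    (a powr q - b powr q) * (a - b) \<le> \<bar>a - b\<bar> powr (q + 1)" if "0 \<le> b" "b \<le> a" for a b :: real
  proof -
    have "b powr q \<le> a powr q" using that assms by (intro powr_mono2) auto
    moreover have "(a powr q - b powr q) * (a - b) \<le> (a - b) powr q * (a - b)"
      using that assms by (intro mult_right_mono powr_diff_le) auto
    ultimately show ?thesis using that by (simp add: powr_add)
  qed
  have "0 \<le> (a powr q - b powr q) * (a - b) \<and>
    (a powr q - b powr q) * (a - b) \<le> \<bar>a - b\<bar> powr (q + 1)"
    using *[of b a] *[of a b] assms by (cases "b \<le> a") (auto simp: algebra_simps abs_minus_commute)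
  then show "0 \<le> (a powr q - b powr q) * (a - b)"
    "(a powr q - b powr q) * (a - b) \<le> \<bar>a - b\<bar> powr (q + 1)" by auto
qed

text \<open>Divided by (a + b)^(q+1), this is the tangent to t^q + (1 - t)^q at t = v. A two-valued
  function of mean zero with the fractions u and v of vertices on the two sides satisfies u a = v b,
  hence a / (a + b) = v, so the estimate is exact for it. The linear term has no fixed sign and is
  controlled only after summation.\<close>

lemma powr_sum_mult_le:
  fixes a b u v q :: real
  assumes q: "0 < q" "q < 1" and uv: "0 < u" "0 < v" "u + v = 1" and ab: "0 \<le> a" "0 \<le> b"
  shows "(a powr q + b powr q) * (a + b) \<le> (u powr q + v powr q) * (a + b) powr (q + 1)
    - q * (u powr (q - 1) - v powr (q - 1)) * ((a + b) powr q * (u * a - v * b))"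
proof (cases "a + b = 0")
  case True
  then show ?thesis using ab by simp
next
  case False
  define s where "s = a + b"
  have s: "s > 0" using False ab by (simp add: s_def)
  have "(a / s) powr q \<le> v powr q + q * v powr (q - 1) * (a / s - v)"
    "(b / s) powr q \<le> u powr q + q * u powr (q - 1) * (b / s - u)"
    using assms s by (intro powr_le_tangent; simp)+
  moreover have "b / s = 1 - a / s" using s by (simp add: s_def field_simps)
  then have "b / s - u = - (a / s - v)" using uv by simp
  ultimately have "(a / s) powr q + (b / s) powr q \<le> u powr q + v powr q
    - q * (u powr (q - 1) - v powr (q - 1)) * (a / s - v)"
    by (simp add: algebra_simps)
  also have "a / s - v = (u * a - v * b) / s"
  proof -
    have "a - v * s = u * a - v * b" using uv(3) unfolding s_def by algebra
    then show ?thesis using s by (simp add: field_simps)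
  qed
  also have "(a / s) powr q + (b / s) powr q = (a powr q + b powr q) / s powr q"
    using s ab by (simp add: powr_divide add_divide_distrib)
  finally have "(a powr q + b powr q) / s powr q * (s powr q * s) \<le> (u powr q + v powr q
    - q * (u powr (q - 1) - v powr (q - 1)) * ((u * a - v * b) / s)) * (s powr q * s)"
    using s by (intro mult_right_mono) auto
  moreover have "X * s \<le> c * (T * s) - k * (T * w)"
    if "X / T * (T * s) \<le> (c - k * (w / s)) * (T * s)" "T > 0" for X c k T w
    using that s by (simp add: left_diff_distrib mult.commute[of w])
  ultimately show ?thesis using s by (simp add: powr_add s_def[symmetric])
qed

lemma double_sum_split:
  fixes h :: "nat \<Rightarrow> nat \<Rightarrow> real"
  assumes "P \<inter> N = {}" "finite P" "finite N" and sym: "\<And>i j. h i j = h j i"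
  shows "(\<Sum>i\<in>P \<union> N. \<Sum>j\<in>P \<union> N. h i j)
    = (\<Sum>i\<in>P. \<Sum>j\<in>P. h i j) + 2 * (\<Sum>i\<in>P. \<Sum>j\<in>N. h i j) + (\<Sum>i\<in>N. \<Sum>j\<in>N. h i j)"
proof -
  have "(\<Sum>i\<in>N. \<Sum>j\<in>P. h i j) = (\<Sum>i\<in>P. \<Sum>j\<in>N. h i j)"
    by (subst sum.swap) (simp add: sym)
  then show ?thesis using assms by (simp add: sum.union_disjoint sum.distrib)
qed

text \<open>
  Writing the deviation as half the sum of
  (phi(x_i) - phi(x_j)) (x_i - x_j) / n over all pairs, where phi(t) = sgn(t) |t|^(p-1), pairs on opposite sides of the mean are estimated by the
  tangent of t^(p-1) + (1-t)^(p-1) at the optimal t; the linear term is then controlled by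
  Chebyshev's sum inequality.
\<close>
lemma deviation_le_split:
  fixes x :: "nat \<Rightarrow> real"
  assumes q: "0 < q" "q < 1" and fin: "finite P" "finite N" and PN: "P \<noteq> {}" "N \<noteq> {}" "P \<inter> N = {}"
    and card: "card P \<le> card N" and uv: "0 < u" "0 < v" "u + v = 1"
    and n: "real (card P) = u * n" "real (card N) = v * n" and "n > 0"
    and x: "\<And>i. i \<in> P \<Longrightarrow> 0 \<le> x i" "\<And>i. i \<in> N \<Longrightarrow> x i \<le> 0" and sum0: "(\<Sum>i\<in>P \<union> N. x i) = 0"
  defines "c \<equiv> u powr q + v powr q"
  shows "2 * n * (\<Sum>i\<in>P \<union> N. \<bar>x i\<bar> powr (q + 1))
      + (c - 1) * (\<Sum>i\<in>P. \<Sum>j\<in>P. \<bar>x i - x j\<bar> powr (q + 1))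
      + (c - 1 - q * (u powr (q - 1) - v powr (q - 1)) * u) * (\<Sum>i\<in>N. \<Sum>j\<in>N. \<bar>x i - x j\<bar> powr (q + 1))
    \<le> c * (\<Sum>i\<in>P \<union> N. \<Sum>j\<in>P \<union> N. \<bar>x i - x j\<bar> powr (q + 1))"
proof -
  define \<phi> where "\<phi> t = sgn t * \<bar>t\<bar> powr q" for t :: real
  define h where "h i j = (\<phi> (x i) - \<phi> (x j)) * (x i - x j)" for i j
  define \<kappa> where "\<kappa> = q * (u powr (q - 1) - v powr (q - 1))"
  define w where "w i j = \<bar>x i - x j\<bar> powr (q + 1)" for i j
  \<comment> \<open>P is the smaller side. As q - 1 < 0, this gives \<kappa> a sign that allows a
    lower bound for the linear terms to be multiplied by it.\<close>
  have uv_le: "u \<le> v" using n card \<open>n > 0\<close> by (metis mult_le_cancel_right not_less of_nat_mono)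
  have kappa: "0 \<le> \<kappa>" unfolding \<kappa>_def using q uv uv_le by (simp add: powr_mono2')
  have phi0: "\<phi> t = t powr q" if "t \<ge> 0" for t using that by (cases "t = 0") (auto simp: \<phi>_def)
  have phi1: "\<phi> t = - ((- t) powr q)" if "t \<le> 0" for t using that by (cases "t = 0") (auto simp: \<phi>_def)
  have hs: "h i j = h j i" for i j by (simp add: h_def algebra_simps)
  have ws: "w i j = w j i" for i j by (simp add: w_def abs_minus_commute)
  have PP: "h i j \<le> w i j" if "i \<in> P" "j \<in> P" for i j
    using powr_diff_mult_le(2)[of "x i" "x j" q] x that q by (simp add: h_def w_def phi0)
  have NN: "h i j \<le> w i j" if "i \<in> N" "j \<in> N" for i j
    using powr_diff_mult_le(2)[of "- x i" "- x j" q] x that q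
    by (simp add: h_def w_def phi1 algebra_simps abs_minus_commute)
  have PN': "h i j \<le> c * w i j - \<kappa> * ((x i - x j) powr q * (u * x i - v * (- x j)))" if "i \<in> P" "j \<in> N" for i j
    using powr_sum_mult_le[OF q uv, of "x i" "- x j"] x[of i] x[of j] that
    by (simp add: h_def w_def phi0 phi1 c_def \<kappa>_def)
  \<comment> \<open>The mean of x is zero and so drops out of the covariance identity, while \<phi>
    (x i) * x i is the (q+1)-th power of \<open>\<bar>x i\<bar>\<close>.\<close>
  have nL: "(\<Sum>i\<in>P \<union> N. \<Sum>j\<in>P \<union> N. h i j) = 2 * n * (\<Sum>i\<in>P \<union> N. \<bar>x i\<bar> powr (q + 1))"
  proof -
    have ne: "finite (P \<union> N)" "P \<union> N \<noteq> {}" using fin PN by auto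
    have cn: "real (card (P \<union> N)) = n" using fin PN n uv(3)
      by (simp add: card_Un_disjoint flip: distrib_right)
    have "\<phi> (x i) * x i = \<bar>x i\<bar> powr (q + 1)" for i by (auto simp: \<phi>_def powr_add sgn_if)
    then show ?thesis using covariance_sum[OF ne, of "\<lambda>i. \<phi> (x i)" x] sum0 \<open>n > 0\<close>
      unfolding cn h_def by simp
  qed
  have S: "(\<Sum>i\<in>P. x i) = (\<Sum>j\<in>N. - x j)"
    using sum0 fin PN by (simp add: sum.union_disjoint sum_negf)
  define S where "S = (\<Sum>i\<in>P. x i)"
  have E: "- u / 2 * (\<Sum>i\<in>N. \<Sum>j\<in>N. w i j)
    \<le> (\<Sum>i\<in>P. \<Sum>j\<in>N. (x i - x j) powr q * (u * x i - v * (- x j)))"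
  proof -
    \<comment> \<open>For fixed j the weight (x i - x j)^q increases with x i, so its covariance
      with x over P is nonnegative.\<close>
    have E1: "0 \<le> (\<Sum>i\<in>P. (x i - x j) powr q * (x i - S / card P))" if "j \<in> N" for j
    proof -
      have "0 \<le> ((x i - x j) powr q - (x k - x j) powr q) * (x i - x k)" if "i \<in> P" "k \<in> P" for i k
        using powr_diff_mult_le(1)[of "x i - x j" "x k - x j" q] that x[of i] x[of k] x[of j] \<open>j \<in> N\<close> q by simp
      then show ?thesis
        unfolding S_def using fin PN by (subst covariance_sum) (auto intro!: sum_nonneg divide_nonneg_nonneg)
    qed
    \<comment> \<open>Over N the covariance enters with the unfavourable sign. It is charged to the
      pairs inside N, which is why their coefficient in the result is reduced by \<kappa> u.\<close>
    have E2: "(\<Sum>j\<in>N. (x i - x j) powr q * (- x j - S / card N))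
      \<le> (\<Sum>j\<in>N. \<Sum>k\<in>N. w j k) / (2 * real (card N))" if "i \<in> P" for i
    proof -
      have "((x i - x j) powr q - (x i - x k) powr q) * (- x j - - x k) \<le> w j k" if "j \<in> N" "k \<in> N" for j k
        using powr_diff_mult_le(2)[of "x i - x j" "x i - x k" q] that x[of i] x[of k] x[of j] \<open>i \<in> P\<close> q
        by (simp add: w_def abs_minus_commute)
      then show ?thesis
        unfolding S_def S using fin PN by (subst covariance_sum) (auto intro!: sum_mono divide_right_mono)
    qed
    have bal: "r * (u * y - v * z) = u * (r * (y - a)) - v * (r * (z - b))" if "u * a = v * b" for r y z a b
      using that by algebra
    have "u * (S / card P) = v * (S / card N)" using n uv \<open>n > 0\<close> by simp
    note bal[OF this]
    then have "(x i - x j) powr q * (u * x i - v * (- x j))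
      = u * ((x i - x j) powr q * (x i - S / card P)) - v * ((x i - x j) powr q * (- x j - S / card N))" for i j
      by blast
    then have "(\<Sum>i\<in>P. \<Sum>j\<in>N. (x i - x j) powr q * (u * x i - v * (- x j)))
      = u * (\<Sum>i\<in>P. \<Sum>j\<in>N. (x i - x j) powr q * (x i - S / card P))
        - v * (\<Sum>i\<in>P. \<Sum>j\<in>N. (x i - x j) powr q * (- x j - S / card N))"
      by (simp only: sum_subtractf sum_distrib_left)
    also have "(\<Sum>i\<in>P. \<Sum>j\<in>N. (x i - x j) powr q * (x i - S / card P))
      = (\<Sum>j\<in>N. \<Sum>i\<in>P. (x i - x j) powr q * (x i - S / card P))" by (rule sum.swap)
    finally have eq: "(\<Sum>i\<in>P. \<Sum>j\<in>N. (x i - x j) powr q * (u * x i - v * (- x j)))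
      = u * (\<Sum>j\<in>N. \<Sum>i\<in>P. (x i - x j) powr q * (x i - S / card P))
        - v * (\<Sum>i\<in>P. \<Sum>j\<in>N. (x i - x j) powr q * (- x j - S / card N))" .
    have "0 \<le> u * (\<Sum>j\<in>N. \<Sum>i\<in>P. (x i - x j) powr q * (x i - S / card P))"
      using uv by (intro mult_nonneg_nonneg sum_nonneg E1) auto
    moreover have "v * (\<Sum>i\<in>P. \<Sum>j\<in>N. (x i - x j) powr q * (- x j - S / card N))
      \<le> v * (\<Sum>i\<in>P. (\<Sum>j\<in>N. \<Sum>k\<in>N. w j k) / (2 * real (card N)))"
      using uv by (intro mult_left_mono sum_mono E2) auto
    moreover have "v * (\<Sum>i\<in>P. (\<Sum>j\<in>N. \<Sum>k\<in>N. w j k) / (2 * real (card N))) = u / 2 * (\<Sum>i\<in>N. \<Sum>j\<in>N. w i j)"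
      using n uv \<open>n > 0\<close> by simp
    ultimately show ?thesis unfolding eq by linarith
  qed
  have "(\<Sum>i\<in>P \<union> N. \<Sum>j\<in>P \<union> N. h i j)
    = (\<Sum>i\<in>P. \<Sum>j\<in>P. h i j) + 2 * (\<Sum>i\<in>P. \<Sum>j\<in>N. h i j) + (\<Sum>i\<in>N. \<Sum>j\<in>N. h i j)"
    using PN fin hs by (intro double_sum_split) auto
  also have "\<dots> \<le> (\<Sum>i\<in>P. \<Sum>j\<in>P. w i j)
    + 2 * (\<Sum>i\<in>P. \<Sum>j\<in>N. c * w i j - \<kappa> * ((x i - x j) powr q * (u * x i - v * (- x j))))
    + (\<Sum>i\<in>N. \<Sum>j\<in>N. w i j)"
    by (intro add_mono mult_left_mono sum_mono PP NN PN') auto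
  also have "(\<Sum>i\<in>P. \<Sum>j\<in>N. c * w i j - \<kappa> * ((x i - x j) powr q * (u * x i - v * (- x j))))
    = c * (\<Sum>i\<in>P. \<Sum>j\<in>N. w i j)
      - \<kappa> * (\<Sum>i\<in>P. \<Sum>j\<in>N. (x i - x j) powr q * (u * x i - v * (- x j)))"
    by (simp only: sum_subtractf sum_distrib_left)
  finally have "(\<Sum>i\<in>P \<union> N. \<Sum>j\<in>P \<union> N. h i j) \<le> (\<Sum>i\<in>P. \<Sum>j\<in>P. w i j)
    + 2 * (c * (\<Sum>i\<in>P. \<Sum>j\<in>N. w i j)
      - \<kappa> * (\<Sum>i\<in>P. \<Sum>j\<in>N. (x i - x j) powr q * (u * x i - v * (- x j))))
    + (\<Sum>i\<in>N. \<Sum>j\<in>N. w i j)" .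
  moreover have "\<kappa> * (\<Sum>i\<in>P. \<Sum>j\<in>N. (x i - x j) powr q * (u * x i - v * (- x j)))
    \<ge> \<kappa> * (- u / 2 * (\<Sum>i\<in>N. \<Sum>j\<in>N. w i j))"
    using kappa E by (rule mult_left_mono[rotated])
  moreover have "A \<le> B + 2 * (c - K') + D" if "A \<le> B + 2 * (c - K) + D" "K' \<le> K" for A B c K K' D :: real
    using that by (simp add: algebra_simps)
  ultimately have main: "(\<Sum>i\<in>P \<union> N. \<Sum>j\<in>P \<union> N. h i j) \<le> (\<Sum>i\<in>P. \<Sum>j\<in>P. w i j)
    + 2 * (c * (\<Sum>i\<in>P. \<Sum>j\<in>N. w i j) - \<kappa> * (- u / 2 * (\<Sum>i\<in>N. \<Sum>j\<in>N. w i j)))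
    + (\<Sum>i\<in>N. \<Sum>j\<in>N. w i j)" by blast
  have "(\<Sum>i\<in>P \<union> N. \<Sum>j\<in>P \<union> N. w i j)
    = (\<Sum>i\<in>P. \<Sum>j\<in>P. w i j) + 2 * (\<Sum>i\<in>P. \<Sum>j\<in>N. w i j) + (\<Sum>i\<in>N. \<Sum>j\<in>N. w i j)"
    using PN fin ws by (intro double_sum_split) auto
  then show ?thesis using main unfolding nL w_def[symmetric] \<kappa>_def[symmetric]
    by (simp add: algebra_simps)
qed

text \<open>The pairs inside P and inside N carry the coefficients C - 1 and D. Since both are
  strictly positive, dropping these pairs gives the inequality, and equality leaves no variation on
  either side.\<close>

lemma deviation_split_bound:
  fixes x :: "nat \<Rightarrow> real"
  assumes p: "1 < p" "p < 2" and sum0: "(\<Sum>i=1..n. x i) = 0"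
  defines "P \<equiv> {i\<in>{1..n}. 0 < x i}"
  assumes ne: "P \<noteq> {}" and card: "2 * card P \<le> n"
  defines "c \<equiv> (real (card P) powr (p - 1) + (real n - real (card P)) powr (p - 1)) / real n powr p"
  shows "(\<Sum>i=1..n. \<bar>x i\<bar> powr p) \<le> c * (\<Sum>i=1..n. \<Sum>j=1..n. \<bar>x i - x j\<bar> powr p) / 2"
    and "(\<Sum>i=1..n. \<bar>x i\<bar> powr p) = c * (\<Sum>i=1..n. \<Sum>j=1..n. \<bar>x i - x j\<bar> powr p) / 2 \<Longrightarrow>
      (\<forall>i\<in>P. \<forall>j\<in>P. x i = x j) \<and> (\<forall>i\<in>{1..n}-P. \<forall>j\<in>{1..n}-P. x i = x j)"
proof -
  define q where "q = p - 1"
  have q: "0 < q" "q < 1" and pq: "p = q + 1" using p by (auto simp: q_def)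
  define N where "N = {1..n} - P"
  have PN: "P \<union> N = {1..n}" "P \<inter> N = {}" and fin: "finite P" "finite N"
    by (auto simp: P_def N_def)
  have cP: "card P > 0" using ne fin by (simp add: card_gt_0_iff)
  have cN: "card P + card N = n" using card_Un_disjoint[OF fin PN(2)] PN(1) by simp
  then have n: "n > 0" and "N \<noteq> {}" using cP card by auto
  define u where "u = card P / n"
  define v where "v = card N / n"
  have uv: "0 < u" "0 < v" "u + v = 1"
    using cP cN card n by (auto simp: u_def v_def simp flip: add_divide_distrib of_nat_add)
  define C where "C = u powr q + v powr q"
  define D where "D = C - 1 - q * (u powr (q - 1) - v powr (q - 1)) * u"
  define pairs where "pairs I = (\<Sum>i\<in>I. \<Sum>j\<in>I. \<bar>x i - x j\<bar> powr p)" for I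
  have c: "real n * c = C"
  proof -
    have "real n - real (card P) = real (card N)" using cN by simp
    then have "real n * c = real n * (real (card P) powr q + real (card N) powr q) / (real n powr q * real n)"
      using n by (simp add: c_def pq powr_add)
    also have "\<dots> = C" using n by (simp add: C_def u_def v_def powr_divide add_divide_distrib)
    finally show ?thesis .
  qed
  have main: "2 * real n * (\<Sum>i=1..n. \<bar>x i\<bar> powr p) + (C - 1) * pairs P + D * pairs N \<le> C * pairs {1..n}"
    unfolding PN(1)[symmetric] C_def D_def pairs_def pq
    by (rule deviation_le_split)
      (use q fin PN ne \<open>N \<noteq> {}\<close> card cN uv n sum0 in \<open>auto simp: u_def v_def P_def N_def\<close>)
  have lt: "t < t powr q" if "0 < t" "t < 1" for t :: real
    using powr_less_mono'[of t q 1] that q by simp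
  have "u < 1" "v < 1" using uv by auto
  then have C1: "C > 1" using lt[of u] lt[of v] uv by (simp add: C_def)
  \<comment> \<open>The tangent to t^q at v, evaluated at t = 1, absorbs the 1 in D; what is left is
    at least (1 - q) u^q.\<close>
  have D0: "D > 0"
  proof -
    have "1 powr q \<le> v powr q + q * v powr (q - 1) * (1 - v)"
      using uv q by (intro powr_le_tangent) auto
    moreover have "1 - v = u" using uv by simp
    moreover have "u powr (q - 1) * u = u powr q" using uv powr_add[of u "q - 1" 1] by simp
    moreover have "q * u powr q < u powr q" using q uv by simp
    ultimately show ?thesis unfolding D_def C_def by (simp add: algebra_simps)
  qed
  have nn: "0 \<le> pairs I" for I unfolding pairs_def by (intro sum_nonneg) auto
  have "2 * real n * (\<Sum>i=1..n. \<bar>x i\<bar> powr p) \<le> C * pairs {1..n}"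
    using main mult_nonneg_nonneg[OF _ nn[of P], of "C - 1"] mult_nonneg_nonneg[OF _ nn[of N], of D] C1 D0
    by linarith
  then have "2 * real n * (\<Sum>i=1..n. \<bar>x i\<bar> powr p) \<le> 2 * real n * (c * pairs {1..n} / 2)"
    by (simp add: c[symmetric] algebra_simps)
  then show "(\<Sum>i=1..n. \<bar>x i\<bar> powr p) \<le> c * (\<Sum>i=1..n. \<Sum>j=1..n. \<bar>x i - x j\<bar> powr p) / 2"
    using n unfolding pairs_def by simp
  assume "(\<Sum>i=1..n. \<bar>x i\<bar> powr p) = c * (\<Sum>i=1..n. \<Sum>j=1..n. \<bar>x i - x j\<bar> powr p) / 2"
  then have "2 * real n * (\<Sum>i=1..n. \<bar>x i\<bar> powr p) = C * pairs {1..n}"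
    unfolding pairs_def[symmetric] by (simp add: c[symmetric])
  then have "(C - 1) * pairs P + D * pairs N \<le> 0" using main by simp
  then have "(C - 1) * pairs P = 0" "D * pairs N = 0"
    using mult_nonneg_nonneg[OF _ nn[of P], of "C - 1"] mult_nonneg_nonneg[OF _ nn[of N], of D] C1 D0
    by (smt (verit))+
  then have "pairs P = 0" "pairs N = 0" using C1 D0 by auto
  moreover have "\<forall>i\<in>I. \<forall>j\<in>I. x i = x j" if "pairs I = 0" "finite I" for I
  proof -
    have "\<forall>i\<in>I. (\<Sum>j\<in>I. \<bar>x i - x j\<bar> powr p) = 0"
      using that unfolding pairs_def by (subst (asm) sum_nonneg_eq_0_iff) (auto intro: sum_nonneg)
    moreover have "(\<Sum>j\<in>I. \<bar>x i - x j\<bar> powr p) = 0 \<longleftrightarrow> (\<forall>j\<in>I. \<bar>x i - x j\<bar> powr p = 0)" for i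
      using that(2) by (intro sum_nonneg_eq_0_iff) auto
    moreover have "\<bar>x i - x j\<bar> powr p = 0 \<longleftrightarrow> x i = x j" for i j by simp
    ultimately show ?thesis by blast
  qed
  ultimately show "(\<forall>i\<in>P. \<forall>j\<in>P. x i = x j) \<and> (\<forall>i\<in>{1..n}-P. \<forall>j\<in>{1..n}-P. x i = x j)"
    using fin unfolding N_def by blast
qed

lemma deviation_split_bound_mean:
  assumes p: "1 < p" "p < 2" and nonconst: "i\<^sub>0 \<in> {1..n}" "j\<^sub>0 \<in> {1..n}" "f i\<^sub>0 \<noteq> f j\<^sub>0"
  shows "\<exists>A. A \<subseteq> {1..n} \<and> 0 < card A \<and> 2 * card A \<le> n \<and>
    deviation p n f \<le> (real (card A) powr (p - 1) + (real n - real (card A)) powr (p - 1)) / real n powr p * pair_sum p n f / 2 \<and>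
    (deviation p n f = (real (card A) powr (p - 1) + (real n - real (card A)) powr (p - 1)) / real n powr p * pair_sum p n f / 2 \<longrightarrow>
      (\<forall>i\<in>A. \<forall>j\<in>A. f i = f j) \<and> (\<forall>i\<in>{1..n}-A. \<forall>j\<in>{1..n}-A. f i = f j))"
proof -
  define x where "x i = f i - mean n f" for i
  have n: "n > 0" using nonconst by auto
  have sum0: "(\<Sum>i=1..n. x i) = 0"
    unfolding x_def by (rule sum_deviation(2)[OF n])
  then have sum0': "(\<Sum>i=1..n. - x i) = 0" by (simp add: sum_negf)
  define P where "P = {i\<in>{1..n}. 0 < x i}"
  define Q where "Q = {i\<in>{1..n}. 0 < - x i}"
  have fin: "finite P" "finite Q" by (simp_all add: P_def Q_def)
  have "\<not> ((\<forall>i\<in>{1..n}. mean n f \<le> f i) \<or> (\<forall>i\<in>{1..n}. f i \<le> mean n f))"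
    using mean_eq_bound_imp_const[OF n nonconst(1), of f] mean_eq_bound_imp_const[OF n nonconst(2), of f] nonconst(3)
    by metis
  then have "\<exists>i\<in>{1..n}. mean n f < f i" "\<exists>i\<in>{1..n}. f i < mean n f" by (meson not_le)+
  then have ne: "P \<noteq> {}" "Q \<noteq> {}" by (auto simp: P_def Q_def x_def)
  have pairs: "(\<Sum>i=1..n. \<Sum>j=1..n. \<bar>x i - x j\<bar> powr p) = pair_sum p n f"
    "(\<Sum>i=1..n. \<Sum>j=1..n. \<bar>- x i - - x j\<bar> powr p) = pair_sum p n f"
    unfolding minus_diff_minus abs_minus_cancel
    by (simp_all add: pair_sum_def x_def)
  have dev: "(\<Sum>i=1..n. \<bar>x i\<bar> powr p) = deviation p n f" "(\<Sum>i=1..n. \<bar>- x i\<bar> powr p) = deviation p n f"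
    by (simp_all only: deviation_def x_def abs_minus_cancel)
  have iff: "x i = x j \<longleftrightarrow> f i = f j" "- x i = - x j \<longleftrightarrow> f i = f j" for i j
    by (simp_all add: x_def)
  have "card P + card Q = card (P \<union> Q)" using fin by (intro card_Un_disjoint[symmetric]) (auto simp: P_def Q_def)
  also have "\<dots> \<le> card {1..n}" by (intro card_mono) (auto simp: P_def Q_def)
  \<comment> \<open>Vertices at the mean belong to neither set, so P or Q contains at most half of
    all vertices. The bound is applied to x or to - x accordingly.\<close>
  finally consider "2 * card P \<le> n" | "2 * card Q \<le> n" by fastforce
  then show ?thesis
  proof cases
    case 1
    note bound = deviation_split_bound[OF p sum0, folded P_def, OF ne(1) 1, unfolded pairs dev]
    show ?thesis
    proof (intro exI[of _ P] conjI impI)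
      show "P \<subseteq> {1..n}" "0 < card P" using ne fin by (auto simp: P_def card_gt_0_iff)
      assume "deviation p n f = (real (card P) powr (p - 1) + (real n - real (card P)) powr (p - 1)) / real n powr p * pair_sum p n f / 2"
      from bound(2)[OF this]
      show "\<forall>i\<in>P. \<forall>j\<in>P. f i = f j" "\<forall>i\<in>{1..n}-P. \<forall>j\<in>{1..n}-P. f i = f j"
        unfolding iff by blast+
    qed (use bound(1) 1 in auto)
  next
    case 2
    note bound = deviation_split_bound[OF p sum0', folded Q_def, OF ne(2) 2, unfolded pairs dev]
    show ?thesis
    proof (intro exI[of _ Q] conjI impI)
      show "Q \<subseteq> {1..n}" "0 < card Q" using ne fin by (auto simp: Q_def card_gt_0_iff)
      assume "deviation p n f = (real (card Q) powr (p - 1) + (real n - real (card Q)) powr (p - 1)) / real n powr p * pair_sum p n f / 2"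
      from bound(2)[OF this]
      show "\<forall>i\<in>Q. \<forall>j\<in>Q. f i = f j" "\<forall>i\<in>{1..n}-Q. \<forall>j\<in>{1..n}-Q. f i = f j"
        unfolding iff by blast+
    qed (use bound(1) 2 in auto)
  qed
qed

section \<open>Balanced splits maximise the constant\<close>

text \<open>The tangents at a and b are compared with k and l. The displacements k - a and l - b are
  opposite, and the slope at a is at least the slope at b.\<close>

lemma powr_sum_less:
  fixes k l a b q :: real
  assumes "0 < q" "q < 1" "0 \<le> k" "k < a" "a \<le> b" "k + l = a + b"
  shows "k powr q + l powr q < a powr q + b powr q"
proof -
  have "k powr q < a powr q + q * a powr (q - 1) * (k - a)"
    using assms by (intro powr_less_tangent) auto
  moreover have "l powr q \<le> b powr q + q * b powr (q - 1) * (l - b)"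
    using assms by (intro powr_le_tangent) auto
  moreover have "q * b powr (q - 1) * (l - b) \<le> q * a powr (q - 1) * (l - b)"
    using assms by (intro mult_right_mono mult_left_mono powr_mono2') auto
  moreover have "k - a = - (l - b)" using assms by simp
  then have "q * a powr (q - 1) * (k - a) = - (q * a powr (q - 1) * (l - b))"
    by (simp only: mult_minus_right)
  ultimately show ?thesis by linarith
qed

lemma floor_ceiling_half:
  "\<lfloor>real n / 2\<rfloor> = int (n div 2)" "\<lceil>real n / 2\<rceil> = int (n - n div 2)"
proof -
  show "\<lfloor>real n / 2\<rfloor> = int (n div 2)" using floor_divide_of_nat_eq[of n 2] by simp
  have "n = 2 * (n div 2) + n mod 2" "n mod 2 < 2" by simp_all
  then show "\<lceil>real n / 2\<rceil> = int (n - n div 2)" by (intro ceiling_unique) linarith+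
qed

lemma balanced_split_max:
  fixes n k :: nat
  assumes "0 < q" "q < 1" "k \<le> n"
  defines "a \<equiv> n div 2" and "b \<equiv> n - n div 2"
  shows "real k powr q + real (n - k) powr q \<le> real a powr q + real b powr q"
    and "real k powr q + real (n - k) powr q = real a powr q + real b powr q \<longleftrightarrow> k = a \<or> k = b"
proof -
  have ab: "a \<le> b" "a + b = n" by (auto simp: a_def b_def)
  have *: "real k powr q + real (n - k) powr q < real a powr q + real b powr q" if "k < a" for k
    using that ab assms by (intro powr_sum_less) auto
  have "k < a \<or> n - k < a \<or> k = a \<or> k = b" using ab assms(3) unfolding a_def b_def by linarith
  moreover have "n - (n - k) = k" using assms(3) by simp
  moreover have "n - a = b" "n - b = a" using ab by auto
  ultimately show "real k powr q + real (n - k) powr q \<le> real a powr q + real b powr q"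
    and "real k powr q + real (n - k) powr q = real a powr q + real b powr q \<longleftrightarrow> k = a \<or> k = b"
    using *[of k] *[of "n - k"] ab by (auto simp: add.commute)
qed

text \<open>A split into k and n - k vertices has the constant c k \<le> C. For a maximizer both
  estimates are tight: c k = C makes the split balanced, and equality in the split bound leaves two
  values. Constant functions are treated apart, as they have no vertex off the mean.\<close>

lemma variation_bound_p_less_2:
  fixes n :: nat
  assumes n: "n \<ge> 2" and p: "1 < p" "p < 2"
    and C: "C = (real_of_int \<lfloor>real n / 2\<rfloor> powr (p - 1) + real_of_int \<lceil>real n / 2\<rceil> powr (p - 1)) / real n powr p"
  shows "variation_bound p n C"
    and "maximizer p n C f \<longleftrightarrow> (\<exists>A B. A > B \<and> f ` {1..n} = {A, B} \<and>
      int (card {i \<in> {1..n}. f i = A}) \<in> {\<lfloor>real n / 2\<rfloor>, \<lceil>real n / 2\<rceil>})"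
proof -
  define c where "c k = (real k powr (p - 1) + real (n - k) powr (p - 1)) / real n powr p" for k
  have C': "C = c (n div 2)" unfolding C c_def floor_ceiling_half by simp
  have c_le: "c k \<le> C" and c_eq: "c k = C \<longleftrightarrow> k = n div 2 \<or> k = n - n div 2" if "k \<le> n" for k
    using balanced_split_max[of "p - 1" k n] p n that unfolding C' c_def
    by (auto simp: divide_right_mono)
  have mono: "c k * pair_sum p n f / 2 \<le> C * pair_sum p n f / 2" if "k \<le> n" for f k
    using c_le[OF that] pair_sum_nonneg[of p n f] by (simp add: mult_right_mono)
  have const: "deviation p n f = 0 \<and> pair_sum p n f = 0"
    if eq: "\<And>i j. i \<in> {1..n} \<Longrightarrow> j \<in> {1..n} \<Longrightarrow> f i = f j" for f
  proof -
    have "f i = mean n f" if i: "i \<in> {1..n}" for i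
    proof -
      have "(\<Sum>j=1..n. f i - f j) = (\<Sum>j=1..n. 0)"
        by (intro sum.cong refl) (metis eq i diff_self)
      then show ?thesis using sum_deviation(1)[of n f i] n by simp
    qed
    then have "deviation p n f = (\<Sum>i=1..n. 0)"
      unfolding deviation_def by (intro sum.cong refl) simp
    moreover have "pair_sum p n f = (\<Sum>i=1..n. \<Sum>j=1..n. 0)"
      unfolding pair_sum_def by (intro sum.cong refl) (metis eq diff_self abs_zero powr_0)
    ultimately show ?thesis by simp
  qed
  have split: "\<exists>A. A \<subseteq> {1..n} \<and> 0 < card A \<and> 2 * card A \<le> n \<and> deviation p n f \<le> c (card A) * pair_sum p n f / 2 \<and>
    (deviation p n f = c (card A) * pair_sum p n f / 2 \<longrightarrow>
      (\<forall>i\<in>A. \<forall>j\<in>A. f i = f j) \<and> (\<forall>i\<in>{1..n}-A. \<forall>j\<in>{1..n}-A. f i = f j))"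
    if nc: "i \<in> {1..n}" "j \<in> {1..n}" "f i \<noteq> f j" for f i j
  proof -
    obtain A where A: "A \<subseteq> {1..n} \<and> 0 < card A \<and> 2 * card A \<le> n \<and>
      deviation p n f \<le> (real (card A) powr (p - 1) + (real n - real (card A)) powr (p - 1)) / real n powr p * pair_sum p n f / 2 \<and>
      (deviation p n f = (real (card A) powr (p - 1) + (real n - real (card A)) powr (p - 1)) / real n powr p * pair_sum p n f / 2 \<longrightarrow>
        (\<forall>i\<in>A. \<forall>j\<in>A. f i = f j) \<and> (\<forall>i\<in>{1..n}-A. \<forall>j\<in>{1..n}-A. f i = f j))"
      using deviation_split_bound_mean[OF p nc] by blast
    have cA: "c (card A) = (real (card A) powr (p - 1) + (real n - real (card A)) powr (p - 1)) / real n powr p"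
      using A by (simp add: c_def)
    show ?thesis using A unfolding cA[symmetric] by blast
  qed
  show "variation_bound p n C"
    unfolding variation_bound_def
  proof
    fix f
    show "deviation p n f \<le> C * p_variation p n f powr p"
    proof (cases "\<forall>i\<in>{1..n}. \<forall>j\<in>{1..n}. f i = f j")
      case True
      then have "deviation p n f = 0 \<and> pair_sum p n f = 0" by (intro const) blast
      then show ?thesis using p by (simp add: p_variation_powr)
    next
      case False
      then obtain i j where "i \<in> {1..n}" "j \<in> {1..n}" "f i \<noteq> f j" by blast
      from split[OF this] obtain A where A: "A \<subseteq> {1..n} \<and> 0 < card A \<and> 2 * card A \<le> n \<and> deviation p n f \<le> c (card A) * pair_sum p n f / 2 \<and>
        (deviation p n f = c (card A) * pair_sum p n f / 2 \<longrightarrow>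
          (\<forall>i\<in>A. \<forall>j\<in>A. f i = f j) \<and> (\<forall>i\<in>{1..n}-A. \<forall>j\<in>{1..n}-A. f i = f j))"
        ..
      then have "2 * card A \<le> n" "deviation p n f \<le> c (card A) * pair_sum p n f / 2" by (simp_all only:)
      then show ?thesis using mono[of "card A" f] p by (simp add: p_variation_powr)
    qed
  qed
  show "maximizer p n C f \<longleftrightarrow> (\<exists>A B. A > B \<and> f ` {1..n} = {A, B} \<and>
      int (card {i \<in> {1..n}. f i = A}) \<in> {\<lfloor>real n / 2\<rfloor>, \<lceil>real n / 2\<rceil>})" (is "_ \<longleftrightarrow> ?R")
  proof
    assume "maximizer p n C f"
    then obtain i j where ij: "i \<in> {1..n}" "j \<in> {1..n}" "f i \<noteq> f j" and eq: "deviation p n f = C * pair_sum p n f / 2"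
      using p by (auto simp: maximizer_def attains_equality_def p_variation_powr)
    obtain S where S0: "S \<subseteq> {1..n} \<and> 0 < card S \<and> 2 * card S \<le> n \<and> deviation p n f \<le> c (card S) * pair_sum p n f / 2 \<and>
        (deviation p n f = c (card S) * pair_sum p n f / 2 \<longrightarrow>
          (\<forall>i\<in>S. \<forall>j\<in>S. f i = f j) \<and> (\<forall>i\<in>{1..n}-S. \<forall>j\<in>{1..n}-S. f i = f j))"
      using split[OF ij] ..
    then have S: "S \<subseteq> {1..n}" "0 < card S" "2 * card S \<le> n" "deviation p n f \<le> c (card S) * pair_sum p n f / 2"
      by (simp_all only:)
    have "C * pair_sum p n f \<le> c (card S) * pair_sum p n f" using S(4) eq by simp
    then have "C \<le> c (card S)" using pair_sum_pos[OF ij, of p] by simp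
    then have cS: "c (card S) = C" using c_le[of "card S"] S(3) by simp
    then have const: "\<forall>i\<in>S. \<forall>j\<in>S. f i = f j" "\<forall>i\<in>{1..n}-S. \<forall>j\<in>{1..n}-S. f i = f j"
      using S0 eq by metis+
    have k: "card S = n div 2 \<or> card S = n - n div 2" using c_eq[of "card S"] cS S(3) by simp
    have fin: "finite S" using S(2) card_ge_0_finite by blast
    have cS': "card ({1..n} - S) = n - card S" using fin S(1) by (simp add: card_Diff_subset)
    then have "0 < card ({1..n} - S)" using S(2,3) by linarith
    then have "{1..n} - S \<noteq> {}" by (metis card.empty less_irrefl)
    then obtain t where t: "t \<in> {1..n}" "t \<notin> S" by blast
    obtain s where s: "s \<in> S" using S(2) by fastforce
    have fS: "i \<in> S \<Longrightarrow> f i = f s" "i \<in> {1..n} \<Longrightarrow> i \<notin> S \<Longrightarrow> f i = f t" for i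
      using const s t by (blast, blast)
    have st: "f s \<noteq> f t" using fS ij by metis
    have img: "f ` {1..n} = {f s, f t}"
    proof
      show "f ` {1..n} \<subseteq> {f s, f t}" using fS by blast
      show "{f s, f t} \<subseteq> f ` {1..n}" using s t S(1) by blast
    qed
    have "f i = f s \<longleftrightarrow> i \<in> S" "f i = f t \<longleftrightarrow> i \<notin> S" if "i \<in> {1..n}" for i
      using fS st that by metis+
    then have "{i\<in>{1..n}. f i = f s} = S" "{i\<in>{1..n}. f i = f t} = {1..n} - S"
      using S(1) by blast+
    then have cst: "card {i\<in>{1..n}. f i = f s} = card S" "card {i\<in>{1..n}. f i = f t} = n - card S"
      using cS' by (simp_all only:)
    \<comment> \<open>Complementation exchanges the two admissible cardinalities, so either of the
      two values may turn out to be the larger one.\<close>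
    have "n - card S = n div 2 \<or> n - card S = n - n div 2" using k by linarith
    with k have card: "int (card {i\<in>{1..n}. f i = f s}) \<in> {\<lfloor>real n / 2\<rfloor>, \<lceil>real n / 2\<rceil>}"
      "int (card {i\<in>{1..n}. f i = f t}) \<in> {\<lfloor>real n / 2\<rfloor>, \<lceil>real n / 2\<rceil>}"
      unfolding cst floor_ceiling_half by (simp_all only: insert_iff empty_iff of_nat_eq_iff simp_thms)
    show ?R
    proof (cases "f s > f t")
      case True
      then show ?thesis by (intro exI[of _ "f s"] exI[of _ "f t"] conjI img card)
    next
      case False
      then have "f t > f s" using st by simp
      moreover have "f ` {1..n} = {f t, f s}" unfolding img by (rule insert_commute)
      ultimately show ?thesis by (intro exI[of _ "f t"] exI[of _ "f s"] conjI card)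
    qed
  next
    assume ?R
    then obtain A B where AB: "A > B" "f ` {1..n} = {A, B}"
      "int (card {i \<in> {1..n}. f i = A}) \<in> {int (n div 2), int (n - n div 2)}"
      unfolding floor_ceiling_half by blast
    define k where "k = card {i \<in> {1..n}. f i = A}"
    have k: "k = n div 2 \<or> k = n - n div 2" using AB(3) unfolding k_def by auto
    then have kn: "k \<le> n" by auto
    have "attains_equality p n (c k) f"
      using two_valued_equality[of f n A B p "real k"] AB(2) p n kn by (simp add: c_def k_def)
    then have "attains_equality p n C f" using c_eq[OF kn] k by simp
    moreover obtain i j where "i \<in> {1..n}" "j \<in> {1..n}" "f i = A" "f j = B"
      using AB(2) by (metis imageE insertCI)
    ultimately show "maximizer p n C f" using AB(1) unfolding maximizer_def by (metis less_irrefl)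
  qed
qed

section \<open>Exponents between 2 and 3\<close>

lemma powr_sum_superadditive:
  fixes a b r :: real
  assumes "0 \<le> a" "0 \<le> b" "1 \<le> r"
  shows "a powr r + b powr r \<le> (a + b) powr r"
proof (cases "a + b = 0")
  case False
  then have s: "a + b > 0" using assms by simp
  have le: "t powr r \<le> t" if "0 \<le> t" "t \<le> 1" for t
    using powr_le_one_le[of t r] that assms by (cases "t = 0") auto
  have "(a / (a + b)) powr r + (b / (a + b)) powr r \<le> a / (a + b) + b / (a + b)"
    using assms s by (intro add_mono le) (auto simp: field_simps)
  also have "\<dots> = 1" using s by (simp flip: add_divide_distrib)
  also have "(a / (a + b)) powr r + (b / (a + b)) powr r = (a powr r + b powr r) / (a + b) powr r"
    using assms s by (simp add: powr_divide add_divide_distrib)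
  finally show ?thesis using s by (simp add: field_simps)
qed (use assms in \<open>simp add: add_nonneg_eq_0_iff\<close>)

text \<open>With m = a^2 + b^2, superadditivity of the power p/2 bounds a^p + b^p by m^(p/2). By the
  parallelogram law (a + b)^2 and (a - b)^2 have average m, so adding their tangent bounds at m
  gives the rest.\<close>

lemma clarkson:
  fixes a b p :: real
  assumes "0 \<le> a" "0 \<le> b" "p > 2"
  shows "2 * (a powr p + b powr p) \<le> (a + b) powr p + \<bar>a - b\<bar> powr p"
proof (cases "a = 0 \<and> b = 0")
  case False
  define m where "m = a^2 + b^2"
  have m: "m > 0" using False by (auto simp: m_def sum_power2_gt_zero_iff)
  have sq: "(t^2) powr (p / 2) = t powr p" if "0 \<le> t" for t :: real
    using that by (cases "t = 0") (simp_all add: powr_powr flip: powr_numeral)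
  have tangent: "m powr (p/2) + (p/2) * m powr (p/2 - 1) * (x - m) \<le> x powr (p/2)" if "0 \<le> x" for x
    using powr_tangent_less[of m x "p/2"] m that assms by (cases "x = m") auto
  have "2 * (a powr p + b powr p) = 2 * ((a^2) powr (p/2) + (b^2) powr (p/2))"
    using assms by (simp add: sq)
  also have "\<dots> \<le> 2 * m powr (p/2)"
    unfolding m_def using assms by (intro mult_left_mono powr_sum_superadditive) auto
  also have "\<dots> \<le> ((a + b)^2) powr (p/2) + (\<bar>a - b\<bar>^2) powr (p/2)"
  proof -
    have "((a + b)^2 - m) = - (\<bar>a - b\<bar>^2 - m)" by (simp add: m_def power2_eq_square algebra_simps)
    then have "(p/2) * m powr (p/2 - 1) * ((a + b)^2 - m) = - ((p/2) * m powr (p/2 - 1) * (\<bar>a - b\<bar>^2 - m))"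
      by (simp only: mult_minus_right)
    then show ?thesis using tangent[of "(a + b)^2"] tangent[of "\<bar>a - b\<bar>^2"] by simp
  qed
  also have "\<dots> = (a + b) powr p + \<bar>a - b\<bar> powr p"
    using assms by (simp only: sq abs_ge_zero add_nonneg_nonneg)
  finally show ?thesis .
qed simp

section \<open>An integral representation of y^p for 2 < p < 3\<close>

text \<open>It behaves like z^3 / 6 at 0 and like z^2 / 2 at infinity, which makes it integrable
  against z^(-1-p) precisely for 2 < p < 3.\<close>

definition exp_gap :: "real \<Rightarrow> real" where
  "exp_gap z = 1 - z + z^2 / 2 - exp (- z)"

text \<open>The mean value theorem is used twice: the derivative of \<open>exp_gap\<close> is g, and
  that of g is 1 - exp (- z), which lies between 0 and z.\<close>

lemma exp_gap_bounds:
  assumes "z > 0"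
  shows "0 < exp_gap z" "exp_gap z \<le> z^2" "exp_gap z \<le> z^3"
proof -
  define g where "g z = z - 1 + exp (- z)" for z :: real
  have "\<exists>\<eta>. 0 < \<eta> \<and> \<eta> < \<xi> \<and> g \<xi> - g 0 = (\<xi> - 0) * (1 - exp (- \<eta>))" if "0 < \<xi>" for \<xi>
    by (intro MVT2 that) (auto simp: g_def intro!: derivative_eq_intros)
  then have g: "0 < g \<xi>" "g \<xi> \<le> \<xi>^2" if \<xi>: "0 < \<xi>" for \<xi>
  proof -
    obtain \<eta> where \<eta>: "0 < \<eta>" "\<eta> < \<xi>" "g \<xi> = \<xi> * (1 - exp (- \<eta>))"
      using \<open>0 < \<xi> \<Longrightarrow> \<exists>\<eta>. _\<close>[OF \<xi>] by (auto simp: g_def)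
    have "1 - exp (- \<eta>) \<le> \<eta>" using exp_ge_add_one_self[of "- \<eta>"] by simp
    then have "g \<xi> \<le> \<xi> * \<xi>" unfolding \<eta>(3) using \<eta> by (intro mult_left_mono) auto
    moreover have "exp (- \<eta>) < 1" using \<eta> by simp
    ultimately show "0 < g \<xi>" "g \<xi> \<le> \<xi>^2" using \<eta> \<xi> by (simp_all add: power2_eq_square)
  qed
  have "\<exists>\<xi>. 0 < \<xi> \<and> \<xi> < z \<and> exp_gap z - exp_gap 0 = (z - 0) * g \<xi>"
    by (intro MVT2 assms) (auto simp: exp_gap_def g_def intro!: derivative_eq_intros)
  then obtain \<xi> where \<xi>: "0 < \<xi>" "\<xi> < z" "exp_gap z = z * g \<xi>" by (auto simp: exp_gap_def)
  show "0 < exp_gap z" using \<xi> g(1)[of \<xi>] by simp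
  have "z * g \<xi> \<le> z * \<xi>^2" using \<xi> g(2)[of \<xi>] by simp
  also have "\<dots> \<le> z * z^2" using \<xi> by (intro mult_left_mono power_mono) auto
  finally show "exp_gap z \<le> z^3" using \<xi> by (simp add: eval_nat_numeral)
  have "exp_gap z \<le> z^2 / 2" using exp_ge_add_one_self[of "- z"] by (simp add: exp_gap_def)
  then show "exp_gap z \<le> z^2" using zero_le_power2[of z] by linarith
qed

text \<open>The indicator extends the integrand from the positive half line to all reals, so that
  the affine substitution for \<open>lborel\<close> applies.\<close>

definition gap_kernel :: "real \<Rightarrow> real \<Rightarrow> real \<Rightarrow> real" where
  "gap_kernel p y u = indicator {0<..} u * (exp_gap (u * y) * u powr (- 1 - p))"

lemma gap_kernel_integrable:
  assumes p: "2 < p" "p < 3"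
  shows "integrable lborel (gap_kernel p 1)"
proof -
  \<comment> \<open>The dominating function joins the two bounds of \<open>exp_gap\<close>: u^(2-p)
    is integrable near 0 because p < 3, and u^(1-p) near infinity because p > 2.\<close>
  define G where "G u = indicator {0..1} u * u powr (2 - p) + indicator {1..} u * u powr (1 - p)" for u :: real
  have set: "integrable lborel (\<lambda>u. indicator A u * u powr e)"
    if "((\<lambda>u. u powr e) has_integral I) A" "A \<in> sets borel" for A :: "real set" and e I
  proof -
    have "(\<lambda>u. u powr e) absolutely_integrable_on A"
      using that by (intro nonnegative_absolutely_integrable_1) (auto simp: has_integral_integrable)
    then show ?thesis
      using that(2) by (simp add: set_integrable_def integrable_completion)
  qed
  have "integrable lborel G"
    unfolding G_def
    using p by (intro Bochner_Integration.integrable_add set[OF has_integral_powr_from_0] set[OF has_integral_powr_to_inf]) auto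
  moreover have "gap_kernel p 1 \<in> borel_measurable lborel"
    unfolding gap_kernel_def exp_gap_def by measurable
  moreover have "norm (gap_kernel p 1 u) \<le> norm (G u)" for u
  proof (cases "0 < u")
    case True
    have G: "0 \<le> G u" by (simp add: G_def)
    have k: "0 \<le> gap_kernel p 1 u" using exp_gap_bounds(1)[OF True] by (simp add: gap_kernel_def indicator_def)
    have e2: "u^2 * u powr (- 1 - p) = u powr (1 - p)" "u^3 * u powr (- 1 - p) = u powr (2 - p)"
      using True by (simp_all flip: powr_numeral powr_add)
    have "gap_kernel p 1 u \<le> G u"
    proof (cases "u < 1")
      case True': True
      have "exp_gap u * u powr (- 1 - p) \<le> u^3 * u powr (- 1 - p)"
        using True exp_gap_bounds(3)[OF True] by (intro mult_right_mono) auto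
      then show ?thesis using True True' by (simp add: gap_kernel_def G_def e2)
    next
      case False
      have "exp_gap u * u powr (- 1 - p) \<le> u^2 * u powr (- 1 - p)"
        using True exp_gap_bounds(2)[OF True] by (intro mult_right_mono) auto
      then show ?thesis using True False by (simp add: gap_kernel_def G_def e2 add_increasing)
    qed
    then show ?thesis using G k by simp
  qed (simp add: gap_kernel_def)
  ultimately show ?thesis by (rule Bochner_Integration.integrable_bound[OF _ _ AE_I2])
qed

text \<open>Together with the Jacobian 1/y of u \<mapsto> y u this makes the integral homogeneous of
  degree p in y. The summand 0 gives the argument the shape of the affine substitution rule.\<close>

lemma gap_kernel_scale:
  assumes "y > 0"
  shows "gap_kernel p y u = y powr (1 + p) * gap_kernel p 1 (0 + y * u)"
proof (cases "u > 0")
  case True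
  have "y powr (1 + p) * (y * u) powr (- 1 - p) = u powr (- 1 - p)"
    using True assms by (simp add: powr_mult flip: powr_add)
  then have "y powr (1 + p) * (exp_gap (y * u) * (y * u) powr (- 1 - p)) = exp_gap (y * u) * u powr (- 1 - p)"
    by (metis mult.left_commute)
  then show ?thesis using True assms by (auto simp: gap_kernel_def mult.commute[of u y])
next
  case False
  then have "\<not> y * u > 0" using assms by (simp add: zero_less_mult_iff)
  then show ?thesis using False by (simp add: gap_kernel_def)
qed

lemma integral_gap_kernel:
  assumes p: "2 < p" "p < 3" and y: "y \<ge> 0"
  shows "integrable lborel (gap_kernel p y)"
    and "(\<integral>u. gap_kernel p y u \<partial>lborel) = y powr p * (\<integral>u. gap_kernel p 1 u \<partial>lborel)"
proof -
  have "integrable lborel (gap_kernel p y) \<and>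
    (\<integral>u. gap_kernel p y u \<partial>lborel) = y powr p * (\<integral>u. gap_kernel p 1 u \<partial>lborel)"
  proof (cases "y = 0")
    case True
    then have "gap_kernel p y = (\<lambda>u. 0)" by (auto simp: gap_kernel_def exp_gap_def)
    then show ?thesis using True by simp
  next
    case False
    then have y: "y > 0" using assms by simp
    have eq: "gap_kernel p y = (\<lambda>u. y powr (1 + p) * gap_kernel p 1 (0 + y * u))"
      using gap_kernel_scale[OF y] by blast
    have "(\<integral>u. gap_kernel p 1 u \<partial>lborel) = y * (\<integral>u. gap_kernel p 1 (0 + y * u) \<partial>lborel)"
      using lborel_integral_real_affine[of y "gap_kernel p 1" 0] y by simp
    then have "y powr p * (\<integral>u. gap_kernel p 1 u \<partial>lborel)
      = y powr (1 + p) * (\<integral>u. gap_kernel p 1 (0 + y * u) \<partial>lborel)"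
      using y by (simp add: powr_add)
    moreover have "integrable lborel (\<lambda>u. gap_kernel p 1 (0 + y * u))"
      using y by (intro lborel_integrable_real_affine gap_kernel_integrable p) auto
    ultimately show ?thesis unfolding eq by simp
  qed
  then show "integrable lborel (gap_kernel p y)"
    "(\<integral>u. gap_kernel p y u \<partial>lborel) = y powr p * (\<integral>u. gap_kernel p 1 u \<partial>lborel)" by auto
qed

lemma integral_gap_kernel_pos:
  assumes p: "2 < p" "p < 3"
  shows "0 < (\<integral>u. gap_kernel p 1 u \<partial>lborel)"
proof -
  have nn: "0 \<le> gap_kernel p 1 u" for u
    using exp_gap_bounds(1)[of u] by (cases "u > 0") (auto simp: gap_kernel_def)
  have "(\<integral>u. gap_kernel p 1 u \<partial>lborel) \<noteq> 0"
  proof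
    assume "(\<integral>u. gap_kernel p 1 u \<partial>lborel) = 0"
    then have "AE u in lborel. gap_kernel p 1 u = 0"
      using gap_kernel_integrable[OF p] nn by (subst (asm) integral_nonneg_eq_0_iff_AE) auto
    then have "AE u in lborel. u \<notin> {0<..1::real}"
    proof eventually_elim
      case (elim u)
      show ?case
      proof
        assume "u \<in> {0<..1}"
        then have "0 < gap_kernel p 1 u" using exp_gap_bounds(1)[of u] by (simp add: gap_kernel_def)
        then show False using elim by simp
      qed
    qed
    then have "{0<..1::real} \<in> null_sets lborel" by (subst (asm) AE_iff_null_sets[symmetric]) auto
    then show False by (auto simp: null_sets_def)
  qed
  moreover have "0 \<le> (\<integral>u. gap_kernel p 1 u \<partial>lborel)" using nn by (intro integral_nonneg_AE) auto
  ultimately show ?thesis by simp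
qed

definition powr_excess :: "real \<Rightarrow> real \<Rightarrow> real \<Rightarrow> real" where
  "powr_excess p a b = (a + b) powr p - a powr p - b powr p"

text \<open>
  For p < 3, y^p is a positive multiple of the integral over u > 0 of
  (1 - u y + u^2 y^2 / 2 - exp (- u y)) u^(-1-p), and
  the excess of the integrand is u^2 a b - (1 - exp (- u a)) (1 - exp (- u b)):
  the first part vanishes upon summation and the second part is minus a square.
\<close>
lemma powr_excess_form_nonpos:
  fixes \<epsilon> y :: "'a \<Rightarrow> real"
  assumes p: "2 < p" "p \<le> 3" and I: "finite I" and y: "\<And>i. i \<in> I \<Longrightarrow> 0 \<le> y i"
    and sum0: "(\<Sum>i\<in>I. \<epsilon> i * y i) = 0"
  shows "(\<Sum>i\<in>I. \<Sum>j\<in>I. \<epsilon> i * \<epsilon> j * powr_excess p (y i) (y j)) \<le> 0"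
proof (cases "p = 3")
  \<comment> \<open>At p = 3 the kernel is of order 1/u near 0, so there is no integral to work
    with. Here the excess is 3 a^2 b + 3 a b^2, and each term contains the vanishing sum as a
    factor.\<close>
  case True
  have "(\<Sum>i\<in>I. \<Sum>j\<in>I. \<epsilon> i * \<epsilon> j * powr_excess p (y i) (y j))
    = (\<Sum>i\<in>I. \<Sum>j\<in>I. 3 * ((\<epsilon> i * (y i)^2) * (\<epsilon> j * y j)) + 3 * ((\<epsilon> i * y i) * (\<epsilon> j * (y j)^2)))"
    using y True by (intro sum.cong refl)
      (simp add: powr_excess_def powr_numeral power2_eq_square power3_eq_cube algebra_simps)
  also have "\<dots> = 3 * ((\<Sum>i\<in>I. \<epsilon> i * (y i)^2) * (\<Sum>j\<in>I. \<epsilon> j * y j))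
      + 3 * ((\<Sum>i\<in>I. \<epsilon> i * y i) * (\<Sum>j\<in>I. \<epsilon> j * (y j)^2))"
    by (simp add: sum.distrib sum_product flip: sum_distrib_left)
  finally show ?thesis using sum0 by simp
next
  case False
  then have p: "2 < p" "p < 3" using p by auto
  define K where "K = (\<integral>u. gap_kernel p 1 u \<partial>lborel)"
  have K: "K > 0" unfolding K_def by (rule integral_gap_kernel_pos[OF p])
  define F where "F i j u = gap_kernel p (y i + y j) u - gap_kernel p (y i) u - gap_kernel p (y j) u" for i j u
  have F: "integrable lborel (F i j)" "(\<integral>u. F i j u \<partial>lborel) = K * powr_excess p (y i) (y j)"
    if "i \<in> I" "j \<in> I" for i j
    using y[of i] y[of j] that integral_gap_kernel[OF p, of "y i"] integral_gap_kernel[OF p, of "y j"]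
      integral_gap_kernel[OF p, of "y i + y j"]
    by (simp_all add: F_def[abs_def] K_def powr_excess_def algebra_simps)
  have neg: "(\<Sum>i\<in>I. \<Sum>j\<in>I. \<epsilon> i * \<epsilon> j * F i j u) \<le> 0" for u
  proof (cases "u > 0")
    case True
    define e where "e i = 1 - exp (- (u * y i))" for i
    have Fu: "F i j u = u powr (- 1 - p) * (u^2 * (y i * y j) - e i * e j)" for i j
    proof -
      have "exp_gap (u * (y i + y j)) - exp_gap (u * y i) - exp_gap (u * y j) = u^2 * (y i * y j) - e i * e j"
      proof -
        have "exp (- (u * (y i + y j))) = exp (- (u * y i)) * exp (- (u * y j))"
          by (simp add: algebra_simps flip: exp_add)
        then show ?thesis by (simp add: exp_gap_def e_def power2_eq_square algebra_simps)
      qed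
      then show ?thesis using True by (simp add: F_def gap_kernel_def flip: left_diff_distrib)
    qed
    have "(\<Sum>i\<in>I. \<Sum>j\<in>I. \<epsilon> i * \<epsilon> j * F i j u) = (\<Sum>i\<in>I. \<Sum>j\<in>I.
      u powr (- 1 - p) * (u^2 * ((\<epsilon> i * y i) * (\<epsilon> j * y j)) - (\<epsilon> i * e i) * (\<epsilon> j * e j)))"
      unfolding Fu by (intro sum.cong refl) (simp add: algebra_simps)
    also have "\<dots> = u powr (- 1 - p) * (u^2 * ((\<Sum>i\<in>I. \<epsilon> i * y i) * (\<Sum>j\<in>I. \<epsilon> j * y j))
      - (\<Sum>i\<in>I. \<epsilon> i * e i) * (\<Sum>j\<in>I. \<epsilon> j * e j))"
      unfolding sum_product by (simp only: sum_subtractf flip: sum_distrib_left)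
    also have "\<dots> \<le> 0" using sum0 by simp
    finally show ?thesis .
  qed (simp add: F_def gap_kernel_def)
  have "K * (\<Sum>i\<in>I. \<Sum>j\<in>I. \<epsilon> i * \<epsilon> j * powr_excess p (y i) (y j))
    = (\<Sum>i\<in>I. \<Sum>j\<in>I. \<epsilon> i * \<epsilon> j * (\<integral>u. F i j u \<partial>lborel))"
    by (simp add: F sum_distrib_left algebra_simps)
  also have "\<dots> = (\<integral>u. (\<Sum>i\<in>I. \<Sum>j\<in>I. \<epsilon> i * \<epsilon> j * F i j u) \<partial>lborel)"
    by (simp add: F Bochner_Integration.integral_sum)
  also have "\<dots> \<le> 0"
  proof -
    have "0 \<le> (\<integral>u. - (\<Sum>i\<in>I. \<Sum>j\<in>I. \<epsilon> i * \<epsilon> j * F i j u) \<partial>lborel)"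
      using neg by (intro Bochner_Integration.integral_nonneg) simp
    then show ?thesis by simp
  qed
  finally show ?thesis using K by (simp add: mult_le_0_iff)
qed

text \<open>For opposite signs \<open>\<bar>x - y\<bar>\<close> is the sum of the absolute values,
  and equality holds by the definition of the excess. For equal signs this is Clarkson's
  inequality.\<close>

lemma pair_powr_lower_bound:
  assumes "p > 2"
  shows "\<bar>x\<bar> powr p + \<bar>y\<bar> powr p - sgn x * sgn y * powr_excess p \<bar>x\<bar> \<bar>y\<bar> \<le> \<bar>x - y\<bar> powr p"
proof -
  consider "x = 0 \<or> y = 0" | "x > 0" "y > 0" | "x < 0" "y < 0" | "x > 0" "y < 0" | "x < 0" "y > 0"
    by linarith
  then show ?thesis
  proof cases
    case 2
    then show ?thesis using clarkson[of x y p] assms by (simp add: powr_excess_def)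
  next
    case 3
    then show ?thesis using clarkson[of "- x" "- y" p] assms
      by (simp add: powr_excess_def abs_minus_commute)
  qed (auto simp: powr_excess_def add.commute)
qed

lemma variation_bound_p_le_3:
  assumes n: "n \<ge> 2" and p: "2 < p" "p \<le> 3"
  shows "variation_bound p n (1 / (2 powr (p - 1) + real n - 2))"
  unfolding variation_bound_def
proof
  fix f
  define x where "x i = f i - mean n f" for i
  define L where "L = (\<Sum>i=1..n. \<bar>x i\<bar> powr p)"
  define Q where "Q = (\<Sum>i=1..n. \<Sum>j=1..n. sgn (x i) * sgn (x j) * powr_excess p \<bar>x i\<bar> \<bar>x j\<bar>)"
  have sum0: "(\<Sum>i=1..n. x i) = 0" unfolding x_def using n by (intro sum_deviation(2)) simp
  have "Q \<le> 0" unfolding Q_def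
    using p sum0 by (intro powr_excess_form_nonpos) (auto simp: sgn_mult_abs)
  have two: "2 powr p = 2 * 2 powr (p - 1)" using powr_add[of 2 1 "p - 1"] by simp
  have diag: "\<bar>x i\<bar> powr p + \<bar>x i\<bar> powr p - sgn (x i) * sgn (x i) * powr_excess p \<bar>x i\<bar> \<bar>x i\<bar>
    = (4 - 2 powr p) * \<bar>x i\<bar> powr p" for i
  proof (cases "x i = 0")
    case False
    have "(\<bar>x i\<bar> + \<bar>x i\<bar>) powr p = 2 powr p * \<bar>x i\<bar> powr p" by (simp flip: mult_2 add: powr_mult)
    then show ?thesis using False by (simp add: powr_excess_def algebra_simps sgn_if)
  qed simp
  \<comment> \<open>On the diagonal the estimate gives (4 - 2^p) \<open>\<bar>x i\<bar>\<close>^p,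
    which is below the true value 0. Restoring this loss improves the constant from 1 / n to 1 /
    (2^(p-1) + n - 2).\<close>
  have pair: "\<bar>x i\<bar> powr p + \<bar>x j\<bar> powr p - sgn (x i) * sgn (x j) * powr_excess p \<bar>x i\<bar> \<bar>x j\<bar>
    + (if i = j then (2 powr p - 4) * \<bar>x i\<bar> powr p else 0) \<le> \<bar>x i - x j\<bar> powr p" for i j
    using pair_powr_lower_bound[of p "x i" "x j"] diag[of i] p by (cases "i = j") (auto simp: algebra_simps)
  have "(\<Sum>i=1..n. \<Sum>j=1..n. \<bar>x i\<bar> powr p + \<bar>x j\<bar> powr p - sgn (x i) * sgn (x j) * powr_excess p \<bar>x i\<bar> \<bar>x j\<bar>
    + (if i = j then (2 powr p - 4) * \<bar>x i\<bar> powr p else 0)) = 2 * real n * L - Q + (2 powr p - 4) * L"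
    by (simp add: sum.distrib sum_subtractf L_def Q_def flip: sum_distrib_left)
  moreover have "\<dots> \<ge> (2 * real n + 2 powr p - 4) * L" using \<open>Q \<le> 0\<close> by (simp add: algebra_simps)
  ultimately have "(2 * real n + 2 powr p - 4) * L \<le> (\<Sum>i=1..n. \<Sum>j=1..n. \<bar>x i - x j\<bar> powr p)"
    using pair by (smt (verit, best) sum_mono)
  also have "\<dots> = pair_sum p n f" by (simp add: pair_sum_def x_def)
  finally have "(2 powr (p - 1) + real n - 2) * L \<le> p_variation p n f powr p"
    using p two by (simp add: p_variation_powr algebra_simps)
  moreover have "2 powr (p - 1) + real n - 2 > 0"
  proof -
    have "(2::real) powr (p - 1) > 0" by simp
    then show ?thesis using n by linarith
  qed
  ultimately show "deviation p n f \<le> 1 / (2 powr (p - 1) + real n - 2) * p_variation p n f powr p"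
    by (simp add: deviation_def L_def x_def field_simps)
qed

section \<open>Reduction to three values for exponents above 3\<close>

text \<open>At t = 0 the difference quotient is bounded by \<open>\<bar>h\<bar>\<close>^(p-1), which
  tends to 0; elsewhere the function is locally a power of t or of - t.\<close>

lemma has_real_derivative_abs_powr:
  assumes "p > 1"
  shows "((\<lambda>t. \<bar>t\<bar> powr p) has_real_derivative p * (sgn t * \<bar>t\<bar> powr (p - 1))) (at t)"
proof -
  consider "t > 0" | "t < 0" | "t = 0" by linarith
  then show ?thesis
  proof cases
    case 1
    have "((\<lambda>t. t powr p) has_real_derivative p * t powr (p - 1)) (at t)"
      using 1 by (rule has_real_derivative_powr)
    then have "((\<lambda>t. \<bar>t\<bar> powr p) has_real_derivative p * t powr (p - 1)) (at t)"
      by (rule has_field_derivative_transform_within_open[where S = "{0<..}"]) (use 1 in auto)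
    then show ?thesis using 1 by simp
  next
    case 2
    have "((\<lambda>t. (- t) powr p) has_real_derivative p * (- t) powr (p - 1) * (- 1)) (at t)"
      using 2 by (intro DERIV_chain2[where f = "\<lambda>t. t powr p"] has_real_derivative_powr derivative_eq_intros) auto
    then have "((\<lambda>t. \<bar>t\<bar> powr p) has_real_derivative p * (- t) powr (p - 1) * (- 1)) (at t)"
      by (rule has_field_derivative_transform_within_open[where S = "{..<0}"]) (use 2 in auto)
    then show ?thesis using 2 by simp
  next
    case 3
    have "((\<lambda>h. \<bar>h\<bar> powr (p - 1)) \<longlongrightarrow> 0) (at 0)"
      using assms by (intro tendsto_zero_powrI[where b = "p - 1"] tendsto_rabs_zero tendsto_ident_at) auto
    then have "((\<lambda>h. (\<bar>0 + h\<bar> powr p - \<bar>0\<bar> powr p) / h) \<longlongrightarrow> 0) (at 0)"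
    proof (rule Lim_null_comparison[rotated])
      have "norm ((\<bar>0 + h\<bar> powr p - \<bar>0\<bar> powr p) / h) \<le> \<bar>h\<bar> powr (p - 1)" if "h \<noteq> 0" for h :: real
        using powr_add[of "\<bar>h\<bar>" "p - 1" 1] that by simp
      then show "\<forall>\<^sub>F h in at 0. norm ((\<bar>0 + h\<bar> powr p - \<bar>0\<bar> powr p) / h) \<le> \<bar>h\<bar> powr (p - 1)"
        by (auto simp: eventually_at_filter)
    qed
    then show ?thesis using 3 by (simp add: DERIV_def)
  qed
qed

lemma has_real_derivative_sgn_powr:
  assumes "q > 1"
  shows "((\<lambda>t. sgn t * \<bar>t\<bar> powr q) has_real_derivative q * \<bar>t\<bar> powr (q - 1)) (at t)"
proof -
  consider "t > 0" | "t < 0" | "t = 0" by linarith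
  then show ?thesis
  proof cases
    case 1
    have "((\<lambda>t. t powr q) has_real_derivative q * t powr (q - 1)) (at t)"
      using 1 by (rule has_real_derivative_powr)
    then have "((\<lambda>t. sgn t * \<bar>t\<bar> powr q) has_real_derivative q * t powr (q - 1)) (at t)"
      by (rule has_field_derivative_transform_within_open[where S = "{0<..}"]) (use 1 in auto)
    then show ?thesis using 1 by simp
  next
    case 2
    have "((\<lambda>t. - ((- t) powr q)) has_real_derivative - (q * (- t) powr (q - 1) * (- 1))) (at t)"
      using 2 by (intro DERIV_minus DERIV_chain2[where f = "\<lambda>t. t powr q"] has_real_derivative_powr derivative_eq_intros) auto
    then have "((\<lambda>t. sgn t * \<bar>t\<bar> powr q) has_real_derivative - (q * (- t) powr (q - 1) * (- 1))) (at t)"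
      by (rule has_field_derivative_transform_within_open[where S = "{..<0}"]) (use 2 in auto)
    then show ?thesis using 2 by simp
  next
    case 3
    have "((\<lambda>h. \<bar>h\<bar> powr (q - 1)) \<longlongrightarrow> 0) (at 0)"
      using assms by (intro tendsto_zero_powrI[where b = "q - 1"] tendsto_rabs_zero tendsto_ident_at) auto
    moreover have "\<forall>\<^sub>F h in at 0. (sgn (0 + h) * \<bar>0 + h\<bar> powr q - sgn 0 * \<bar>0\<bar> powr q) / h = \<bar>h\<bar> powr (q - 1)"
    proof -
      have "(sgn (0 + h) * \<bar>0 + h\<bar> powr q - sgn 0 * \<bar>0\<bar> powr q) / h = \<bar>h\<bar> powr (q - 1)" if "h \<noteq> 0" for h :: real
        using powr_add[of "\<bar>h\<bar>" "q - 1" 1] that by (simp add: sgn_if)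
      then show ?thesis by (auto simp: eventually_at_filter)
    qed
    ultimately have "((\<lambda>h. (sgn (0 + h) * \<bar>0 + h\<bar> powr q - sgn 0 * \<bar>0\<bar> powr q) / h) \<longlongrightarrow> 0) (at 0)"
      by (simp cong: tendsto_cong)
    then show ?thesis using 3 assms by (simp add: DERIV_def)
  qed
qed

text \<open>If D were negative, G' would be negative just to the right of its zero at 0, and by the
  mean value theorem G would fall below its minimum.\<close>

lemma second_derivative_nonneg:
  fixes G :: "real \<Rightarrow> real"
  assumes min: "\<And>s. G 0 \<le> G s" and G': "\<And>s. (G has_real_derivative G' s) (at s)"
    and G'': "(G' has_real_derivative D) (at 0)"
  shows "G' 0 = 0" "0 \<le> D"
proof -
  show G0: "G' 0 = 0" using DERIV_local_min[OF G'[of 0], of 1] min by simp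
  show "0 \<le> D"
  proof (rule ccontr)
    assume "\<not> 0 \<le> D"
    then obtain d where d: "d > 0" "\<And>h. 0 < h \<Longrightarrow> h < d \<Longrightarrow> G' h < 0"
      using DERIV_neg_dec_right[OF G''] G0 by auto
    have "\<exists>z. 0 < z \<and> z < d / 2 \<and> G (d / 2) - G 0 = (d / 2 - 0) * G' z"
      using d G' by (intro MVT2) auto
    then obtain z where z: "0 < z" "z < d / 2" "G (d / 2) - G 0 = (d / 2) * G' z" by auto
    moreover have "(d / 2) * G' z < 0" using d(1) d(2)[of z] z by (intro mult_pos_neg) auto
    ultimately have "G (d / 2) - G 0 < 0" by linarith
    then show False using min[of "d / 2"] by simp
  qed
qed

section \<open>The shape of the set where the derivative of the gradient is nonnegative\<close>

lemma powr_convex_with_1: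
  fixes A l r :: real
  assumes "0 \<le> A" "0 < l" "l < 1" "1 < r"
  shows "(l * A + (1 - l)) powr r \<le> l * A powr r + (1 - l)"
proof -
  define m where "m = l * A + (1 - l)"
  have m: "m > 0" using assms by (simp add: m_def add_nonneg_pos)
  define k where "k = r * m powr (r - 1)"
  have t: "m powr r + k * (y - m) \<le> y powr r" if "0 \<le> y" for y
    using powr_tangent_less[of m y r] m that assms by (cases "y = m") (auto simp: k_def)
  have "l * (m powr r + k * (A - m)) + (1 - l) * (m powr r + k * (1 - m)) \<le> l * A powr r + (1 - l) * 1 powr r"
    using assms by (intro add_mono mult_left_mono t) auto
  moreover have "l * (m powr r + k * (A - m)) + (1 - l) * (m powr r + k * (1 - m)) = m powr r + k * (m - m)"
    by (simp add: m_def algebra_simps)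
  ultimately show ?thesis by (simp add: m_def)
qed

text \<open>The tangent at 1 applies since \<open>\<bar>1 - z\<bar>\<close> - 1 \<ge> - z. It is
  strict unless \<open>\<bar>1 - z\<bar>\<close> = 1, and for z \<noteq> 0 this leaves z = 2, which
  is checked directly.\<close>

lemma abs_powr_bernoulli:
  fixes z r :: real
  assumes "r > 1"
  shows "1 - r * z \<le> \<bar>1 - z\<bar> powr r" and "z \<noteq> 0 \<Longrightarrow> 1 - r * z < \<bar>1 - z\<bar> powr r"
proof -
  show strict: "1 - r * z < \<bar>1 - z\<bar> powr r" if "z \<noteq> 0"
  proof (cases "\<bar>1 - z\<bar> = 1")
    case True
    then have "z = 2" using that by linarith
    then show ?thesis using assms by simp
  next
    case False
    have "r * (- z) \<le> r * (\<bar>1 - z\<bar> - 1)" using assms by (intro mult_left_mono) auto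
    then show ?thesis using powr_tangent_less[of 1 "\<bar>1 - z\<bar>" r] False assms by simp
  qed
  show "1 - r * z \<le> \<bar>1 - z\<bar> powr r" using strict by (cases "z = 0") auto
qed

text \<open>
  Dividing by |t|^r, the expression is a function of 1/t that is convex and, by Bernoulli's
  inequality, minimal at 0 only.
\<close>
lemma powr_dominance_star_shaped:
  fixes x :: "'a \<Rightarrow> real"
  assumes I: "finite I" and r: "r > 1" and C: "C > 0" and sum0: "(\<Sum>j\<in>I. x j) = 0"
    and nz: "k \<in> I" "x k \<noteq> 0"
    and t: "t \<noteq> 0" "\<bar>t\<bar> powr r \<le> C * (\<Sum>j\<in>I. \<bar>t - x j\<bar> powr r)"
    and l: "0 \<le> l" "l < 1"
  shows "\<bar>l * t\<bar> powr r < C * (\<Sum>j\<in>I. \<bar>l * t - x j\<bar> powr r)"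
proof (cases "l = 0")
  case True
  have "0 < \<bar>x k\<bar> powr r" using nz by simp
  also have "\<dots> \<le> (\<Sum>j\<in>I. \<bar>x j\<bar> powr r)" using nz I by (intro member_le_sum) auto
  finally show ?thesis using True C by simp
next
  case False
  define s where "s = l * t"
  have s: "s \<noteq> 0" using False t by (simp add: s_def)
  define A where "A j = \<bar>1 - x j / s\<bar>" for j
  define X where "X = (\<Sum>j\<in>I. A j powr r)"
  define N where "N = real (card I)"
  \<comment> \<open>N is the value of the normalised sum at 1/t = 0 and X its value at 1/s. The
    linear terms of Bernoulli's inequality cancel because the x j sum to zero.\<close>
  have X: "N < X"
  proof -
    have "(\<Sum>j\<in>I. 1 - r * (x j / s)) < X"
      unfolding X_def A_def
    proof (rule sum_strict_mono_ex1[OF I])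
      show "\<forall>j\<in>I. 1 - r * (x j / s) \<le> \<bar>1 - x j / s\<bar> powr r" using abs_powr_bernoulli(1)[OF r] by blast
      show "\<exists>j\<in>I. 1 - r * (x j / s) < \<bar>1 - x j / s\<bar> powr r"
        using abs_powr_bernoulli(2)[OF r, of "x k / s"] nz s by auto
    qed
    moreover have "(\<Sum>j\<in>I. r * (x j / s)) = r / s * (\<Sum>j\<in>I. x j)"
      by (simp add: sum_distrib_left)
    ultimately show ?thesis using sum0 by (simp add: sum_subtractf N_def)
  qed
  \<comment> \<open>Since s = l t, the reciprocal 1/t is l times 1/s; convexity bounds the value
    there by the combination of those at 1/s and at 0.\<close>
  have "\<bar>t - x j\<bar> powr r \<le> \<bar>t\<bar> powr r * (l * A j powr r + (1 - l))" for j
  proof -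
    have "t - x j = t * (l * (1 - x j / s) + (1 - l))" using s t False by (simp add: s_def field_simps)
    then have "\<bar>t - x j\<bar> = \<bar>t\<bar> * \<bar>l * (1 - x j / s) + (1 - l)\<bar>" by (simp only: abs_mult)
    also have "\<dots> \<le> \<bar>t\<bar> * (l * A j + (1 - l))"
    proof (rule mult_left_mono)
      show "\<bar>l * (1 - x j / s) + (1 - l)\<bar> \<le> l * A j + (1 - l)"
        using abs_triangle_ineq[of "l * (1 - x j / s)" "1 - l"] l by (simp add: A_def abs_mult)
    qed simp
    finally have "\<bar>t - x j\<bar> powr r \<le> (\<bar>t\<bar> * (l * A j + (1 - l))) powr r"
      using r by (intro powr_mono2) auto
    also have "\<dots> = \<bar>t\<bar> powr r * (l * A j + (1 - l)) powr r"
      by (rule powr_mult)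
    also have "\<dots> \<le> \<bar>t\<bar> powr r * (l * A j powr r + (1 - l))"
      using l False r by (intro mult_left_mono powr_convex_with_1) (auto simp: A_def)
    finally show ?thesis .
  qed
  then have "(\<Sum>j\<in>I. \<bar>t - x j\<bar> powr r) \<le> (\<Sum>j\<in>I. \<bar>t\<bar> powr r * (l * A j powr r + (1 - l)))"
    by (intro sum_mono) auto
  also have "\<dots> = \<bar>t\<bar> powr r * (l * X + (1 - l) * N)"
    by (simp add: X_def N_def sum.distrib flip: sum_distrib_left)
  finally have "\<bar>t\<bar> powr r \<le> C * (\<bar>t\<bar> powr r * (l * X + (1 - l) * N))"
    using t(2) C by (smt (verit) mult_left_mono)
  then have "\<bar>t\<bar> powr r * 1 \<le> \<bar>t\<bar> powr r * (C * (l * X + (1 - l) * N))" by (simp add: mult.left_commute)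
  then have "1 \<le> C * (l * X + (1 - l) * N)" using t(1) by (simp only: mult_le_cancel_left_pos powr_gt_zero)
  then have 1: "1 \<le> l * (C * X) + (1 - l) * (C * N)" by (simp add: algebra_simps)
  have CX: "C * N < C * X" using X C by simp
  \<comment> \<open>A convex combination of C X and C N is at least 1 and C N < C X, so C X exceeds
    1, because the weight 1 - l of C N is positive.\<close>
  have "1 < C * X"
  proof (rule ccontr)
    assume "\<not> 1 < C * X"
    then have "l * (C * X) \<le> l * 1" "(1 - l) * (C * N) < (1 - l) * 1"
      using CX l False by (auto intro!: mult_left_mono mult_strict_left_mono)
    then show False using 1 by simp
  qed
  then have "\<bar>s\<bar> powr r * 1 < \<bar>s\<bar> powr r * (C * X)" using s by (intro mult_strict_left_mono) auto
  also have "\<dots> = C * (\<Sum>j\<in>I. \<bar>s - x j\<bar> powr r)"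
  proof -
    have "\<bar>s - x j\<bar> powr r = \<bar>s\<bar> powr r * A j powr r" for j
    proof -
      have "s - x j = s * (1 - x j / s)" using s by (simp add: field_simps)
      then have "\<bar>s - x j\<bar> = \<bar>s\<bar> * A j" by (simp only: abs_mult A_def)
      then show ?thesis by (simp add: powr_mult A_def)
    qed
    then show ?thesis by (simp add: X_def sum_distrib_left mult.left_commute)
  qed
  finally show ?thesis by (simp add: s_def)
qed

section \<open>First and second order conditions for an extremal function\<close>

lemma sum_delta_diff:
  fixes F :: "'a \<Rightarrow> real"
  assumes "finite I" "i \<in> I" "j \<in> I"
  shows "(\<Sum>a\<in>I. ((if a = i then 1 else 0) - (if a = j then 1 else 0)) * F a) = F i - F j"
  using assms by (simp add: left_diff_distrib sum_subtractf if_distrib[of "\<lambda>z. z * _"] cong: if_cong)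

text \<open>Summation by parts on the complete graph: by antisymmetry both ends of a pair contribute
  the same amount.\<close>

lemma sum_antisym_diff:
  fixes k :: "'a \<Rightarrow> 'a \<Rightarrow> real"
  assumes "\<And>a b. k a b = - k b a"
  shows "(\<Sum>a\<in>I. \<Sum>b\<in>I. k a b * (d a - d b)) = 2 * (\<Sum>a\<in>I. d a * (\<Sum>b\<in>I. k a b))"
proof -
  have "(\<Sum>a\<in>I. \<Sum>b\<in>I. k a b * d b) = (\<Sum>a\<in>I. \<Sum>b\<in>I. k b a * d a)" by (rule sum.swap)
  also have "\<dots> = - (\<Sum>a\<in>I. \<Sum>b\<in>I. k a b * d a)"
    unfolding sum_negf[symmetric] by (intro sum.cong refl) (metis assms mult_minus_left)
  finally have "(\<Sum>a\<in>I. \<Sum>b\<in>I. k a b * (d a - d b)) = 2 * (\<Sum>a\<in>I. \<Sum>b\<in>I. k a b * d a)"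
    by (simp add: right_diff_distrib sum_subtractf)
  then show ?thesis by (simp add: sum_distrib_left mult.commute)
qed

text \<open>Raising x i and lowering x j by s keeps the mean zero. The difference G s of both sides
  is then nonnegative and vanishes at s = 0, so G' 0 = 0 and the second derivative there is
  nonnegative; these are the two conclusions.\<close>

lemma extremal_conditions:
  fixes x :: "nat \<Rightarrow> real"
  assumes I: "finite I" and p: "p > 2" and sum0: "(\<Sum>i\<in>I. x i) = 0"
    and bound: "\<And>g. (\<Sum>i\<in>I. g i) = 0 \<Longrightarrow>
      (\<Sum>i\<in>I. \<bar>g i\<bar> powr p) \<le> C / 2 * (\<Sum>i\<in>I. \<Sum>j\<in>I. \<bar>g i - g j\<bar> powr p)"
    and eq: "(\<Sum>i\<in>I. \<bar>x i\<bar> powr p) = C / 2 * (\<Sum>i\<in>I. \<Sum>j\<in>I. \<bar>x i - x j\<bar> powr p)"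
    and ij: "i \<in> I" "j \<in> I" "i \<noteq> j"
  defines "\<phi> \<equiv> \<lambda>t. sgn t * \<bar>t\<bar> powr (p - 1)"
  shows "C * (\<Sum>k\<in>I. \<phi> (x i - x k)) - \<phi> (x i) = C * (\<Sum>k\<in>I. \<phi> (x j - x k)) - \<phi> (x j)"
    and "x i = x j \<Longrightarrow> \<bar>x i\<bar> powr (p - 2) \<le> C * (\<Sum>k\<in>I. \<bar>x i - x k\<bar> powr (p - 2))"
proof -
  define d where "d a = (if a = i then 1 else 0) - (if a = j then 1 else (0::real))" for a
  have d_sum: "(\<Sum>a\<in>I. d a * F a) = F i - F j" for F
    unfolding d_def by (rule sum_delta_diff[OF I ij(1,2)])
  define G where "G s = C / 2 * (\<Sum>a\<in>I. \<Sum>b\<in>I. \<bar>x a - x b + s * (d a - d b)\<bar> powr p)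
    - (\<Sum>a\<in>I. \<bar>x a + s * d a\<bar> powr p)" for s
  define G' where "G' s = p * (C / 2 * (\<Sum>a\<in>I. \<Sum>b\<in>I. \<phi> (x a - x b + s * (d a - d b)) * (d a - d b))
    - (\<Sum>a\<in>I. \<phi> (x a + s * d a) * d a))" for s
  define w where "w a b = \<bar>x a - x b\<bar> powr (p - 2)" for a b
  define D where "D = p * (p - 1) * (C / 2 * (\<Sum>a\<in>I. \<Sum>b\<in>I. w a b * (d a - d b)^2)
    - (\<Sum>a\<in>I. \<bar>x a\<bar> powr (p - 2) * (d a)^2))"
  have d1: "((\<lambda>s. \<bar>y + s * e\<bar> powr p) has_real_derivative p * (\<phi> (y + s * e) * e)) (at s)" for y e s
  proof -
    have "((\<lambda>s. \<bar>y + s * e\<bar> powr p) has_real_derivative p * (sgn (y + s * e) * \<bar>y + s * e\<bar> powr (p - 1)) * e) (at s)"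
      using p by (intro DERIV_chain2[where f = "\<lambda>t. \<bar>t\<bar> powr p"] has_real_derivative_abs_powr) (auto intro!: derivative_eq_intros)
    then show ?thesis by (simp add: \<phi>_def mult.assoc)
  qed
  have d2: "((\<lambda>s. \<phi> (y + s * e) * e) has_real_derivative (p - 1) * (\<bar>y\<bar> powr (p - 2) * e^2)) (at 0)" for y e
  proof -
    have "((\<lambda>s. \<phi> (y + s * e)) has_real_derivative (p - 1) * \<bar>y + 0 * e\<bar> powr (p - 1 - 1) * e) (at 0)"
      unfolding \<phi>_def
      using p by (intro DERIV_chain2[where f = "\<lambda>t. sgn t * \<bar>t\<bar> powr (p - 1)"] has_real_derivative_sgn_powr)
        (auto intro!: derivative_eq_intros)
    from DERIV_cmult_right[OF this, of e] show ?thesis by (simp add: power2_eq_square mult.assoc)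
  qed
  have "G 0 = 0" by (simp add: G_def eq)
  moreover have "0 \<le> G s" for s
  proof -
    have "(\<Sum>a\<in>I. d a) = 0" using d_sum[of "\<lambda>_. 1"] by simp
    then have "(\<Sum>a\<in>I. x a + s * d a) = 0" by (simp add: sum.distrib sum0 flip: sum_distrib_left)
    from bound[OF this] show ?thesis by (simp add: G_def algebra_simps)
  qed
  ultimately have min: "G 0 \<le> G s" for s by simp
  have G': "(G has_real_derivative G' s) (at s)" for s
  proof -
    have "(G has_real_derivative C / 2 * (\<Sum>a\<in>I. \<Sum>b\<in>I. p * (\<phi> (x a - x b + s * (d a - d b)) * (d a - d b)))
      - (\<Sum>a\<in>I. p * (\<phi> (x a + s * d a) * d a))) (at s)"
      unfolding G_def[abs_def] by (intro DERIV_diff DERIV_cmult DERIV_sum d1)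
    moreover have "C / 2 * (p * X) - p * Y = p * (C / 2 * X - Y)" for X Y
      by (simp add: algebra_simps)
    ultimately show ?thesis by (simp only: G'_def flip: sum_distrib_left)
  qed
  have G'': "(G' has_real_derivative D) (at 0)"
  proof -
    have "(G' has_real_derivative p * (C / 2 * (\<Sum>a\<in>I. \<Sum>b\<in>I. (p - 1) * (w a b * (d a - d b)^2))
      - (\<Sum>a\<in>I. (p - 1) * (\<bar>x a\<bar> powr (p - 2) * (d a)^2)))) (at 0)"
      unfolding G'_def[abs_def] w_def by (intro DERIV_diff DERIV_cmult DERIV_sum d2)
    moreover have "p * (C / 2 * ((p - 1) * X) - (p - 1) * Y) = p * (p - 1) * (C / 2 * X - Y)" for X Y
      by (simp add: algebra_simps)
    ultimately show ?thesis by (simp only: D_def flip: sum_distrib_left)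
  qed
  note opt = second_derivative_nonneg[OF min G' G'']
  have "(\<Sum>a\<in>I. \<Sum>b\<in>I. \<phi> (x a - x b) * (d a - d b)) = 2 * (\<Sum>a\<in>I. d a * (\<Sum>b\<in>I. \<phi> (x a - x b)))"
  proof (rule sum_antisym_diff)
    fix a b
    show "\<phi> (x a - x b) = - \<phi> (x b - x a)" by (simp add: \<phi>_def sgn_if abs_minus_commute)
  qed
  moreover have "C / 2 * (\<Sum>a\<in>I. \<Sum>b\<in>I. \<phi> (x a - x b) * (d a - d b)) - (\<Sum>a\<in>I. d a * \<phi> (x a)) = 0"
    using opt(1) p by (simp add: G'_def mult.commute)
  ultimately show "C * (\<Sum>k\<in>I. \<phi> (x i - x k)) - \<phi> (x i) = C * (\<Sum>k\<in>I. \<phi> (x j - x k)) - \<phi> (x j)"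
    by (simp add: d_sum right_diff_distrib)
  assume xij: "x i = x j"
  have "(\<Sum>a\<in>I. \<Sum>b\<in>I. w a b * (d a - d b)^2)
    = (\<Sum>a\<in>I. \<Sum>b\<in>I. w a b * (d a)^2) + (\<Sum>a\<in>I. \<Sum>b\<in>I. w a b * (d b)^2) - 2 * (\<Sum>a\<in>I. d a * (\<Sum>b\<in>I. d b * w a b))"
    by (simp add: power2_diff algebra_simps sum.distrib sum_subtractf sum_distrib_left)
  also have "(\<Sum>a\<in>I. \<Sum>b\<in>I. w a b * (d b)^2) = (\<Sum>b\<in>I. \<Sum>a\<in>I. w a b * (d b)^2)" by (rule sum.swap)
  also have "\<dots> = (\<Sum>a\<in>I. \<Sum>b\<in>I. w a b * (d a)^2)" by (simp add: w_def abs_minus_commute)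
  \<comment> \<open>The mixed term only involves weights between i and j, including i = i and j = j.
    All of them are powers of 0 because x i = x j.\<close>
  also have "(\<Sum>a\<in>I. d a * (\<Sum>b\<in>I. d b * w a b)) = 0"
    unfolding d_sum by (simp add: w_def xij)
  finally have "(\<Sum>a\<in>I. \<Sum>b\<in>I. w a b * (d a - d b)^2) = 2 * (\<Sum>a\<in>I. \<Sum>b\<in>I. w a b * (d a)^2)"
    by simp
  moreover have "(\<Sum>a\<in>I. \<Sum>b\<in>I. w a b * (d a)^2) = (\<Sum>a\<in>I. (d a)^2 * (\<Sum>b\<in>I. w a b))"
    by (simp add: mult.commute[of _ "sum _ _"] flip: sum_distrib_right)
  ultimately have ww: "(\<Sum>a\<in>I. \<Sum>b\<in>I. w a b * (d a - d b)^2) = 2 * (\<Sum>a\<in>I. (d a)^2 * (\<Sum>b\<in>I. w a b))"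
    by simp
  have "0 \<le> C / 2 * (\<Sum>a\<in>I. \<Sum>b\<in>I. w a b * (d a - d b)^2) - (\<Sum>a\<in>I. \<bar>x a\<bar> powr (p - 2) * (d a)^2)"
  proof -
    have "0 < p * (p - 1)" using p by simp
    then show ?thesis using opt(2) unfolding D_def zero_le_mult_iff by (meson not_le)
  qed
  also have "\<dots> = (\<Sum>a\<in>I. d a * (d a * (C * (\<Sum>b\<in>I. w a b) - \<bar>x a\<bar> powr (p - 2))))"
    unfolding ww by (simp add: power2_eq_square algebra_simps sum_subtractf sum_distrib_left)
  also have "\<dots> = 2 * (C * (\<Sum>b\<in>I. w i b) - \<bar>x i\<bar> powr (p - 2))"
    unfolding d_sum using ij by (simp add: d_def w_def xij)
  finally show "\<bar>x i\<bar> powr (p - 2) \<le> C * (\<Sum>k\<in>I. \<bar>x i - x k\<bar> powr (p - 2))"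
    by (simp add: w_def)
qed

text \<open>
  The gradient of the extremal problem is the function \<Psi> below. The set U where its derivative is
  nonnegative is an interval around 0. As \<Psi> takes the same value at all the x i, there is at most
  one x i in U, one above U and one below U; the latter two are attained only once by the second
  order condition.
\<close>
lemma extremal_three_values:
  fixes x :: "nat \<Rightarrow> real"
  assumes n: "n \<ge> 3" and p: "p > 3" and C: "C > 0" and sum0: "(\<Sum>i=1..n. x i) = 0"
    and nz: "k \<in> {1..n}" "x k \<noteq> 0"
    and bound: "\<And>g. (\<Sum>i=1..n. g i) = 0 \<Longrightarrow>
      (\<Sum>i=1..n. \<bar>g i\<bar> powr p) \<le> C / 2 * (\<Sum>i=1..n. \<Sum>j=1..n. \<bar>g i - g j\<bar> powr p)"
    and eq: "(\<Sum>i=1..n. \<bar>x i\<bar> powr p) = C / 2 * (\<Sum>i=1..n. \<Sum>j=1..n. \<bar>x i - x j\<bar> powr p)"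
  obtains u v M where "u \<in> {1..n}" "v \<in> {1..n}" "u \<noteq> v" "\<And>i. i \<in> {1..n} - {u, v} \<Longrightarrow> x i = M"
    "x v \<le> M" "M \<le> x u"
proof -
  define \<phi> where "\<phi> t = sgn t * \<bar>t\<bar> powr (p - 1)" for t :: real
  define \<Psi> where "\<Psi> t = C * (\<Sum>j=1..n. \<phi> (t - x j)) - \<phi> t" for t
  define \<psi> where "\<psi> t = C * (\<Sum>j=1..n. \<bar>t - x j\<bar> powr (p - 2)) - \<bar>t\<bar> powr (p - 2)" for t
  define U where "U = {t. 0 \<le> \<psi> t}"
  have same: "\<Psi> (x i) = \<Psi> (x j)" if "i \<in> {1..n}" "j \<in> {1..n}" for i j
    using extremal_conditions(1)[OF _ _ sum0 bound eq that, folded \<phi>_def] p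
    by (cases "i = j") (auto simp: \<Psi>_def \<phi>_def)
  \<comment> \<open>Used in contrapositive form: a value outside U is attained at one vertex
    only.\<close>
  have double: "x i \<in> U" if "i \<in> {1..n}" "j \<in> {1..n}" "i \<noteq> j" "x i = x j" for i j
    using extremal_conditions(2)[OF _ _ sum0 bound eq that] p by (auto simp: U_def \<psi>_def)
  have star: "0 < \<psi> (l * t)" if "t \<noteq> 0" "t \<in> U" "0 \<le> l" "l < 1" for t l
    using powr_dominance_star_shaped[OF _ _ C sum0 nz, of "p - 2" t l] that p
    by (auto simp: U_def \<psi>_def)
  have inner: "0 < \<psi> w" if "t \<in> U" "0 \<le> w \<and> w < t \<or> t < w \<and> w \<le> 0" for w t
  proof -
    have "0 < \<psi> (w / t * t)" using that by (intro star) (auto simp: field_simps)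
    then show ?thesis using that by auto
  qed
  have deriv: "(\<Psi> has_real_derivative (p - 1) * \<psi> t) (at t)" for t
  proof -
    have d: "((\<lambda>t. \<phi> (t - a)) has_real_derivative (p - 1) * \<bar>t - a\<bar> powr (p - 2)) (at t)" for a
    proof -
      have "((\<lambda>t. \<phi> (t - a)) has_real_derivative (p - 1) * \<bar>t - a\<bar> powr (p - 1 - 1) * 1) (at t)"
        unfolding \<phi>_def
        using p by (intro DERIV_chain2[where f = "\<lambda>t. sgn t * \<bar>t\<bar> powr (p - 1)"] has_real_derivative_sgn_powr)
          (auto intro!: derivative_eq_intros)
      then show ?thesis by simp
    qed
    have "(\<Psi> has_real_derivative C * (\<Sum>j=1..n. (p - 1) * \<bar>t - x j\<bar> powr (p - 2)) - (p - 1) * \<bar>t - 0\<bar> powr (p - 2)) (at t)"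
      unfolding \<Psi>_def[abs_def] using d[of 0] by (intro DERIV_diff DERIV_cmult DERIV_sum d) simp
    moreover have "C * ((p - 1) * X) - (p - 1) * Y = (p - 1) * (C * X - Y)" for X Y
      by (simp add: algebra_simps)
    ultimately show ?thesis by (simp only: \<psi>_def diff_zero flip: sum_distrib_left)
  qed
  have mvt: "\<exists>w. s < w \<and> w < t \<and> \<Psi> t - \<Psi> s = (t - s) * ((p - 1) * \<psi> w)" if "s < t" for s t
    using that deriv by (intro MVT2) auto
  have U_unique: "s = t" if "s \<in> U" "t \<in> U" "\<Psi> s = \<Psi> t" for s t
  proof -
    have False if st: "s < t" "s \<in> U" "t \<in> U" "\<Psi> s = \<Psi> t" for s t
    proof -
      obtain w where w: "s < w" "w < t" "\<Psi> t - \<Psi> s = (t - s) * ((p - 1) * \<psi> w)" using mvt[OF st(1)] by blast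
      have "0 < \<psi> w" using inner[of t w] inner[of s w] st w by (cases "0 \<le> w") auto
      then show False using w st p by simp
    qed
    from this[of s t] this[of t s] show ?thesis using that by fastforce
  qed
  \<comment> \<open>Equal values of \<Psi> would give a zero w of \<psi> between s and t. Then w is
    in U, and \<open>inner\<close> would put whichever of s and t is closer to 0 into U as
    well.\<close>
  have outer_unique: "s = t" if "s \<notin> U" "t \<notin> U" "0 < s \<and> 0 < t \<or> s < 0 \<and> t < 0" "\<Psi> s = \<Psi> t" for s t
  proof -
    have False if st: "s < t" "s \<notin> U" "t \<notin> U" "0 < s \<or> t < 0" "\<Psi> s = \<Psi> t" for s t
    proof -
      obtain w where w: "s < w" "w < t" "\<Psi> t - \<Psi> s = (t - s) * ((p - 1) * \<psi> w)" using mvt[OF st(1)] by blast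
      then have "w \<in> U" using st p by (simp add: U_def)
      then have "0 < \<psi> s \<or> 0 < \<psi> t" using inner[of w s] inner[of w t] st w by auto
      then show False using st by (auto simp: U_def)
    qed
    from this[of s t] this[of t s] show ?thesis using that by (metis linorder_neqE_linordered_idom)
  qed
  have U0: "0 \<in> U" using C by (auto simp: U_def \<psi>_def intro!: mult_nonneg_nonneg sum_nonneg)
  define Up where "Up = {i\<in>{1..n}. x i \<notin> U \<and> x i > 0}"
  define Lo where "Lo = {i\<in>{1..n}. x i \<notin> U \<and> x i < 0}"
  have Up1: "i = j" if "i \<in> Up" "j \<in> Up" for i j
    using double[of i j] outer_unique[of "x i" "x j"] same[of i j] that unfolding Up_def by blast
  have Lo1: "i = j" if "i \<in> Lo" "j \<in> Lo" for i j
    using double[of i j] outer_unique[of "x i" "x j"] same[of i j] that unfolding Lo_def by blast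
  have rest: "x i \<in> U" if "i \<in> {1..n} - Up - Lo" for i
    using that U0 by (cases "x i = 0") (auto simp: Up_def Lo_def)
  have fin: "finite Up" "finite Lo" by (auto simp: Up_def Lo_def)
  have "card (Up \<union> Lo) \<le> 2"
  proof -
    have "card Up \<le> 1" "card Lo \<le> 1" using Up1 Lo1 fin by (simp_all add: card_le_Suc0_iff_eq)
    then show ?thesis using card_Un_le[of Up Lo] by simp
  qed
  moreover have "Up \<union> Lo \<subseteq> {1..n}" by (auto simp: Up_def Lo_def)
  \<comment> \<open>Here n \<ge> 3 matters: at most two vertices have values outside U, so some
    vertex m has its value in U.\<close>
  ultimately have "Up \<union> Lo \<subset> {1..n}" using n by (metis card_atLeastAtMost diff_Suc_1 not_numeral_le_zero numeral_le_iff order.not_eq_order_implies_strict le_trans semiring_norm(72) eval_nat_numeral(3) not_less_eq_eq order_refl)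
  then obtain m where m: "m \<in> {1..n}" "m \<notin> Up" "m \<notin> Lo" by blast
  define M where "M = x m"
  have MU: "M \<in> U" using rest m by (simp add: M_def)
  have restM: "x i = M" if "i \<in> {1..n} - Up - Lo" for i
    using U_unique[of "x i" M] rest[OF that] MU same[of i m] that m unfolding M_def by blast
  have leM: "M \<le> x i" if "i \<in> Up" for i
    using inner[of M "x i"] MU that by (force simp: Up_def U_def)
  have geM: "x i \<le> M" if "i \<in> Lo" for i
    using inner[of M "x i"] MU that by (force simp: Lo_def U_def)
  \<comment> \<open>When no value lies outside U on one side, the vertex m with value M takes the
    place of the missing extreme vertex; a constant function may use any two vertices.\<close>
  consider (a) u v where "Up = {u}" "Lo = {v}" | (b) u where "Up = {u}" "Lo = {}"
    | (c) v where "Up = {}" "Lo = {v}" | (d) "Up = {}" "Lo = {}"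
    using Up1 Lo1 by (metis insertI1 is_singletonI' is_singleton_def)
  then show ?thesis
  proof cases
    case a
    have "u \<in> Up" "v \<in> Lo" using a by auto
    then have "u \<in> {1..n}" "v \<in> {1..n}" "u \<noteq> v" by (auto simp: Up_def Lo_def)
    moreover have "x i = M" if "i \<in> {1..n} - {u, v}" for i using a that by (intro restM) auto
    ultimately show ?thesis using leM[OF \<open>u \<in> Up\<close>] geM[OF \<open>v \<in> Lo\<close>] by (intro that[of u v M])
  next
    case b
    then have "u \<in> Up" by auto
    then have "u \<in> {1..n}" "u \<noteq> m" using m by (auto simp: Up_def)
    moreover have "x i = M" if "i \<in> {1..n} - {u, m}" for i using b that by (intro restM) auto
    moreover have "x m \<le> M" by (simp add: M_def)
    ultimately show ?thesis using leM[OF \<open>u \<in> Up\<close>] m(1) by (intro that[of u m M])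
  next
    case c
    then have "v \<in> Lo" by auto
    then have "v \<in> {1..n}" "m \<noteq> v" using m by (auto simp: Lo_def)
    moreover have "x i = M" if "i \<in> {1..n} - {m, v}" for i using c that by (intro restM) auto
    moreover have "M \<le> x m" by (simp add: M_def)
    ultimately show ?thesis using geM[OF \<open>v \<in> Lo\<close>] m(1) by (intro that[of m v M])
  next
    case d
    then have "x i = M" if "i \<in> {1..n}" for i using that by (intro restM) auto
    then show ?thesis using n by (intro that[of 1 2 M]) auto
  qed
qed

section \<open>Existence of an extremal function\<close>

text \<open>Functions live on all natural numbers. Setting them to 0 off the vertices places them in
  a product of compact sets, and the two sum conditions are closed in the product topology.\<close>

lemma compact_normalised:
  assumes "p > 0"
  shows "compact {x :: nat \<Rightarrow> real. (\<forall>i. i \<notin> {1..n} \<longrightarrow> x i = 0) \<and> (\<Sum>i=1..n. x i) = 0 \<and> (\<Sum>i=1..n. \<bar>x i\<bar> powr p) = 1}"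
    (is "compact ?S")
proof -
  let ?K = "PiE UNIV (\<lambda>i. if i \<in> {1..n} then {-1..1::real} else {0})"
  let ?T = "{x :: nat \<Rightarrow> real. (\<Sum>i=1..n. x i) = 0 \<and> (\<Sum>i=1..n. \<bar>x i\<bar> powr p) = 1}"
  have "compactin (product_topology (\<lambda>i. euclidean) UNIV) ?K"
    by (simp add: compactin_PiE)
  then have "compact ?K" by (simp add: euclidean_product_topology)
  moreover have "closed ?T"
    using assms by (intro closed_Collect_conj closed_Collect_eq continuous_intros
      continuous_on_powr' continuous_on_product_coordinates) auto
  ultimately have "compact (?K \<inter> ?T)" by (rule compact_Int_closed)
  moreover have "?K \<inter> ?T = ?S"
  proof (intro set_eqI iffI)
    fix x assume x: "x \<in> ?S"
    have "\<bar>x i\<bar> \<le> 1" if "i \<in> {1..n}" for i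
    proof (rule ccontr)
      assume "\<not> \<bar>x i\<bar> \<le> 1"
      then have "1 < \<bar>x i\<bar> powr p" using assms by (simp add: gr_one_powr)
      also have "\<dots> \<le> (\<Sum>i=1..n. \<bar>x i\<bar> powr p)" using that by (intro member_le_sum) auto
      finally show False using x by simp
    qed
    then show "x \<in> ?K \<inter> ?T" using x by (auto simp: PiE_def Pi_def abs_le_iff split: if_splits)
  next
    fix x assume x: "x \<in> ?K \<inter> ?T"
    have "x i \<in> (if i \<in> {1..n} then {-1..1::real} else {0})" for i
      by (rule PiE_mem[OF IntD1[OF x] UNIV_I])
    then have "x i = 0" if "i \<notin> {1..n}" for i by (metis that singletonD)
    then show "x \<in> ?S" using IntD2[OF x] by simp
  qed
  ultimately show ?thesis by simp
qed

text \<open>Only the best constant D has to be compared with C. A function attaining D has the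
  three-value form, so the hypothesis applied to this single function yields D \<le> C.\<close>

lemma three_value_reduction:
  assumes n: "n \<ge> 3" and p: "p > 3"
    and three: "\<And>(x :: nat \<Rightarrow> real) u v M. u \<in> {1..n} \<Longrightarrow> v \<in> {1..n} \<Longrightarrow> u \<noteq> v \<Longrightarrow>
      (\<And>i. i \<in> {1..n} - {u, v} \<Longrightarrow> x i = M) \<Longrightarrow> x v \<le> M \<Longrightarrow> M \<le> x u \<Longrightarrow> (\<Sum>i=1..n. x i) = 0 \<Longrightarrow>
      (\<Sum>i=1..n. \<bar>x i\<bar> powr p) \<le> C * (pair_sum p n x / 2)"
  shows "variation_bound p n C"
proof -
  define L where "L x = (\<Sum>i=1..n. \<bar>x i\<bar> powr p)" for x :: "nat \<Rightarrow> real"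
  define S where "S = {x :: nat \<Rightarrow> real. (\<forall>i. i \<notin> {1..n} \<longrightarrow> x i = 0) \<and> (\<Sum>i=1..n. x i) = 0 \<and> L x = 1}"
  have L0: "0 \<le> L x" for x unfolding L_def by (intro sum_nonneg) auto
  have normalise: "\<exists>y\<in>S. pair_sum p n g = L g * pair_sum p n y" if g: "(\<Sum>i=1..n. g i) = 0" "L g > 0" for g
  proof -
    define c where "c = L g powr (- 1 / p)"
    have c: "c > 0" using g by (simp add: c_def)
    have "c powr p = L g powr - 1" unfolding c_def powr_powr using p by simp
    then have cp: "c powr p = 1 / L g" using g(2) by (simp add: powr_neg_one)
    define y where "y i = (if i \<in> {1..n} then c * g i else 0)" for i
    have "(\<Sum>i=1..n. y i) = 0" using g by (simp add: y_def flip: sum_distrib_left)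
    moreover have "L y = c powr p * L g"
      using c by (simp add: L_def y_def abs_mult powr_mult sum_distrib_left)
    then have "L y = 1" using cp g(2) by simp
    ultimately have "y \<in> S" by (simp add: S_def y_def)
    moreover have "pair_sum p n y = c powr p * pair_sum p n g"
    proof -
      have "\<bar>y i - y j\<bar> powr p = c powr p * \<bar>g i - g j\<bar> powr p" if "i \<in> {1..n}" "j \<in> {1..n}" for i j
      proof -
        have "y i - y j = c * (g i - g j)" using that by (simp add: y_def algebra_simps)
        then show ?thesis using c by (simp add: abs_mult powr_mult)
      qed
      then show ?thesis unfolding pair_sum_def by (simp add: sum_distrib_left)
    qed
    ultimately show ?thesis using cp g(2) by (intro bexI[of _ y]) simp_all
  qed
  have "compact S" unfolding S_def L_def using p by (intro compact_normalised) simp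
  moreover have "S \<noteq> {}"
  proof -
    define g where "g i = (if i = 1 then 1 else if i = 2 then - 1 else (0::real))" for i :: nat
    have "{1..n} = {1, 2} \<union> {3..n}" using n by auto
    then have "(\<Sum>i=1..n. g i) = 0" "L g = 2" by (simp_all add: L_def g_def sum.union_disjoint)
    then show ?thesis using normalise[of g] by auto
  qed
  moreover have "continuous_on S (pair_sum p n)"
    unfolding pair_sum_def using p by (intro continuous_intros continuous_on_powr'
      continuous_on_subset[OF continuous_on_product_coordinates]) auto
  ultimately obtain x where x: "x \<in> S" and min: "\<And>y. y \<in> S \<Longrightarrow> pair_sum p n x \<le> pair_sum p n y"
    using continuous_attains_inf[of S "pair_sum p n"] by blast
  have x': "(\<Sum>i=1..n. x i) = 0" "L x = 1" using x by (simp_all add: S_def)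
  obtain k where k: "k \<in> {1..n}" "x k \<noteq> 0"
  proof (rule ccontr)
    assume "\<not> thesis"
    then have "L x = (\<Sum>i=1..n. 0)" unfolding L_def by (intro sum.cong) (use that in auto)
    then show False using x'(2) by simp
  qed
  have V: "pair_sum p n x > 0"
  proof -
    have "\<exists>j\<in>{1..n}. x k \<noteq> x j"
    proof (rule ccontr)
      assume "\<not> (\<exists>j\<in>{1..n}. x k \<noteq> x j)"
      then have "(\<Sum>i=1..n. x i) = (\<Sum>i=1..n. x k)" by (intro sum.cong) auto
      then show False using x'(1) k n by simp
    qed
    then show ?thesis using pair_sum_pos[OF k(1)] by blast
  qed
  \<comment> \<open>By homogeneity the minimum of \<open>pair_sum\<close> over normalised functions
    determines the best constant; the 2 accounts for ordered pairs.\<close>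
  define D where "D = 2 / pair_sum p n x"
  have bound: "L g \<le> D / 2 * pair_sum p n g" if g0: "(\<Sum>i=1..n. g i) = 0" for g
  proof (cases "L g > 0")
    case True
    then obtain y where y: "y \<in> S" "pair_sum p n g = L g * pair_sum p n y" using normalise[OF g0] by blast
    have "L g * pair_sum p n x \<le> pair_sum p n g" using min[OF y(1)] True by (simp add: y(2))
    then show ?thesis using V by (simp add: D_def field_simps)
  next
    case False
    then show ?thesis using L0[of g] V pair_sum_nonneg[of p n g] by (simp add: D_def)
  qed
  have eq: "L x = D / 2 * pair_sum p n x" using V x' by (simp add: D_def)
  have "D > 0" using V by (simp add: D_def)
  have "1 \<le> C * (pair_sum p n x / 2)"
  proof (rule extremal_three_values[OF n p \<open>D > 0\<close> x'(1) k bound[unfolded L_def pair_sum_def] eq[unfolded L_def pair_sum_def]])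
    fix u v M assume "u \<in> {1..n}" "v \<in> {1..n}" "u \<noteq> v" "\<And>i. i \<in> {1..n} - {u, v} \<Longrightarrow> x i = M" "x v \<le> M" "M \<le> x u"
    from three[OF this x'(1)] show "1 \<le> C * (pair_sum p n x / 2)" using x'(2) unfolding L_def by simp
  qed
  then have DC: "D \<le> C" using V by (simp add: D_def field_simps)
  show ?thesis
    unfolding variation_bound_def
  proof
    fix f
    define g where "g i = f i - mean n f" for i
    have "L g \<le> D / 2 * pair_sum p n g" unfolding g_def using n by (intro bound sum_deviation(2)) simp
    also have "\<dots> \<le> C / 2 * pair_sum p n g" using DC pair_sum_nonneg[of p n g] by (intro mult_right_mono) auto
    also have "pair_sum p n g = pair_sum p n f" by (simp add: pair_sum_def g_def)
    finally show "deviation p n f \<le> C * p_variation p n f powr p"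
      using p by (simp add: p_variation_powr deviation_def L_def g_def)
  qed
qed

section \<open>The inequality for three values\<close>

lemma sum_three_valued:
  fixes x :: "nat \<Rightarrow> real" and F :: "real \<Rightarrow> real"
  assumes uv: "u \<in> {1..n}" "v \<in> {1..n}" "u \<noteq> v" and M: "\<And>i. i \<in> {1..n} - {u, v} \<Longrightarrow> x i = M"
  shows "(\<Sum>i=1..n. F (x i)) = F (x u) + F (x v) + (real n - 2) * F M"
proof -
  have "(\<Sum>i=1..n. F (x i)) = (\<Sum>i\<in>{u, v}. F (x i)) + (\<Sum>i\<in>{1..n} - {u, v}. F (x i))"
    using uv by (subst add.commute, intro sum.subset_diff) auto
  also have "(\<Sum>i\<in>{1..n} - {u, v}. F (x i)) = (\<Sum>i\<in>{1..n} - {u, v}. F M)"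
    by (intro sum.cong refl) (simp only: M)
  also have "\<dots> = (real n - 2) * F M"
  proof -
    have "2 \<le> n" using uv by auto
    moreover have "card ({1..n} - {u, v}) = n - 2" using uv by (subst card_Diff_subset) auto
    ultimately show ?thesis by (simp add: of_nat_diff)
  qed
  finally show ?thesis using uv by simp
qed

lemma pair_sum_three_valued:
  fixes x :: "nat \<Rightarrow> real"
  assumes "p > 0" "u \<in> {1..n}" "v \<in> {1..n}" "u \<noteq> v" "\<And>i. i \<in> {1..n} - {u, v} \<Longrightarrow> x i = M"
  shows "pair_sum p n x / 2
    = \<bar>x u - x v\<bar> powr p + (real n - 2) * (\<bar>x u - M\<bar> powr p + \<bar>x v - M\<bar> powr p)"
proof -
  have s: "(\<Sum>i=1..n. F (x i)) = F (x u) + F (x v) + (real n - 2) * F M" for F :: "real \<Rightarrow> real"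
    using assms(2-5) by (rule sum_three_valued)
  have "pair_sum p n x
    = (\<Sum>i=1..n. \<bar>x i - x u\<bar> powr p + \<bar>x i - x v\<bar> powr p + (real n - 2) * \<bar>x i - M\<bar> powr p)"
    unfolding pair_sum_def using s[of "\<lambda>t. \<bar>x _ - t\<bar> powr p"] by simp
  also have "\<dots> = 2 * (\<bar>x u - x v\<bar> powr p + (real n - 2) * (\<bar>x u - M\<bar> powr p + \<bar>x v - M\<bar> powr p))"
    using s[of "\<lambda>t. \<bar>t - x u\<bar> powr p + \<bar>t - x v\<bar> powr p + (real n - 2) * \<bar>t - M\<bar> powr p"] assms(1)
    by (simp add: abs_minus_commute algebra_simps)
  finally show ?thesis by simp
qed

lemma three_valued_inequality:
  fixes x :: "nat \<Rightarrow> real"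
  assumes n: "n \<ge> 3" and p: "p > 1"
    and uv: "u \<in> {1..n}" "v \<in> {1..n}" "u \<noteq> v" and M: "\<And>i. i \<in> {1..n} - {u, v} \<Longrightarrow> x i = M"
    and le: "x v \<le> M" "M \<le> x u" and sum0: "(\<Sum>i=1..n. x i) = 0"
  defines "\<eta> \<equiv> (real n - 2) / real n"
  assumes ineq: "\<And>h. 0 \<le> h \<Longrightarrow> h \<le> 1 \<Longrightarrow>
      (1 + \<eta> * h) powr p + (1 - \<eta> * h) powr p + (real n - 2) * ((1 - \<eta>) * h) powr p
      \<le> C * (2 powr p + (real n - 2) * ((1 + h) powr p + (1 - h) powr p))"
  shows "(\<Sum>i=1..n. \<bar>x i\<bar> powr p) \<le> C * (pair_sum p n x / 2)"
proof -
  have S: "(\<Sum>i=1..n. F (x i)) = F (x u) + F (x v) + (real n - 2) * F M" for F :: "real \<Rightarrow> real"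
    using uv M by (rule sum_three_valued)
  have V: "pair_sum p n x / 2 = \<bar>x u - x v\<bar> powr p + (real n - 2) * (\<bar>x u - M\<bar> powr p + \<bar>x v - M\<bar> powr p)"
    using uv M p by (intro pair_sum_three_valued) auto
  show ?thesis
  proof (cases "x u = x v")
    case True
    then have uM: "x u = M" "x v = M" using le by auto
    have "x u + x v + (real n - 2) * M = 0" using S[of "\<lambda>t. t"] sum0 by simp
    then have "real n * M = 0" unfolding uM by (simp add: algebra_simps)
    then have "M = 0" using n by simp
    then show ?thesis
      using S[of "\<lambda>t. \<bar>t\<bar> powr p"] V p uM by simp
  next
    case False
    \<comment> \<open>d is half the distance between the extreme values and h the offset of M from
      their midpoint in units of d. Mean zero puts this midpoint at - \<eta> d h, so d and h
      determine everything, and d cancels by homogeneity.\<close>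
    define d where "d = (x u - x v) / 2"
    define h where "h = (2 * M - x u - x v) / (x u - x v)"
    have d: "d > 0" using False le by (simp add: d_def)
    have h: "-1 \<le> h" "h \<le> 1" using False le by (simp_all add: h_def field_simps)
    have eta: "0 \<le> \<eta>" "\<eta> \<le> 1" using n by (simp_all add: \<eta>_def)
    have eh: "\<bar>\<eta> * h\<bar> \<le> 1"
      using eta h mult_mono[of "\<bar>\<eta>\<bar>" 1 "\<bar>h\<bar>" 1] by (simp add: abs_mult)
    have sum: "x u + x v + (real n - 2) * M = 0" using S[of "\<lambda>t. t"] sum0 by simp
    have dh: "d * h = M - (x u + x v) / 2" using False by (simp add: d_def h_def field_simps)
    have m: "(x u + x v) / 2 = - \<eta> * (d * h)"
    proof -
      define s where "s = (x u + x v) / 2"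
      have "2 * s = x u + x v" by (simp add: s_def field_simps)
      then have "2 * s + (real n - 2) * M = 0" using sum by linarith
      then have "real n * s = - (real n - 2) * (d * h)" unfolding dh s_def[symmetric] by (simp add: algebra_simps)
      then have "real n * ((x u + x v) / 2) = - (real n - 2) * (d * h)" unfolding s_def .
      then show ?thesis using n by (simp add: \<eta>_def field_simps)
    qed
    have xu: "x u = d * (1 - \<eta> * h)" and xv: "x v = - (d * (1 + \<eta> * h))" and xM: "M = d * ((1 - \<eta>) * h)"
      using m dh by (simp_all add: d_def algebra_simps) (simp_all add: field_simps)
    have abs: "\<bar>x u\<bar> = d * (1 - \<eta> * h)" "\<bar>x v\<bar> = d * (1 + \<eta> * h)" "\<bar>M\<bar> = d * ((1 - \<eta>) * \<bar>h\<bar>)"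
      "\<bar>x u - x v\<bar> = d * 2" "\<bar>x u - M\<bar> = d * (1 - h)" "\<bar>x v - M\<bar> = d * (1 + h)"
    proof -
      have "0 \<le> 1 - \<eta> * h" "0 \<le> 1 + \<eta> * h" using eh by linarith+
      then show "\<bar>x u\<bar> = d * (1 - \<eta> * h)" "\<bar>x v\<bar> = d * (1 + \<eta> * h)" using d unfolding xu xv by (simp_all add: abs_mult)
      show "\<bar>M\<bar> = d * ((1 - \<eta>) * \<bar>h\<bar>)" using d eta unfolding xM by (simp add: abs_mult)
      have "x u - x v = d * 2" "x u - M = d * (1 - h)" "x v - M = - (d * (1 + h))"
        unfolding xu xv xM by (simp_all add: algebra_simps)
      then show "\<bar>x u - x v\<bar> = d * 2" "\<bar>x u - M\<bar> = d * (1 - h)" "\<bar>x v - M\<bar> = d * (1 + h)"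
        using d h by (simp_all add: abs_mult)
    qed
    \<comment> \<open>Replacing h by - h only exchanges the roles of u and v, which reduces the
      inequality to h \<ge> 0.\<close>
    have even: "(1 + c * h) powr p + (1 - c * h) powr p = (1 + c * \<bar>h\<bar>) powr p + (1 - c * \<bar>h\<bar>) powr p" for c
      by (cases "0 \<le> h") auto
    have "(\<Sum>i=1..n. \<bar>x i\<bar> powr p) = d powr p *
      ((1 + \<eta> * \<bar>h\<bar>) powr p + (1 - \<eta> * \<bar>h\<bar>) powr p + (real n - 2) * ((1 - \<eta>) * \<bar>h\<bar>) powr p)"
      unfolding S[of "\<lambda>t. \<bar>t\<bar> powr p"] abs even[symmetric]
      by (simp only: powr_mult) (simp add: algebra_simps)
    also have "\<dots> \<le> d powr p * (C * (2 powr p + (real n - 2) * ((1 + \<bar>h\<bar>) powr p + (1 - \<bar>h\<bar>) powr p)))"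
      using h by (intro mult_left_mono ineq) auto
    also have "\<dots> = C * (pair_sum p n x / 2)"
    proof -
      have "(1 + \<bar>h\<bar>) powr p + (1 - \<bar>h\<bar>) powr p = (1 + h) powr p + (1 - h) powr p"
        using even[of 1] by simp
      then show ?thesis
        unfolding V abs by (simp only: powr_mult) (simp add: algebra_simps)
    qed
    finally show ?thesis .
  qed
qed

section \<open>Monotonicity in the parameter h\<close>

lemma three_point_derivative:
  fixes \<eta> C N h p :: real
  assumes p: "p > 1" and eta: "0 < \<eta>" "\<eta> < 1" "N - 2 = N * \<eta>" and h: "0 < h" "h < 1"
  shows "((\<lambda>h. C * (2 powr p + (N - 2) * ((1 + h) powr p + (1 - h) powr p))
      - ((1 + \<eta> * h) powr p + (1 - \<eta> * h) powr p + (N - 2) * ((1 - \<eta>) * h) powr p))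
    has_real_derivative p * \<eta> * (C * N * ((1 + h) powr (p - 1) - (1 - h) powr (p - 1))
      - ((1 + \<eta> * h) powr (p - 1) - (1 - \<eta> * h) powr (p - 1)) - 2 * ((1 - \<eta>) * h) powr (p - 1))) (at h)"
proof -
  have pos: "1 + h > 0" "1 - h > 0" "1 + \<eta> * h > 0" "1 - \<eta> * h > 0" "(1 - \<eta>) * h > 0"
    using h eta mult_strict_mono[of \<eta> 1 h 1] by (auto simp: add_pos_pos)
  have d: "((\<lambda>h. (a + b * h) powr p) has_real_derivative p * (a + b * h) powr (p - 1) * b) (at h)"
    if "a + b * h > 0" for a b
    using that by (intro DERIV_chain2[where f = "\<lambda>t. t powr p"] has_real_derivative_powr) (auto intro!: derivative_eq_intros)
  have d1: "((\<lambda>h. (1 + h) powr p) has_real_derivative p * (1 + h) powr (p - 1)) (at h)"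
    "((\<lambda>h. (1 - h) powr p) has_real_derivative - (p * (1 - h) powr (p - 1))) (at h)"
    "((\<lambda>h. (1 - \<eta> * h) powr p) has_real_derivative - (p * (1 - \<eta> * h) powr (p - 1) * \<eta>)) (at h)"
    "((\<lambda>h. ((1 - \<eta>) * h) powr p) has_real_derivative p * ((1 - \<eta>) * h) powr (p - 1) * (1 - \<eta>)) (at h)"
    using d[of 1 1] d[of 1 "-1"] d[of 1 "- \<eta>"] d[of 0 "1 - \<eta>"] pos by simp_all
  \<comment> \<open>This relation gives the term of the N - 2 equal vertices the factor p * \<eta>
    that the other terms already have.\<close>
  have two: "(N - 2) * (1 - \<eta>) = 2 * \<eta>" using eta(3) by (simp add: algebra_simps)
  have "((\<lambda>h. C * (2 powr p + (N - 2) * ((1 + h) powr p + (1 - h) powr p))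
      - ((1 + \<eta> * h) powr p + (1 - \<eta> * h) powr p + (N - 2) * ((1 - \<eta>) * h) powr p))
    has_real_derivative C * (0 + (N - 2) * (p * (1 + h) powr (p - 1) + - (p * (1 - h) powr (p - 1))))
      - (p * (1 + \<eta> * h) powr (p - 1) * \<eta> + - (p * (1 - \<eta> * h) powr (p - 1) * \<eta>)
        + (N - 2) * (p * ((1 - \<eta>) * h) powr (p - 1) * (1 - \<eta>)))) (at h)"
    by (intro DERIV_diff DERIV_add DERIV_cmult DERIV_const d1 d pos)
  moreover have "C * (0 + (N - 2) * (p * a + - (p * b))) - (p * a' * \<eta> + - (p * b' * \<eta>) + (N - 2) * (p * e * (1 - \<eta>)))
    = p * \<eta> * (C * N * (a - b) - (a' - b') - 2 * e)" for a b a' b' e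
  proof -
    have lin: "C * (0 + X * (p * a + - (p * b))) - (p * a' * \<eta> + - (p * b' * \<eta>) + X * (p * e * (1 - \<eta>)))
      = C * X * (p * (a - b)) - p * \<eta> * (a' - b') - X * (1 - \<eta>) * (p * e)" for X
      by (simp add: algebra_simps)
    show ?thesis unfolding lin two unfolding eta(3) by (simp add: algebra_simps)
  qed
  ultimately show ?thesis by (simp only:)
qed

lemma three_point_continuous:
  fixes \<eta> C N p :: real
  assumes "p > 0" "0 < \<eta>" "\<eta> < 1"
  shows "continuous_on {0..1} (\<lambda>h. C * (2 powr p + (N - 2) * ((1 + h) powr p + (1 - h) powr p))
      - ((1 + \<eta> * h) powr p + (1 - \<eta> * h) powr p + (N - 2) * ((1 - \<eta>) * h) powr p))"
proof -
  have c: "continuous_on {0..1} (\<lambda>h. (a + b * h) powr p)" if "\<And>h. 0 \<le> h \<Longrightarrow> h \<le> 1 \<Longrightarrow> 0 \<le> a + b * h" for a b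
    using that assms(1) by (intro continuous_on_powr' continuous_on_add continuous_on_mult
      continuous_on_const continuous_on_id) auto
  have "0 \<le> 1 - \<eta> * h" "0 \<le> (1 - \<eta>) * h" "0 \<le> 1 + \<eta> * h" if "0 \<le> h" "h \<le> 1" for h
    using that assms mult_mono[of \<eta> 1 h 1] by auto
  then have "continuous_on {0..1} (\<lambda>h. (1 + \<eta> * h) powr p)" "continuous_on {0..1} (\<lambda>h. (1 - \<eta> * h) powr p)"
    "continuous_on {0..1} (\<lambda>h. ((1 - \<eta>) * h) powr p)" "continuous_on {0..1} (\<lambda>h. (1 + h) powr p)"
    "continuous_on {0..1} (\<lambda>h. (1 - h) powr p)"
    using c[of 1 \<eta>] c[of 1 "- \<eta>"] c[of 0 "1 - \<eta>"] c[of 1 1] c[of 1 "-1"] by simp_all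
  then show ?thesis
    by (intro continuous_on_diff continuous_on_add continuous_on_mult continuous_on_const)
qed

text \<open>\<open>start\<close> is equality at h = 0, and \<open>k\<close> is the sign of the
  derivative after division by p * \<eta>.\<close>

lemma three_point_from_left:
  fixes \<eta> C N h p :: real
  assumes p: "p > 1" and eta: "0 < \<eta>" "\<eta> < 1" "N - 2 = N * \<eta>" and h: "0 \<le> h" "h \<le> 1"
    and start: "C * (2 powr p + 2 * (N - 2)) = 2"
    and k: "\<And>h. 0 < h \<Longrightarrow> h < 1 \<Longrightarrow> (1 + \<eta> * h) powr (p - 1) - (1 - \<eta> * h) powr (p - 1) + 2 * ((1 - \<eta>) * h) powr (p - 1)
      \<le> C * N * ((1 + h) powr (p - 1) - (1 - h) powr (p - 1))"
  shows "(1 + \<eta> * h) powr p + (1 - \<eta> * h) powr p + (N - 2) * ((1 - \<eta>) * h) powr p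
      \<le> C * (2 powr p + (N - 2) * ((1 + h) powr p + (1 - h) powr p))"
proof -
  define g where "g h = C * (2 powr p + (N - 2) * ((1 + h) powr p + (1 - h) powr p))
      - ((1 + \<eta> * h) powr p + (1 - \<eta> * h) powr p + (N - 2) * ((1 - \<eta>) * h) powr p)" for h
  have "g 0 \<le> g h"
  proof (rule DERIV_nonneg_imp_increasing_open[where f = g, OF h(1)])
    fix y assume "0 < y" "y < h"
    then have y: "0 < y" "y < 1" using h by auto
    have "0 \<le> p * \<eta> * (C * N * ((1 + y) powr (p - 1) - (1 - y) powr (p - 1))
      - ((1 + \<eta> * y) powr (p - 1) - (1 - \<eta> * y) powr (p - 1)) - 2 * ((1 - \<eta>) * y) powr (p - 1))"
      using k[OF y] p eta by (intro mult_nonneg_nonneg) auto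
    then show "\<exists>D. (g has_real_derivative D) (at y) \<and> 0 \<le> D"
      unfolding g_def[abs_def] using three_point_derivative[OF p eta y, of C] by blast
  next
    show "continuous_on {0..h} g"
      unfolding g_def[abs_def] using p eta h by (intro continuous_on_subset[OF three_point_continuous]) auto
  qed
  moreover have "g 0 = 0" using start p by (simp add: g_def algebra_simps)
  ultimately show ?thesis by (simp add: g_def)
qed

text \<open>The mirror image: \<open>start\<close> is equality at h = 1, and the derivative has the
  other sign.\<close>

lemma three_point_from_right:
  fixes \<eta> C N h p :: real
  assumes p: "p > 1" and eta: "0 < \<eta>" "\<eta> < 1" "N - 2 = N * \<eta>" and h: "0 \<le> h" "h \<le> 1"
    and start: "C * (2 powr p + (N - 2) * 2 powr p) = (1 + \<eta>) powr p + (1 - \<eta>) powr p + (N - 2) * (1 - \<eta>) powr p"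
    and k: "\<And>h. 0 < h \<Longrightarrow> h < 1 \<Longrightarrow> C * N * ((1 + h) powr (p - 1) - (1 - h) powr (p - 1))
      \<le> (1 + \<eta> * h) powr (p - 1) - (1 - \<eta> * h) powr (p - 1) + 2 * ((1 - \<eta>) * h) powr (p - 1)"
  shows "(1 + \<eta> * h) powr p + (1 - \<eta> * h) powr p + (N - 2) * ((1 - \<eta>) * h) powr p
      \<le> C * (2 powr p + (N - 2) * ((1 + h) powr p + (1 - h) powr p))"
proof -
  define g where "g h = C * (2 powr p + (N - 2) * ((1 + h) powr p + (1 - h) powr p))
      - ((1 + \<eta> * h) powr p + (1 - \<eta> * h) powr p + (N - 2) * ((1 - \<eta>) * h) powr p)" for h
  have "g 1 \<le> g h"
  proof (rule DERIV_nonpos_imp_decreasing_open[where f = g, OF h(2)])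
    fix y assume "h < y" "y < 1"
    then have y: "0 < y" "y < 1" using h by auto
    have "p * \<eta> * (C * N * ((1 + y) powr (p - 1) - (1 - y) powr (p - 1))
      - ((1 + \<eta> * y) powr (p - 1) - (1 - \<eta> * y) powr (p - 1)) - 2 * ((1 - \<eta>) * y) powr (p - 1)) \<le> 0"
      using k[OF y] p eta by (intro mult_nonneg_nonpos) auto
    then show "\<exists>D. (g has_real_derivative D) (at y) \<and> D \<le> 0"
      unfolding g_def[abs_def] using three_point_derivative[OF p eta y, of C] by blast
  next
    show "continuous_on {h..1} g"
      unfolding g_def[abs_def] using p eta h by (intro continuous_on_subset[OF three_point_continuous]) auto
  qed
  moreover have "g 1 = 0" using start p by (simp add: g_def algebra_simps)
  ultimately show ?thesis by (simp add: g_def)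
qed

section \<open>Sign of the derivative for the Dirac delta constant\<close>

text \<open>For s \<le> 2 the difference w z is concave in z and vanishes at 0, hence w \<eta> is at
  least \<eta> w 1.\<close>

lemma powr_difference_concave:
  fixes s \<eta> c t :: real
  assumes s: "1 < s" "s \<le> 2" and eta: "0 < \<eta>" "\<eta> < 1" and c: "c \<le> \<eta>" and t: "t > 1"
  shows "c * ((t + 1) powr s - (t - 1) powr s) \<le> (t + \<eta>) powr s - (t - \<eta>) powr s"
proof -
  define w where "w z = (t + z) powr s - (t - z) powr s" for z
  have "concave_on {0..1} w"
  proof (rule f''_le0_imp_concave)
    fix z :: real assume z: "z \<in> {0..1}"
    have pos: "t + z > 0" "t - z > 0" using z t by auto
    show "(w has_real_derivative s * (t + z) powr (s - 1) + s * (t - z) powr (s - 1)) (at z)"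
      unfolding w_def[abs_def] using pos by (auto intro!: derivative_eq_intros simp: field_simps)
    show "((\<lambda>z. s * (t + z) powr (s - 1) + s * (t - z) powr (s - 1)) has_real_derivative
      s * (s - 1) * ((t + z) powr (s - 2) - (t - z) powr (s - 2))) (at z)"
      using pos by (auto intro!: derivative_eq_intros simp: algebra_simps)
    have "(t + z) powr (s - 2) \<le> (t - z) powr (s - 2)" using pos s z by (intro powr_mono2') auto
    then show "s * (s - 1) * ((t + z) powr (s - 2) - (t - z) powr (s - 2)) \<le> 0"
      using s by (intro mult_nonneg_nonpos) auto
  qed simp
  then have "(1 - \<eta>) * w 0 + \<eta> * w 1 \<le> w ((1 - \<eta>) *\<^sub>R 0 + \<eta> *\<^sub>R 1)"
    using eta by (intro concave_onD) auto
  then have "\<eta> * w 1 \<le> w \<eta>" by (simp add: w_def)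
  moreover have "0 \<le> w 1" using t s by (simp add: w_def powr_mono2)
  then have "c * w 1 \<le> \<eta> * w 1" using c by (intro mult_right_mono)
  ultimately show ?thesis by (simp add: w_def)
qed

lemma powr_difference_at_1:
  fixes s \<eta> c Q :: real
  assumes s: "2 \<le> s" "s \<le> Q - 1" and eta: "1 / 3 \<le> \<eta>" "\<eta> < 1"
    and c: "c = ((1 + \<eta>) / 2) powr Q + ((1 - \<eta>) / 2) powr Q"
  shows "c * 2 powr s \<le> (1 + \<eta>) powr s - (1 - \<eta>) powr s"
proof -
  have "c \<le> ((1 + \<eta>) / 2) powr (s + 1) + ((1 - \<eta>) / 2) powr (s + 1)"
    unfolding c using s eta by (intro add_mono powr_mono') auto
  then have "c * 2 powr s \<le> (((1 + \<eta>) / 2) powr (s + 1) + ((1 - \<eta>) / 2) powr (s + 1)) * 2 powr s"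
    by (intro mult_right_mono) auto
  also have "\<dots> = ((1 + \<eta>) * (1 + \<eta>) powr s + (1 - \<eta>) * (1 - \<eta>) powr s) / 2"
    using eta by (simp add: powr_divide powr_add field_simps)
  also have "\<dots> \<le> (1 + \<eta>) powr s - (1 - \<eta>) powr s"
  proof -
    have e: "(1 + \<eta>) powr s = (1 + \<eta>)^2 * (1 + \<eta>) powr (s - 2)" "(1 - \<eta>) powr s = (1 - \<eta>)^2 * (1 - \<eta>) powr (s - 2)"
      using eta by (simp_all flip: powr_numeral powr_add)
    \<comment> \<open>This is equivalent to \<eta> \<ge> 1/3, that is to n \<ge> 3, and settles s =
      2; larger s only favours the base 1 + \<eta>.\<close>
    have "(1 - \<eta>) * (3 - \<eta>) \<le> (1 + \<eta>)^2" using eta by (simp add: power2_eq_square algebra_simps)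
    then have "(1 - \<eta>)^2 * (3 - \<eta>) \<le> (1 + \<eta>)^2 * (1 - \<eta>)"
      using eta mult_left_mono[of "(1 - \<eta>) * (3 - \<eta>)" "(1 + \<eta>)^2" "1 - \<eta>"] by (simp add: power2_eq_square algebra_simps)
    then have "(1 - \<eta>)^2 * (3 - \<eta>) * (1 - \<eta>) powr (s - 2) \<le> (1 + \<eta>)^2 * (1 - \<eta>) * (1 + \<eta>) powr (s - 2)"
      using eta s by (intro mult_mono[of "_ * _" "_ * _"] powr_mono2) auto
    then have "(3 - \<eta>) * (1 - \<eta>) powr s \<le> (1 - \<eta>) * (1 + \<eta>) powr s"
      unfolding e by (simp add: algebra_simps)
    then show ?thesis by (simp add: field_simps)
  qed
  finally show ?thesis .
qed

text \<open>Differentiating in t lowers the exponent s by one. The induction descends to s \<le> 2,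
  where concavity applies, and the value at t = 1 comes from \<open>powr_difference_at_1\<close>.
  The condition c \<le> \<eta> compares the leading terms for large t.\<close>

lemma powr_difference_bound:
  fixes s \<eta> c t Q :: real
  assumes eta: "1 / 3 \<le> \<eta>" "\<eta> < 1" and c: "c = ((1 + \<eta>) / 2) powr Q + ((1 - \<eta>) / 2) powr Q" "c \<le> \<eta>"
    and s: "1 < s" "s \<le> Q - 1" and t: "t > 1"
  shows "c * ((t + 1) powr s - (t - 1) powr s) \<le> (t + \<eta>) powr s - (t - \<eta>) powr s"
proof -
  have "c * ((t + 1) powr s - (t - 1) powr s) \<le> (t + \<eta>) powr s - (t - \<eta>) powr s"
    if "1 < s" "s \<le> Q - 1" "s \<le> real m + 2" "t > 1" for m s t
    using that
  proof (induction m arbitrary: s t)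
    case 0
    then show ?case using eta c(2) by (intro powr_difference_concave) auto
  next
    case (Suc m)
    show ?case
    proof (cases "s \<le> 2")
      case True
      then show ?thesis using Suc.prems eta c(2) by (intro powr_difference_concave) auto
    next
      case False
      define D where "D t = (t + \<eta>) powr s - (t - \<eta>) powr s - c * ((t + 1) powr s - (t - 1) powr s)" for t
      have "D 1 \<le> D t"
      proof (rule DERIV_nonneg_imp_increasing_open[where f = D])
        show "1 \<le> t" using Suc.prems by simp
        fix y :: real assume y: "1 < y" "y < t"
        have "(D has_real_derivative s * ((y + \<eta>) powr (s - 1) - (y - \<eta>) powr (s - 1)
          - c * ((y + 1) powr (s - 1) - (y - 1) powr (s - 1)))) (at y)"
          unfolding D_def[abs_def] using y eta by (auto intro!: derivative_eq_intros simp: algebra_simps)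
        moreover have "c * ((y + 1) powr (s - 1) - (y - 1) powr (s - 1)) \<le> (y + \<eta>) powr (s - 1) - (y - \<eta>) powr (s - 1)"
          using Suc.prems False y by (intro Suc.IH) auto
        ultimately show "\<exists>d. (D has_real_derivative d) (at y) \<and> 0 \<le> d"
          using Suc.prems by (intro exI conjI) (assumption, simp)
      next
        show "continuous_on {1..t} D"
          unfolding D_def[abs_def] using Suc.prems eta by (intro continuous_intros continuous_on_powr') auto
      qed
      moreover have "0 \<le> D 1"
        using powr_difference_at_1[OF _ Suc.prems(2) eta c(1)] False Suc.prems by (simp add: D_def)
      ultimately show ?thesis by (simp add: D_def)
    qed
  qed
  from this[OF s _ t, of "nat \<lceil>s\<rceil>"] show ?thesis by linarith
qed

text \<open>Division by h^q and the substitution t = 1/h turn the term (1 - \<eta>)^q into a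
  constant, which differentiation in t removes. The choice of c makes the resulting function K
  vanish at t = 1.\<close>

lemma three_point_gradient_nonpos:
  fixes q \<eta> c h :: real
  assumes eta: "1 / 3 \<le> \<eta>" "\<eta> < 1" and c: "c = ((1 + \<eta>) / 2) powr q + ((1 - \<eta>) / 2) powr q" "c \<le> \<eta>"
    and q: "q > 2" and h: "0 < h" "h < 1"
  shows "c * ((1 + h) powr q - (1 - h) powr q)
    \<le> (1 + \<eta> * h) powr q - (1 - \<eta> * h) powr q + 2 * ((1 - \<eta>) * h) powr q"
proof -
  define K where "K t = (t + \<eta>) powr q - (t - \<eta>) powr q + 2 * (1 - \<eta>) powr q - c * ((t + 1) powr q - (t - 1) powr q)" for t
  define t where "t = 1 / h"
  have t: "t > 1" using h by (simp add: t_def)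
  have "K 1 \<le> K t"
  proof (rule DERIV_nonneg_imp_increasing_open[where f = K])
    show "1 \<le> t" using t by simp
    fix y :: real assume y: "1 < y" "y < t"
    have "(K has_real_derivative q * ((y + \<eta>) powr (q - 1) - (y - \<eta>) powr (q - 1)
      - c * ((y + 1) powr (q - 1) - (y - 1) powr (q - 1)))) (at y)"
      unfolding K_def[abs_def] using y eta by (auto intro!: derivative_eq_intros simp: algebra_simps)
    moreover have "c * ((y + 1) powr (q - 1) - (y - 1) powr (q - 1)) \<le> (y + \<eta>) powr (q - 1) - (y - \<eta>) powr (q - 1)"
      using y eta c q by (intro powr_difference_bound[where Q = q]) auto
    ultimately show "\<exists>d. (K has_real_derivative d) (at y) \<and> 0 \<le> d"
      using q by (intro exI conjI) (assumption, simp)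
  next
    show "continuous_on {1..t} K"
      unfolding K_def[abs_def] using q eta by (intro continuous_intros continuous_on_powr') auto
  qed
  moreover have "K 1 = 0"
    using eta q unfolding K_def c(1) by (simp add: powr_divide add_divide_distrib[symmetric])
  ultimately have "0 \<le> h powr q * K t" using h by simp
  also have "\<dots> = (1 + \<eta> * h) powr q - (1 - \<eta> * h) powr q + 2 * ((1 - \<eta>) * h) powr q
    - c * ((1 + h) powr q - (1 - h) powr q)"
  proof -
    have e: "(h * y) powr q = h powr q * y powr q" for y by (rule powr_mult)
    have "h * (t + 1) = 1 + h" "h * (t - 1) = 1 - h" "h * (t + \<eta>) = 1 + \<eta> * h" "h * (t - \<eta>) = 1 - \<eta> * h"
      "h * (1 - \<eta>) = (1 - \<eta>) * h"
      using h by (simp_all add: t_def algebra_simps)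
    then show ?thesis
      using e[of "t + 1"] e[of "t - 1"] e[of "t + \<eta>"] e[of "t - \<eta>"] e[of "1 - \<eta>"] by (simp add: K_def algebra_simps)
  qed
  finally show ?thesis by simp
qed

section \<open>Sign of the derivative for the constant of the values a + c, a, ..., a, a - c\<close>

text \<open>All terms are replaced by linear functions of h: the convex difference on the right by
  its tangent 2 q h at 0, the one on the left by its chord of slope 2^q. The assumption on c
  compares the slopes.\<close>

lemma three_point_gradient_nonneg:
  fixes q \<eta> c h :: real
  assumes eta: "0 < \<eta>" "\<eta> < 1" and q: "q > 2" and h: "0 < h" "h < 1"
    and c: "\<eta> * 2 powr q + 2 * (1 - \<eta>)^2 \<le> c * (2 * q)" and c0: "0 \<le> c"
  shows "(1 + \<eta> * h) powr q - (1 - \<eta> * h) powr q + 2 * ((1 - \<eta>) * h) powr q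
    \<le> c * ((1 + h) powr q - (1 - h) powr q)"
proof -
  \<comment> \<open>Twice the odd part of (1 + z)^q; the prime does not denote a derivative.\<close>
  define o' where "o' z = (1 + z) powr q - (1 - z) powr q" for z
  have der: "(o' has_real_derivative q * ((1 + z) powr (q - 1) + (1 - z) powr (q - 1))) (at z)" if "0 \<le> z" "z < 1" for z
    unfolding o'_def[abs_def] using that by (auto intro!: derivative_eq_intros simp: algebra_simps)
  have conv: "convex_on {0..<1} o'"
  proof (rule f''_ge0_imp_convex)
    fix z :: real assume z: "z \<in> {0..<1}"
    show "(o' has_real_derivative q * ((1 + z) powr (q - 1) + (1 - z) powr (q - 1))) (at z)" using z by (intro der) auto
    show "((\<lambda>z. q * ((1 + z) powr (q - 1) + (1 - z) powr (q - 1))) has_real_derivative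
      q * (q - 1) * ((1 + z) powr (q - 2) - (1 - z) powr (q - 2))) (at z)"
      using z by (auto intro!: derivative_eq_intros simp: algebra_simps)
    have "(1 - z) powr (q - 2) \<le> (1 + z) powr (q - 2)" using z q by (intro powr_mono2) auto
    then show "0 \<le> q * (q - 1) * ((1 + z) powr (q - 2) - (1 - z) powr (q - 2))"
      using q by (intro mult_nonneg_nonneg) auto
  qed simp
  have cont: "continuous_on {0..1} o'"
    unfolding o'_def[abs_def] using q by (intro continuous_intros continuous_on_powr') auto
  \<comment> \<open>Bernoulli's inequality at z and - z shows that the derivative of o' is at least
    its value 2 q at 0.\<close>
  have lower: "2 * q * h \<le> o' h"
  proof -
    have "o' 0 - 2 * q * 0 \<le> o' h - 2 * q * h"
    proof (rule DERIV_nonneg_imp_increasing_open[where f = "\<lambda>z. o' z - 2 * q * z"])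
      fix z assume z: "0 < z" "z < h"
      have "((\<lambda>z. o' z - 2 * q * z) has_real_derivative q * ((1 + z) powr (q - 1) + (1 - z) powr (q - 1)) - 2 * q * 1) (at z)"
        using z h by (intro DERIV_diff der DERIV_cmult DERIV_ident) auto
      moreover have "q * 2 \<le> q * ((1 + z) powr (q - 1) + (1 - z) powr (q - 1))"
        using abs_powr_bernoulli(1)[of "q - 1" z] abs_powr_bernoulli(1)[of "q - 1" "- z"] q z h
        by (intro mult_left_mono) auto
      ultimately show "\<exists>D. ((\<lambda>z. o' z - 2 * q * z) has_real_derivative D) (at z) \<and> 0 \<le> D"
        by (intro exI conjI) (assumption, simp)
    next
      show "continuous_on {0..h} (\<lambda>z. o' z - 2 * q * z)"
        using h by (intro continuous_intros continuous_on_subset[OF cont]) auto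
    qed (use h in simp)
    then show ?thesis by (simp add: o'_def)
  qed
  \<comment> \<open>By convexity and o' 0 = 0 the quotient o' z / z increases, up to 2^q at z =
    1.\<close>
  have upper: "o' z \<le> z * 2 powr q" if z: "0 < z" "z < 1" for z
  proof -
    have "o' z / z \<le> o' 1 / 1"
    proof (rule DERIV_nonneg_imp_increasing_open[where f = "\<lambda>y. o' y / y"])
      fix y assume y: "z < y" "y < 1"
      define d where "d = q * ((1 + y) powr (q - 1) + (1 - y) powr (q - 1))"
      have d: "(o' has_real_derivative d) (at y)" using y z unfolding d_def by (intro der) auto
      have "o' 0 - o' y \<ge> d * (0 - y)"
        using y z by (intro convex_on_imp_above_tangent[OF conv, of y] has_field_derivative_at_within[OF d]) auto
      then have "0 \<le> (d * y - o' y * 1) / (y * y)" using y z by (simp add: o'_def)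
      moreover have "((\<lambda>y. o' y / y) has_real_derivative (d * y - o' y * 1) / (y * y)) (at y)"
        using y z by (intro DERIV_divide d DERIV_ident) auto
      ultimately show "\<exists>D. ((\<lambda>y. o' y / y) has_real_derivative D) (at y) \<and> 0 \<le> D" by blast
    next
      show "continuous_on {z..1} (\<lambda>y. o' y / y)"
        using z by (intro continuous_intros continuous_on_subset[OF cont]) auto
    qed (use z in simp)
    then show ?thesis using z q by (simp add: o'_def field_simps)
  qed
  have "o' (\<eta> * h) \<le> \<eta> * h * 2 powr q"
    using eta h mult_strict_mono[of \<eta> 1 h 1] by (intro upper) auto
  moreover have "((1 - \<eta>) * h) powr q \<le> (1 - \<eta>)^2 * h"
  proof -
    have "((1 - \<eta>) * h) powr q = (1 - \<eta>) powr q * h powr q" by (rule powr_mult)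
    also have "\<dots> \<le> (1 - \<eta>) powr 2 * h powr 1"
      using eta h q by (intro mult_mono powr_mono') auto
    finally show ?thesis using eta h by simp
  qed
  moreover have "h * (\<eta> * 2 powr q + 2 * (1 - \<eta>)^2) \<le> h * (c * (2 * q))" using c h by (intro mult_left_mono) auto
  moreover have "c * (2 * q * h) \<le> c * o' h" using lower c0 by (intro mult_left_mono)
  ultimately show ?thesis by (simp add: o'_def algebra_simps)
qed

section \<open>Exponents above 3\<close>

lemma sharp_variation_boundI:
  assumes "p > 0" "variation_bound p n C" "attains_equality p n C f"
    and "i \<in> {1..n}" "j \<in> {1..n}" "f i \<noteq> f j"
  shows "sharp_variation_bound p n C"
  unfolding sharp_variation_bound_def
proof (intro conjI allI impI notI assms(2))
  fix C' assume C': "C' < C" "variation_bound p n C'"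
  have "p_variation p n f powr p > 0" using pair_sum_pos[OF assms(4-6), of p] assms(1) by (simp add: p_variation_powr)
  then have "C' * p_variation p n f powr p < C * p_variation p n f powr p" using C'(1) by simp
  then show False using C'(2) assms(3) unfolding variation_bound_def attains_equality_def by (metis not_le)
qed

lemma variation_bound_dirac:
  assumes n: "n \<ge> 3" and p: "p > 3"
    and hyp: "(1 + (real n - 1) powr (p - 1)) / real n powr (p - 1) \<le> (real n - 2) / real n"
  shows "variation_bound p n ((1 + (real n - 1) powr (p - 1)) / real n powr p)"
proof (rule three_value_reduction[OF n p])
  fix x :: "nat \<Rightarrow> real" and u v M
  assume uvM: "u \<in> {1..n}" "v \<in> {1..n}" "u \<noteq> v" "\<And>i. i \<in> {1..n} - {u, v} \<Longrightarrow> x i = M"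
    "x v \<le> M" "M \<le> x u" "(\<Sum>i=1..n. x i) = 0"
  define N where "N = real n"
  define \<eta> where "\<eta> = (N - 2) / N"
  define C where "C = (1 + (N - 1) powr (p - 1)) / N powr p"
  have N: "N \<ge> 3" using n by (simp add: N_def)
  have eta: "1 / 3 \<le> \<eta>" "0 < \<eta>" "\<eta> < 1" "N - 2 = N * \<eta>" using N by (simp_all add: \<eta>_def field_simps)
  have eta': "1 + \<eta> = 2 * (N - 1) / N" "1 - \<eta> = 2 / N" using N by (simp_all add: \<eta>_def field_simps)
  have NN: "N powr p = N * N powr (p - 1)" "(N - 1) powr p = (N - 1) * (N - 1) powr (p - 1)"
    using N powr_add[of N 1 "p - 1"] powr_add[of "N - 1" 1 "p - 1"] by simp_all
  \<comment> \<open>At h = 1 the ratios (1 + \<eta>) / 2 and (1 - \<eta>) / 2 are the deviations (N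
    - 1) / N and 1 / N of a Dirac delta of height 1.\<close>
  have c: "C * N = ((1 + \<eta>) / 2) powr (p - 1) + ((1 - \<eta>) / 2) powr (p - 1)"
  proof -
    have "(1 + \<eta>) / 2 = (N - 1) / N" "(1 - \<eta>) / 2 = 1 / N" using N by (simp_all add: \<eta>_def field_simps)
    then show ?thesis using N by (simp add: C_def NN powr_divide add_divide_distrib distrib_right)
  qed
  have "C * N = (1 + (N - 1) powr (p - 1)) / N powr (p - 1)" using N by (simp add: C_def NN)
  then have c_le: "C * N \<le> \<eta>" using hyp by (simp add: \<eta>_def N_def)
  have start: "C * (2 powr p + (N - 2) * 2 powr p) = (1 + \<eta>) powr p + (1 - \<eta>) powr p + (N - 2) * (1 - \<eta>) powr p"
  proof -
    have "(2 * (N - 1) / N) powr p = 2 powr p * ((N - 1) * (N - 1) powr (p - 1)) / N powr p"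
      "(2 / N) powr p = 2 powr p / N powr p"
      by (simp_all only: powr_divide powr_mult NN(2))
    then show ?thesis using N unfolding C_def eta' by (simp only:) (simp add: field_simps)
  qed
  have "(\<Sum>i=1..n. \<bar>x i\<bar> powr p) \<le> C * (pair_sum p n x / 2)"
  proof (rule three_valued_inequality[OF n _ uvM], unfold N_def[symmetric] \<eta>_def[symmetric])
    show "(1 + \<eta> * h) powr p + (1 - \<eta> * h) powr p + (N - 2) * ((1 - \<eta>) * h) powr p
      \<le> C * (2 powr p + (N - 2) * ((1 + h) powr p + (1 - h) powr p))" if "0 \<le> h" "h \<le> 1" for h
      using three_point_from_right[OF _ eta(2-4) that start] three_point_gradient_nonpos[OF eta(1,3) c c_le] p
      by simp
  qed (use p in simp)
  then show "(\<Sum>i=1..n. \<bar>x i\<bar> powr p) \<le> (1 + (real n - 1) powr (p - 1)) / real n powr p * (pair_sum p n x / 2)"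
    by (simp add: C_def N_def)
qed

section \<open>Exponents that satisfy the condition of (v)\<close>

text \<open>The left side is a sum of powers of 1/n and (n - 1)/n and decreases in p, so p = 4 is
  decisive. There the gap is n (n - 3) / n^3, which vanishes for n = 3.\<close>

lemma dirac_condition_ge_4:
  assumes n: "n \<ge> 3" and p: "p \<ge> 4"
  shows "(1 + (real n - 1) powr (p - 1)) / real n powr (p - 1) \<le> (real n - 2) / real n"
proof -
  define N where "N = real n"
  have N: "N \<ge> 3" using n by (simp add: N_def)
  have "(1 + (N - 1) powr (p - 1)) / N powr (p - 1) = (1 / N) powr (p - 1) + ((N - 1) / N) powr (p - 1)"
    using N by (simp add: powr_divide add_divide_distrib)
  also have "\<dots> \<le> (1 / N) powr 3 + ((N - 1) / N) powr 3"
    using N p by (intro add_mono powr_mono') auto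
  also have "\<dots> = (1 + (N - 1) ^ 3) / N ^ 3"
    using N by (simp add: powr_numeral power_divide add_divide_distrib)
  also have "\<dots> \<le> (N - 2) / N"
  proof -
    have "N^2 * (N - 2) - (1 + (N - 1) ^ 3) = N * (N - 3)" by (simp add: eval_nat_numeral algebra_simps)
    moreover have "0 \<le> N * (N - 3)" using N by simp
    ultimately have "1 + (N - 1) ^ 3 \<le> N^2 * (N - 2)" by linarith
    then have "(1 + (N - 1) ^ 3) / N ^ 3 \<le> N^2 * (N - 2) / N ^ 3" using N by (intro divide_right_mono) auto
    also have "\<dots> = (N - 2) / N" using N by (simp add: eval_nat_numeral)
    finally show ?thesis .
  qed
  finally show ?thesis by (simp add: N_def)
qed

text \<open>Bounding n^(1-p) by n^(-2) leaves ((n - 1)/n)^(p-1) \<le> (n^2 - 2 n - 1) / n^2, and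
  taking logarithms gives the threshold. It exceeds 3 because n^2 - 2 n - 1 < (n - 1)^2, which
  justifies the bound.\<close>

lemma dirac_condition_delta2:
  assumes n: "n \<ge> 3" and p: "p \<ge> 3 + delta2 n"
  shows "(1 + (real n - 1) powr (p - 1)) / real n powr (p - 1) \<le> (real n - 2) / real n"
proof -
  define N where "N = real n"
  define q where "q = p - 1"
  have N: "N \<ge> 3" using n by (simp add: N_def)
  have N2: "N^2 - 2 * N - 1 > 0"
  proof -
    have "N * (N - 2) \<ge> 3 * 1" using N by (intro mult_mono) auto
    then show ?thesis by (simp add: power2_eq_square algebra_simps)
  qed
  have l: "ln N - ln (N - 1) > 0" using N by simp
  have q: "(2 * ln N - ln (N^2 - 2 * N - 1)) / (ln N - ln (N - 1)) \<le> q"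
    using p by (simp add: delta2_def N_def q_def)
  have "q \<ge> 2"
  proof -
    have "N^2 - 2 * N - 1 \<le> (N - 1)^2" by (simp add: power2_eq_square algebra_simps)
    then have "ln (N^2 - 2 * N - 1) \<le> ln ((N - 1)^2)" using N2 by (intro ln_mono) auto
    then have "ln (N^2 - 2 * N - 1) \<le> 2 * ln (N - 1)" using N by (simp add: ln_realpow)
    then have "2 * (ln N - ln (N - 1)) \<le> 2 * ln N - ln (N^2 - 2 * N - 1)" by simp
    then have "2 \<le> (2 * ln N - ln (N^2 - 2 * N - 1)) / (ln N - ln (N - 1))" using l by (simp add: field_simps)
    then show ?thesis using q by simp
  qed
  have "2 * ln N - ln (N^2 - 2 * N - 1) \<le> q * (ln N - ln (N - 1))" using q l by (simp add: field_simps)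
  then have "q * ln (N - 1) - q * ln N \<le> ln (N^2 - 2 * N - 1) - 2 * ln N" by (simp add: algebra_simps)
  then have "exp (q * ln (N - 1) - q * ln N) \<le> exp (ln (N^2 - 2 * N - 1) - 2 * ln N)" by simp
  moreover have "exp (q * ln (N - 1) - q * ln N) = (N - 1) powr q / N powr q"
    using N by (simp add: exp_diff powr_def)
  moreover have "exp (ln (N^2 - 2 * N - 1) - 2 * ln N) = (N^2 - 2 * N - 1) / N^2"
  proof -
    have "2 * ln N = ln (N^2)" using N by (simp add: ln_realpow)
    then show ?thesis using N N2 by (simp add: exp_diff)
  qed
  moreover have "1 / N powr q \<le> 1 / N^2"
  proof -
    have "N powr 2 \<le> N powr q" using N \<open>q \<ge> 2\<close> by (intro powr_mono) auto
    then show ?thesis using N by (intro divide_left_mono) (auto simp: powr_numeral)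
  qed
  ultimately have "(1 + (N - 1) powr q) / N powr q \<le> 1 / N^2 + (N^2 - 2 * N - 1) / N^2"
    by (simp add: add_divide_distrib)
  also have "\<dots> = (N - 2) / N" using N by (simp add: power2_eq_square field_simps)
  finally show ?thesis by (simp add: N_def q_def)
qed

section \<open>Exponents just above 3\<close>

text \<open>The hypothesis says that y = (n - 1)^d lies below the larger root of (2 y - 1) (2 y - 2)
  = 1 / n^2. This root is at most 1 + 1 / (2 n^2), and 2 \<le> n - 1 bounds 2^d by y.\<close>

lemma two_powr_less_delta1:
  assumes n: "n \<ge> 3" and d: "0 < d" "d < delta1 n"
  shows "2 powr d \<le> 1 + 1 / (2 * real n ^ 2)"
proof -
  define N where "N = real n"
  have N: "N \<ge> 3" using n by (simp add: N_def)
  have "2 powr d \<le> (N - 1) powr d" using N d by (intro powr_mono2) auto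
  also have "\<dots> = exp (d * ln (N - 1))" using N by (simp add: powr_def)
  also have "d * ln (N - 1) \<le> ln (sqrt (N ^ 2 + 4) + 3 * N) - ln (4 * N)"
    using d(2) N by (simp add: delta1_def N_def field_simps)
  then have "exp (d * ln (N - 1)) \<le> exp (ln (sqrt (N ^ 2 + 4) + 3 * N) - ln (4 * N))" by simp
  also have "\<dots> = (sqrt (N ^ 2 + 4) + 3 * N) / (4 * N)"
    using N by (simp add: exp_diff add_nonneg_pos)
  also have "\<dots> \<le> ((N + 2 / N) + 3 * N) / (4 * N)"
  proof -
    have "sqrt (N ^ 2 + 4) \<le> N + 2 / N"
    proof (rule real_le_lsqrt)
      have "(N + 2 / N)^2 = N^2 + 4 + (2 / N)^2" using N by (simp add: power2_sum)
      then show "N ^ 2 + 4 \<le> (N + 2 / N)^2" by simp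
    qed (use N in auto)
    then show ?thesis using N by (intro divide_right_mono add_right_mono) auto
  qed
  also have "\<dots> = 1 + 1 / (2 * N^2)" using N by (simp add: power2_eq_square field_simps)
  finally show ?thesis by (simp add: N_def)
qed

text \<open>With 2^(p-1) = 4 e, the claim is polynomial in N and e; it is tightest at
  e = 1 + 1 / (2 N^2).\<close>
lemma three_value_constant_bound:
  fixes N e q :: real
  assumes N: "N \<ge> 3" and e: "1 \<le> e" "e \<le> 1 + 1 / (2 * N^2)" and q: "q \<ge> 2"
  shows "(N - 2) / N * (4 * e) + 2 * (1 - (N - 2) / N)^2 \<le> 1 / (4 * e + N - 2) * N * (2 * q)"
proof -
  define \<epsilon> where "\<epsilon> = 1 / (2 * N^2)"
  have "((N - 2) * N * e + 2) * (4 * e + N - 2) \<le> ((N - 2) * N * (1 + \<epsilon>) + 2) * (4 * (1 + \<epsilon>) + N - 2)"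
    using e N unfolding \<epsilon>_def by (intro mult_mono add_right_mono mult_left_mono diff_right_mono add_nonneg_nonneg) auto
  also have "\<dots> \<le> N^3"
  proof -
    have "N^3 * (((N - 2) * N * (1 + \<epsilon>) + 2) * (4 * (1 + \<epsilon>) + N - 2))
      = N^3 * N^3 - (3 * N^4 - 12 * N^3 + 12 * N^2 - 10 * N + 4) / 2"
      using N by (simp add: \<epsilon>_def eval_nat_numeral field_simps)
    moreover have "0 \<le> 3 * N^4 - 12 * N^3 + 12 * N^2 - 10 * N + 4"
    proof -
      \<comment> \<open>Shifting the origin to the smallest admissible N makes all coefficients
        positive; the constant term 1 shows how little room n = 3 leaves.\<close>
      define t where "t = N - 3"
      have "3 * N^4 - 12 * N^3 + 12 * N^2 - 10 * N + 4 = 3 * t^4 + 24 * t^3 + 66 * t^2 + 62 * t + 1"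
        by (simp add: t_def eval_nat_numeral algebra_simps)
      moreover have "t \<ge> 0" using N by (simp add: t_def)
      then have "0 \<le> 3 * t^4 + 24 * t^3 + 66 * t^2 + 62 * t + 1"
        by (intro add_nonneg_nonneg mult_nonneg_nonneg zero_le_power) auto
      ultimately show ?thesis by (simp only:)
    qed
    ultimately have "N^3 * (((N - 2) * N * (1 + \<epsilon>) + 2) * (4 * (1 + \<epsilon>) + N - 2)) \<le> N^3 * N^3" by simp
    then show ?thesis by (rule mult_left_le_imp_le) (use N in simp)
  qed
  finally have main: "((N - 2) * N * e + 2) * (4 * e + N - 2) \<le> N^3" .
  have pos: "4 * e + N - 2 > 0" using N e by simp
  have "(N - 2) / N * (4 * e) + 2 * (1 - (N - 2) / N)^2 = 4 / N^2 * ((N - 2) * N * e + 2)"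
    using N by (simp add: power2_eq_square field_simps)
  also have "\<dots> \<le> 4 / N^2 * (N^3 / (4 * e + N - 2))"
    using main pos by (intro mult_left_mono) (auto simp: pos_le_divide_eq)
  also have "\<dots> = 1 / (4 * e + N - 2) * N * 4" using N by (simp add: eval_nat_numeral)
  also have "\<dots> \<le> 1 / (4 * e + N - 2) * N * (2 * q)"
    using N q pos by (intro mult_left_mono) auto
  finally show ?thesis .
qed

lemma variation_bound_delta1:
  assumes n: "n \<ge> 3" and p: "3 < p" "p < 3 + delta1 n"
  shows "variation_bound p n (1 / (2 powr (p - 1) + real n - 2))"
proof (rule three_value_reduction[OF n p(1)])
  fix x :: "nat \<Rightarrow> real" and u v M
  assume uvM: "u \<in> {1..n}" "v \<in> {1..n}" "u \<noteq> v" "\<And>i. i \<in> {1..n} - {u, v} \<Longrightarrow> x i = M"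
    "x v \<le> M" "M \<le> x u" "(\<Sum>i=1..n. x i) = 0"
  define N where "N = real n"
  define \<eta> where "\<eta> = (N - 2) / N"
  define C where "C = 1 / (2 powr (p - 1) + N - 2)"
  have N: "N \<ge> 3" using n by (simp add: N_def)
  have eta: "0 < \<eta>" "\<eta> < 1" "N - 2 = N * \<eta>" using N by (simp_all add: \<eta>_def field_simps)
  have two: "2 powr (p - 1) = 4 * 2 powr (p - 3)" "2 powr p = 2 * 2 powr (p - 1)"
    using powr_add[of 2 2 "p - 3"] powr_add[of 2 1 "p - 1"] by simp_all
  have C0: "2 powr (p - 1) + N - 2 > 0" using N powr_gt_zero[of 2 "p - 1"] by linarith
  have start: "C * (2 powr p + 2 * (N - 2)) = 2" using C0 by (simp add: C_def two(2) field_simps)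
  have "1 \<le> 2 powr (p - 3)" using p by (simp add: ge_one_powr_ge_zero)
  \<comment> \<open>The slope condition for h near 0 with e = 2^(p-3); \<open>delta1\<close> keeps e
    in the range where it holds.\<close>
  then have c: "\<eta> * 2 powr (p - 1) + 2 * (1 - \<eta>)^2 \<le> C * N * (2 * (p - 1))"
    using three_value_constant_bound[OF N, of "2 powr (p - 3)" "p - 1"] two_powr_less_delta1[OF n, of "p - 3"] p
    by (simp add: C_def \<eta>_def two(1) N_def)
  have "0 \<le> C * N" using C0 N by (simp add: C_def)
  have "(\<Sum>i=1..n. \<bar>x i\<bar> powr p) \<le> C * (pair_sum p n x / 2)"
  proof (rule three_valued_inequality[OF n _ uvM], unfold N_def[symmetric] \<eta>_def[symmetric])
    show "(1 + \<eta> * h) powr p + (1 - \<eta> * h) powr p + (N - 2) * ((1 - \<eta>) * h) powr p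
      \<le> C * (2 powr p + (N - 2) * ((1 + h) powr p + (1 - h) powr p))" if "0 \<le> h" "h \<le> 1" for h
      using three_point_from_left[OF _ eta that start] three_point_gradient_nonneg[OF eta(1,2) _ _ _ c \<open>0 \<le> C * N\<close>] p
      by simp
  qed (use p in simp)
  then show "(\<Sum>i=1..n. \<bar>x i\<bar> powr p) \<le> 1 / (2 powr (p - 1) + real n - 2) * (pair_sum p n x / 2)"
    by (simp add: C_def N_def)
qed

section \<open>Functions attaining equality, sharpness and asymptotics\<close>

lemma symmetric_three_values_equality:
  fixes f :: "nat \<Rightarrow> real"
  assumes n: "n \<ge> 2" and p: "p > 1" and uv: "u \<in> {1..n}" "v \<in> {1..n}" "u \<noteq> v"
    and f: "f u = a + c" "f v = a - c" "\<And>i. i \<in> {1..n} - {u, v} \<Longrightarrow> f i = a"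
  shows "attains_equality p n (1 / (2 powr (p - 1) + real n - 2)) f"
proof -
  have S: "(\<Sum>i=1..n. F (f i)) = F (a + c) + F (a - c) + (real n - 2) * F a" for F :: "real \<Rightarrow> real"
    using sum_three_valued[of u n v f a F] uv f by simp
  have m: "mean n f = a" using S[of "\<lambda>t. t"] n by (simp add: mean_def field_simps)
  have L: "deviation p n f = 2 * \<bar>c\<bar> powr p"
    unfolding deviation_def m using S[of "\<lambda>t. \<bar>t - a\<bar> powr p"] p by simp
  have "pair_sum p n f / 2 = (2 * \<bar>c\<bar>) powr p + (real n - 2) * (2 * \<bar>c\<bar> powr p)"
    using pair_sum_three_valued[of p u n v f a] uv f p by (simp add: abs_mult)
  also have "(2 * \<bar>c\<bar>) powr p = 2 * 2 powr (p - 1) * \<bar>c\<bar> powr p"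
    using powr_add[of 2 1 "p - 1"] by (simp add: powr_mult)
  finally have V: "pair_sum p n f / 2 = (2 powr (p - 1) + real n - 2) * (2 * \<bar>c\<bar> powr p)"
    by (simp add: algebra_simps)
  have "2 powr (p - 1) + real n - 2 > 0" using n powr_gt_zero[of 2 "p - 1"] by linarith
  then show ?thesis using p L V by (simp add: attains_equality_def p_variation_powr)
qed

lemma dirac_delta_equality:
  assumes n: "n > 0" and p: "p > 1" and f: "dirac_delta n f"
  shows "attains_equality p n ((1 + (real n - 1) powr (p - 1)) / real n powr p) f"
proof -
  obtain A B where "f ` {1..n} = {A, B}" "card {i \<in> {1..n}. f i = A} = 1"
    using f unfolding dirac_delta_def by blast
  then show ?thesis using two_valued_equality[of f n A B p 1] n p by simp
qed

lemma sharp_variation_bound_dirac: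
  assumes n: "n \<ge> 3" and p: "p > 3"
    and hyp: "(1 + (real n - 1) powr (p - 1)) / real n powr (p - 1) \<le> (real n - 2) / real n"
  shows "sharp_variation_bound p n ((1 + (real n - 1) powr (p - 1)) / real n powr p)"
proof -
  define f where "f i = (if i = 1 then 1 else 0 :: real)" for i :: nat
  have "f ` {1..n} = {1, 0}"
  proof
    have "f 1 = 1" "f 2 = 0" "1 \<in> {1..n}" "2 \<in> {1..n}" using n by (auto simp: f_def)
    then show "{1, 0} \<subseteq> f ` {1..n}" by (metis empty_subsetI imageI insert_subset)
  qed (auto simp: f_def)
  moreover have "{i \<in> {1..n}. f i = 1} = {1}" using n by (auto simp: f_def split: if_splits)
  ultimately have "dirac_delta n f" unfolding dirac_delta_def by (intro exI[of _ 1] exI[of _ 0]) simp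
  then show ?thesis
    using n p by (intro sharp_variation_boundI[OF _ variation_bound_dirac[OF n p hyp] dirac_delta_equality, of f 1 2])
      (auto simp: f_def)
qed

lemma sharp_variation_bound_three_values:
  assumes n: "n \<ge> 3" and p: "2 < p \<and> p \<le> 3 \<or> 3 < p \<and> p < 3 + delta1 n"
  shows "sharp_variation_bound p n (1 / (2 powr (p - 1) + real n - 2))"
proof -
  define f where "f i = (if i = 1 then 1 else if i = 2 then - 1 else 0 :: real)" for i :: nat
  have "variation_bound p n (1 / (2 powr (p - 1) + real n - 2))"
    using p variation_bound_p_le_3[of n p] variation_bound_delta1[OF n, of p] n by auto
  moreover have "attains_equality p n (1 / (2 powr (p - 1) + real n - 2)) f"
    using n p by (intro symmetric_three_values_equality[of n p 1 2 f 0 1]) (auto simp: f_def)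
  ultimately show ?thesis
    using n p by (intro sharp_variation_boundI[of p n _ f 1 2]) (auto simp: f_def)
qed

lemma delta1_asymptotics:
  "(\<lambda>N. delta1 N - 1 / (2 * real N ^ 2 * ln (real N))) \<in> O(\<lambda>N. 1 / real N ^ 3)"
  unfolding delta1_def by real_asymp

lemma delta2_asymptotics:
  "(\<lambda>N. (3 + delta2 N) - (3 + 2 / real N)) \<in> O(\<lambda>N. 1 / real N ^ 2)"
  unfolding delta2_def by real_asymp

theorem theorem1:
  fixes n :: nat
  assumes n: "n \<ge> 3"
  shows
    "((\<forall>f. (\<Sum>i=1..n. \<bar>f i - mean n f\<bar>) \<le> 2 / real n * p_variation 1 n f) \<and>
      (\<forall>f a k. bij_betw a {1..n} {1..n} \<and> 1 \<le> k \<and> k < n \<and>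
          (\<forall>i j. 1 \<le> i \<and> i \<le> j \<and> j \<le> n \<longrightarrow> f (a i) \<ge> f (a j)) \<and>
          f (a k) \<ge> mean n f \<and> mean n f \<ge> f (a (k + 1)) \<longrightarrow>
        ((\<Sum>i=1..n. \<bar>f i - mean n f\<bar>) = 2 / real n * p_variation 1 n f \<longleftrightarrow>
          (\<forall>i\<in>{1..k}. f (a i) = f (a 1)) \<and> (\<forall>i\<in>{k+1..n}. f (a i) = f (a n)))))
     \<and>
     (\<forall>p C. 1 < p \<and> p < 2 \<and>
        C = (real_of_int \<lfloor>real n / 2\<rfloor> powr (p - 1) + real_of_int \<lceil>real n / 2\<rceil> powr (p - 1)) / real n powr p \<longrightarrow>
        variation_bound p n C \<and>
        (\<forall>f. maximizer p n C f \<longleftrightarrow>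
          (\<exists>A B. A > B \<and> f ` {1..n} = {A, B} \<and>
             int (card {i \<in> {1..n}. f i = A}) \<in> {\<lfloor>real n / 2\<rfloor>, \<lceil>real n / 2\<rceil>})))
     \<and>
     (\<forall>f. (\<Sum>i=1..n. \<bar>f i - mean n f\<bar> ^ 2) = 1 / real n * p_variation 2 n f ^ 2)
     \<and>
     ((\<forall>p C. (2 < p \<and> p \<le> 3 \<or> 3 < p \<and> p < 3 + delta1 n) \<and>
        C = 1 / (2 powr (p - 1) + real n - 2) \<longrightarrow>
        sharp_variation_bound p n C \<and>
        (\<forall>f a c u v. u \<in> {1..n} \<and> v \<in> {1..n} \<and> u \<noteq> v \<and>
            f u = a + c \<and> f v = a - c \<and> (\<forall>i\<in>{1..n} - {u, v}. f i = a) \<longrightarrow>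
          attains_equality p n C f \<and> (c \<noteq> 0 \<longrightarrow> maximizer p n C f))) \<and>
      (\<lambda>N. delta1 N - 1 / (2 * real N ^ 2 * ln (real N))) \<in> O(\<lambda>N. 1 / real N ^ 3))
     \<and>
     ((\<forall>p C. 3 < p \<and> p < 4 \<and>
        (real n - 2) / real n \<ge> (1 + (real n - 1) powr (p - 1)) / real n powr (p - 1) \<and>
        C = (1 + (real n - 1) powr (p - 1)) / real n powr p \<longrightarrow>
        sharp_variation_bound p n C \<and> (\<forall>f. dirac_delta n f \<longrightarrow> attains_equality p n C f)) \<and>
      (\<forall>p. 3 < p \<and> p < 4 \<and> p \<ge> 3 + delta2 n \<longrightarrow>
        (real n - 2) / real n \<ge> (1 + (real n - 1) powr (p - 1)) / real n powr (p - 1)) \<and>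
      (\<lambda>N. (3 + delta2 N) - (3 + 2 / real N)) \<in> O(\<lambda>N. 1 / real N ^ 2))
     \<and>
     (\<forall>p C. p \<ge> 4 \<and> C = (1 + (real n - 1) powr (p - 1)) / real n powr p \<longrightarrow>
        sharp_variation_bound p n C \<and> (\<forall>f. dirac_delta n f \<longrightarrow> attains_equality p n C f))"
proof (intro conjI allI impI)
  have n0: "n > 0" using n by simp
  fix f :: "nat \<Rightarrow> real"
  show "(\<Sum>i=1..n. \<bar>f i - mean n f\<bar>) \<le> 2 / real n * p_variation 1 n f"
    using n0 by (rule deviation_1)
  show "(\<Sum>i=1..n. \<bar>f i - mean n f\<bar> ^ 2) = 1 / real n * p_variation 2 n f ^ 2"
    using n0 by (rule deviation_2)
next
  fix f a k
  assume *: "bij_betw a {1..n} {1..n} \<and> 1 \<le> k \<and> k < n \<and>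
          (\<forall>i j. 1 \<le> i \<and> i \<le> j \<and> j \<le> n \<longrightarrow> f (a i) \<ge> f (a j)) \<and>
          f (a k) \<ge> mean n f \<and> mean n f \<ge> f (a (k + 1))"
  show "(\<Sum>i=1..n. \<bar>f i - mean n f\<bar>) = 2 / real n * p_variation 1 n f \<longleftrightarrow>
          (\<forall>i\<in>{1..k}. f (a i) = f (a 1)) \<and> (\<forall>i\<in>{k+1..n}. f (a i) = f (a n))"
    by (rule deviation_1_equality) (use * in blast)+
next
  fix p C
  assume *: "1 < p \<and> p < 2 \<and>
        C = (real_of_int \<lfloor>real n / 2\<rfloor> powr (p - 1) + real_of_int \<lceil>real n / 2\<rceil> powr (p - 1)) / real n powr p"
  then have p: "1 < p" "p < 2"
    and C: "C = (real_of_int \<lfloor>real n / 2\<rfloor> powr (p - 1) + real_of_int \<lceil>real n / 2\<rceil> powr (p - 1)) / real n powr p"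
    by auto
  have n2: "n \<ge> 2" using n by simp
  show "variation_bound p n C" by (rule variation_bound_p_less_2(1)[OF n2 p C])
  show "maximizer p n C f \<longleftrightarrow> (\<exists>A B. A > B \<and> f ` {1..n} = {A, B} \<and>
      int (card {i \<in> {1..n}. f i = A}) \<in> {\<lfloor>real n / 2\<rfloor>, \<lceil>real n / 2\<rceil>})" for f
    by (rule variation_bound_p_less_2(2)[OF n2 p C])
next
  fix p C
  assume *: "(2 < p \<and> p \<le> 3 \<or> 3 < p \<and> p < 3 + delta1 n) \<and> C = 1 / (2 powr (p - 1) + real n - 2)"
  then show "sharp_variation_bound p n C" using sharp_variation_bound_three_values[OF n] by blast
  fix f :: "nat \<Rightarrow> real" and a c :: real and u v :: nat
  assume f: "u \<in> {1..n} \<and> v \<in> {1..n} \<and> u \<noteq> v \<and>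
            f u = a + c \<and> f v = a - c \<and> (\<forall>i\<in>{1..n} - {u, v}. f i = a)"
  have "attains_equality p n (1 / (2 powr (p - 1) + real n - 2)) f"
    by (rule symmetric_three_values_equality[of n p u v f a c]) (use n * f in auto)
  with * show eq: "attains_equality p n C f" by simp
  assume "c \<noteq> 0"
  then have "f u \<noteq> f v" using f by simp
  then show "maximizer p n C f" unfolding maximizer_def using eq f by blast
next
  show "(\<lambda>N. delta1 N - 1 / (2 * real N ^ 2 * ln (real N))) \<in> O(\<lambda>N. 1 / real N ^ 3)"
    by (rule delta1_asymptotics)
next
  fix p C
  assume *: "3 < p \<and> p < 4 \<and>
        (real n - 2) / real n \<ge> (1 + (real n - 1) powr (p - 1)) / real n powr (p - 1) \<and>
        C = (1 + (real n - 1) powr (p - 1)) / real n powr p"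
  then show "sharp_variation_bound p n C" using sharp_variation_bound_dirac[OF n] by blast
  show "attains_equality p n C f" if "dirac_delta n f" for f
    using dirac_delta_equality[of n p f] that * n by simp
next
  fix p
  assume "3 < p \<and> p < 4 \<and> p \<ge> 3 + delta2 n"
  then show "(real n - 2) / real n \<ge> (1 + (real n - 1) powr (p - 1)) / real n powr (p - 1)"
    using dirac_condition_delta2[OF n] by blast
next
  show "(\<lambda>N. (3 + delta2 N) - (3 + 2 / real N)) \<in> O(\<lambda>N. 1 / real N ^ 2)"
    by (rule delta2_asymptotics)
next
  fix p C
  assume *: "p \<ge> 4 \<and> C = (1 + (real n - 1) powr (p - 1)) / real n powr p"
  then show "sharp_variation_bound p n C"
    using sharp_variation_bound_dirac[OF n] dirac_condition_ge_4[OF n] by force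
  show "attains_equality p n C f" if "dirac_delta n f" for f
    using dirac_delta_equality[of n p f] that * n by simp
qed

end
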